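(* Let $V$ be a finite-dimensional real vector space, $G\subset\mathrm{GL}(V)$ a Lie subgroup and $\mathfrak g=\mathrm{Lie}\,G$. The correspondence $H\mapsto S$, where $S=S^H\in\mathfrak g^{(1)}$ is the linear part of $\rho_{\mathfrak h}$, $\mathfrak h=\mathrm{Lie}\,H$, induces bijections $A'(G)\to C'(\mathfrak g)$ and $A(G)\to C(\mathfrak g)$. This defines on the set $A'(G)$ of Abelian almost simply transitive affine groups of type $G$ the structure of an affine cone over a quadratic projective real algebraic variety. The subset $A(G)\subset A'(G)$ consisting of simply transitive groups is a closed subvariety defined by a system of linear equations. Under the identification $A'(G)\cong C'(\mathfrak g)\subset\mathfrak g^{(1)}$ given by the bijection $H\mapsto S^H$, the action of $g\in G$ on $A'(G)$ by conjugation corresponds to the linear action $\mathfrak g^{(1)}\ni S\mapsto g\cdot S\in\mathfrak g^{(1)}$, where $(g\cdot S)_X:=gS_{g^{-1}X}g^{-1}$.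
   Context: $\mathrm{Aff}_G(V)$ is the group of affine transformations of $V$ with linear part in $G$; its Lie algebra is $\mathrm{aff}_{\mathfrak g}(V)=\mathfrak g+V$ (semidirect sum with the ideal $V$ of infinitesimal translations), with elements written $(S,t)$, $S\in\mathfrak g$ the linear part, $t\in V$ the translational part. An affine group of type $G$ is a connected Lie subgroup $H\subset\mathrm{Aff}_G(V)$. It is simply transitive if the orbit map $\varphi:H\to V$, $h\mapsto h0$, is a diffeomorphism, and almost simply transitive if $\varphi$ is an immersion and its differential $\phi:\mathfrak h\to V$, $X\mapsto X0$, is an isomorphism. $A'(G)$ (resp. $A(G)$) is the set of Abelian almost simply transitive (resp. simply transitive) affine groups of type $G$. For $H\in A'(G)$ with Lie algebra $\mathfrak h$ and inclusion $\iota:\mathfrak h\to\mathrm{aff}_{\mathfrak g}(V)$, $\rho_{\mathfrak h}:=\iota\circ\phi^{-1}:V\to\mathrm{aff}_{\mathfrak g}(V)$; it has the form $\rho_{\mathfrak h}(X)=(S_X,X)$, and $S:X\mapsto S_X$ is its linear part. The first prolongation is $\mathfrak g^{(1)}=(V^*\otimes\mathfrak g)\cap(S^2V^*\otimes V)$, i.e. linear maps $S:V\to\mathfrak g$ with $S_XY=S_YX$. $C'(\mathfrak g)=\{S\in\mathfrak g^{(1)}\mid[S_X,S_Y]=0\ \forall X,Y\in V\}$ and $C(\mathfrak g)=\{S\in C'(\mathfrak g)\mid\mathrm{tr}\,S_X=0\ \forall X\in V\}$. *)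

theory Defs
  imports "HOL-Analysis.Analysis" "HOL-Algebra.Group"
begin

section \<open>Smooth maps and immersed submanifolds\<close>

text \<open>
  All manifolds are immersed submanifolds of a normed space, which is finite-dimensional wherever
  the notions are used. Under that proviso, asking all directional derivatives to be of class
  \<open>C\<^sup>k\<close> is the same as asking the derivative to be of class \<open>C\<^sup>k\<close>.
\<close>

primrec Ck_on :: "nat \<Rightarrow> 'a::real_normed_vector set \<Rightarrow> ('a \<Rightarrow> 'b::real_normed_vector) \<Rightarrow> bool" where
  "Ck_on 0 S f \<longleftrightarrow> continuous_on S f"
| "Ck_on (Suc k) S f \<longleftrightarrow>
    (\<forall>x\<in>S. f differentiable (at x)) \<and> (\<forall>v. Ck_on k S (\<lambda>x. frechet_derivative f (at x) v))"

definition smooth_on :: "'a::real_normed_vector set \<Rightarrow> ('a \<Rightarrow> 'b::real_normed_vector) \<Rightarrow> bool" where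
  "smooth_on S f \<longleftrightarrow> (\<forall>k. Ck_on k S f)"

text \<open>
  An (injectively) immersed submanifold is given by its own topology \<open>M\<close>, which may be strictly
  finer than the subspace topology of its point set \<open>topspace M\<close>. Together with the inclusion it
  determines the smooth structure. The local parametrizations have as domains open subsets of
  linear subspaces \<open>W\<close> (in place of open subsets of some \<open>\<real>\<^sup>k\<close>). The Hausdorff property is
  automatic because \<open>M\<close> is finer than the subspace topology.
\<close>

definition immersed_submanifold :: "'e::real_normed_vector topology \<Rightarrow> bool" where
  "immersed_submanifold M \<longleftrightarrow>
    second_countable M \<and>
    (\<forall>p\<in>topspace M. \<exists>(W :: 'e set) (\<Omega> :: 'e set) \<psi>.
       subspace W \<and> open \<Omega> \<and> smooth_on \<Omega> \<psi> \<and>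
       (\<forall>x\<in>W \<inter> \<Omega>. inj_on (frechet_derivative \<psi> (at x)) W) \<and>
       p \<in> \<psi> ` (W \<inter> \<Omega>) \<and> openin M (\<psi> ` (W \<inter> \<Omega>)) \<and>
       homeomorphic_map (top_of_set (W \<inter> \<Omega>)) (subtopology M (\<psi> ` (W \<inter> \<Omega>))) \<psi>)"

text \<open>
  A map between immersed submanifolds is smooth iff it is continuous for the manifold topologies
  and locally (in the topology of the source) the restriction of a smooth map between open subsets
  of the ambient spaces. Continuity into \<open>N\<close> is what makes a map that is smooth into the ambient
  space of \<open>N\<close> smooth into \<open>N\<close>.
\<close>

definition smooth_map ::
  "'e::real_normed_vector topology \<Rightarrow> 'f::real_normed_vector topology \<Rightarrow> ('e \<Rightarrow> 'f) \<Rightarrow> bool" where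
  "smooth_map M N f \<longleftrightarrow>
    continuous_map M N f \<and>
    (\<forall>p\<in>topspace M. \<exists>U \<Omega> F. openin M U \<and> p \<in> U \<and> open \<Omega> \<and> U \<subseteq> \<Omega> \<and> smooth_on \<Omega> F \<and>
       (\<forall>x\<in>U. f x = F x))"

definition diffeomorphism ::
  "'e::real_normed_vector topology \<Rightarrow> 'f::real_normed_vector topology \<Rightarrow> ('e \<Rightarrow> 'f) \<Rightarrow> bool" where
  "diffeomorphism M N f \<longleftrightarrow>
    smooth_map M N f \<and>
    (\<exists>g. smooth_map N M g \<and> (\<forall>x\<in>topspace M. g (f x) = x) \<and> (\<forall>y\<in>topspace N. f (g y) = y))"

definition curve_through ::
  "'e::real_normed_vector topology \<Rightarrow> 'e \<Rightarrow> 'e \<Rightarrow> (real \<Rightarrow> 'e) \<Rightarrow> bool" where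
  "curve_through M p v c \<longleftrightarrow>
    (\<exists>\<epsilon>>0. smooth_map (top_of_set {-\<epsilon><..<\<epsilon>}) M c) \<and> c 0 = p \<and>
    (c has_vector_derivative v) (at 0)"

definition tangent_space :: "'e::real_normed_vector topology \<Rightarrow> 'e \<Rightarrow> 'e set" where
  "tangent_space M p = {v. \<exists>c. curve_through M p v c}"

definition differential ::
  "'e::real_normed_vector topology \<Rightarrow> ('e \<Rightarrow> 'f::real_normed_vector) \<Rightarrow> 'e \<Rightarrow> 'e \<Rightarrow> 'f" where
  "differential M f p v =
    (THE w. \<forall>c. curve_through M p v c \<longrightarrow> ((\<lambda>t. f (c t)) has_vector_derivative w) (at 0))"

definition immersion ::
  "'e::real_normed_vector topology \<Rightarrow> 'f::real_normed_vector topology \<Rightarrow> ('e \<Rightarrow> 'f) \<Rightarrow> bool" where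
  "immersion M N f \<longleftrightarrow>
    smooth_map M N f \<and> (\<forall>p\<in>topspace M. inj_on (differential M f p) (tangent_space M p))"

definition push_topology :: "('a \<Rightarrow> 'b) \<Rightarrow> 'a topology \<Rightarrow> 'b topology" where
  "push_topology f M = pullback_topology (f ` topspace M) (inv_into (topspace M) f) M"


section \<open>Lie subgroups of the general linear and the affine group\<close>

text \<open>
  A Lie subgroup of a group \<open>K\<close> whose elements lie in a normed space: a subgroup with the structure
  of an immersed submanifold (not necessarily embedded or closed) for which the group operations
  are smooth. Like an immersed submanifold, it is represented by its topology, the underlying
  group being \<open>topspace H\<close>.
\<close>

definition lie_subgroup :: "('e::real_normed_vector) monoid \<Rightarrow> 'e topology \<Rightarrow> bool" where
  "lie_subgroup K H \<longleftrightarrow>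
    subgroup (topspace H) K \<and> immersed_submanifold H \<and>
    smooth_map (prod_topology H H) H (\<lambda>(x, y). x \<otimes>\<^bsub>K\<^esub> y) \<and>
    smooth_map H H (\<lambda>x. inv\<^bsub>K\<^esub> x)"

definition lie_algebra :: "('e::real_normed_vector) monoid \<Rightarrow> 'e topology \<Rightarrow> 'e set" where
  "lie_algebra K H = tangent_space H \<one>\<^bsub>K\<^esub>"

definition GL :: "('v::real_normed_vector \<Rightarrow>\<^sub>L 'v) monoid" where
  "GL = units_of \<lparr>carrier = UNIV, mult = (o\<^sub>L), one = id_blinfun\<rparr>"

text \<open>The pair \<open>(L, s)\<close> stands for the affine transformation \<open>x \<mapsto> L x + s\<close>.\<close>

definition Aff :: "(('v::real_normed_vector \<Rightarrow>\<^sub>L 'v) \<times> 'v) monoid" where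
  "Aff = \<lparr>carrier = carrier GL \<times> UNIV,
          mult = (\<lambda>(L, s) (L', s'). (L o\<^sub>L L', blinfun_apply L s' + s)),
          one = (id_blinfun, 0)\<rparr>"

definition aff_apply :: "('v::real_normed_vector \<Rightarrow>\<^sub>L 'v) \<times> 'v \<Rightarrow> 'v \<Rightarrow> 'v" where
  "aff_apply h x = blinfun_apply (fst h) x + snd h"

definition Aff_G ::
  "('v::real_normed_vector \<Rightarrow>\<^sub>L 'v) topology \<Rightarrow> (('v \<Rightarrow>\<^sub>L 'v) \<times> 'v) topology" where
  "Aff_G G = prod_topology G euclidean"

definition affine_group_of_type ::
  "('v::real_normed_vector \<Rightarrow>\<^sub>L 'v) topology \<Rightarrow> (('v \<Rightarrow>\<^sub>L 'v) \<times> 'v) topology \<Rightarrow> bool" where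
  "affine_group_of_type G H \<longleftrightarrow>
    lie_subgroup Aff H \<and> immersion H (Aff_G G) (\<lambda>h. h) \<and> connected_space H"

definition orbit_map :: "('v::real_normed_vector \<Rightarrow>\<^sub>L 'v) \<times> 'v \<Rightarrow> 'v" where
  "orbit_map h = aff_apply h 0"

definition orbit_differential ::
  "(('v::real_normed_vector \<Rightarrow>\<^sub>L 'v) \<times> 'v) topology \<Rightarrow> ('v \<Rightarrow>\<^sub>L 'v) \<times> 'v \<Rightarrow> 'v" where
  "orbit_differential H = differential H orbit_map \<one>\<^bsub>Aff\<^esub>"

definition simply_transitive :: "(('v::real_normed_vector \<Rightarrow>\<^sub>L 'v) \<times> 'v) topology \<Rightarrow> bool" where
  "simply_transitive H \<longleftrightarrow> diffeomorphism H euclidean orbit_map"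

text \<open>The differential is automatically linear, so bijectivity makes it an isomorphism.\<close>

definition almost_simply_transitive ::
  "(('v::real_normed_vector \<Rightarrow>\<^sub>L 'v) \<times> 'v) topology \<Rightarrow> bool" where
  "almost_simply_transitive H \<longleftrightarrow>
    immersion H euclidean orbit_map \<and> bij_betw (orbit_differential H) (lie_algebra Aff H) UNIV"

definition abelian_groups_of_type ::
  "('v::real_normed_vector \<Rightarrow>\<^sub>L 'v) topology \<Rightarrow> (('v \<Rightarrow>\<^sub>L 'v) \<times> 'v) topology set" where
  "abelian_groups_of_type G =
    {H. affine_group_of_type G H \<and> comm_group (Aff\<lparr>carrier := topspace H\<rparr>)}"

definition AST ::
  "('v::real_normed_vector \<Rightarrow>\<^sub>L 'v) topology \<Rightarrow> (('v \<Rightarrow>\<^sub>L 'v) \<times> 'v) topology set" where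
  "AST G = {H \<in> abelian_groups_of_type G. almost_simply_transitive H}"

definition ST ::
  "('v::real_normed_vector \<Rightarrow>\<^sub>L 'v) topology \<Rightarrow> (('v \<Rightarrow>\<^sub>L 'v) \<times> 'v) topology set" where
  "ST G = {H \<in> abelian_groups_of_type G. simply_transitive H}"

definition rho ::
  "(('v::real_normed_vector \<Rightarrow>\<^sub>L 'v) \<times> 'v) topology \<Rightarrow> 'v \<Rightarrow> ('v \<Rightarrow>\<^sub>L 'v) \<times> 'v" where
  "rho H = inv_into (lie_algebra Aff H) (orbit_differential H)"

definition linear_part ::
  "(('v::real_normed_vector \<Rightarrow>\<^sub>L 'v) \<times> 'v) topology \<Rightarrow> 'v \<Rightarrow>\<^sub>L 'v \<Rightarrow>\<^sub>L 'v" where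
  "linear_part H = Blinfun (\<lambda>X. fst (rho H X))"

definition conj_group ::
  "('v::real_normed_vector \<Rightarrow>\<^sub>L 'v) \<Rightarrow> (('v \<Rightarrow>\<^sub>L 'v) \<times> 'v) topology \<Rightarrow> (('v \<Rightarrow>\<^sub>L 'v) \<times> 'v) topology"
  where
  "conj_group a H = push_topology (\<lambda>h. (a, 0) \<otimes>\<^bsub>Aff\<^esub> h \<otimes>\<^bsub>Aff\<^esub> inv\<^bsub>Aff\<^esub> (a, 0)) H"


section \<open>The first prolongation\<close>

definition prolongation ::
  "('v::real_normed_vector \<Rightarrow>\<^sub>L 'v) set \<Rightarrow> ('v \<Rightarrow>\<^sub>L 'v \<Rightarrow>\<^sub>L 'v) set" where
  "prolongation \<gg> =
    {S. (\<forall>X. blinfun_apply S X \<in> \<gg>) \<and>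
        (\<forall>X Y. blinfun_apply (blinfun_apply S X) Y = blinfun_apply (blinfun_apply S Y) X)}"

definition bracket :: "('v::real_normed_vector \<Rightarrow>\<^sub>L 'v) \<Rightarrow> ('v \<Rightarrow>\<^sub>L 'v) \<Rightarrow> 'v \<Rightarrow>\<^sub>L 'v" where
  "bracket P Q = (P o\<^sub>L Q) - (Q o\<^sub>L P)"

text \<open>The trace does not depend on the chosen basis (of a finite-dimensional space).\<close>

definition endo_trace :: "('v::real_normed_vector \<Rightarrow>\<^sub>L 'v) \<Rightarrow> real" where
  "endo_trace P =
    (let B = (SOME B. independent B \<and> span B = UNIV)
     in \<Sum>b\<in>B. representation B (blinfun_apply P b) b)"

definition C' :: "('v::real_normed_vector \<Rightarrow>\<^sub>L 'v) set \<Rightarrow> ('v \<Rightarrow>\<^sub>L 'v \<Rightarrow>\<^sub>L 'v) set" where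
  "C' \<gg> =
    {S \<in> prolongation \<gg>. \<forall>X Y. bracket (blinfun_apply S X) (blinfun_apply S Y) = 0}"

definition C0 :: "('v::real_normed_vector \<Rightarrow>\<^sub>L 'v) set \<Rightarrow> ('v \<Rightarrow>\<^sub>L 'v \<Rightarrow>\<^sub>L 'v) set" where
  "C0 \<gg> = {S \<in> C' \<gg>. \<forall>X. endo_trace (blinfun_apply S X) = 0}"

definition act ::
  "('v::real_normed_vector \<Rightarrow>\<^sub>L 'v) \<Rightarrow> ('v \<Rightarrow>\<^sub>L 'v \<Rightarrow>\<^sub>L 'v) \<Rightarrow> 'v \<Rightarrow>\<^sub>L 'v \<Rightarrow>\<^sub>L 'v" where
  "act a S =
    Blinfun (\<lambda>X. a o\<^sub>L blinfun_apply S (blinfun_apply (inv\<^bsub>GL\<^esub> a) X) o\<^sub>L inv\<^bsub>GL\<^esub> a)"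


section \<open>Quadratic projective varieties and affine cones\<close>

definition projective_space :: "'e::real_vector set \<Rightarrow> 'e set set" where
  "projective_space E = {l. subspace l \<and> l \<subseteq> E \<and> dim l = 1}"

definition quadratic_form :: "('e::real_vector \<Rightarrow> real) \<Rightarrow> bool" where
  "quadratic_form q \<longleftrightarrow> (\<exists>b. bilinear b \<and> (\<forall>x. q x = b x x))"

definition quadratic_projective_variety :: "'e::real_vector set \<Rightarrow> 'e set set \<Rightarrow> bool" where
  "quadratic_projective_variety E Z \<longleftrightarrow>
    subspace E \<and>
    (\<exists>Q. finite Q \<and> (\<forall>q\<in>Q. quadratic_form q) \<and>
         Z = {l \<in> projective_space E. \<forall>q\<in>Q. \<forall>x\<in>l. q x = 0})"

definition affine_cone :: "'e::real_vector set set \<Rightarrow> 'e set" where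
  "affine_cone Z = insert 0 (\<Union>Z)"

end

theory Submission
  imports Defs
begin

text \<open>
  An element \<open>S\<close> of \<open>C' \<gg>\<close> turns \<open>V\<close> into a commutative associative algebra with product
  \<open>x y = S\<^sub>x y\<close>. Adjoining a unit, the invertible elements \<open>1 + x\<close> form a group with composition
  \<open>x + y + x y\<close>, and \<open>x \<mapsto> (1 + S\<^sub>x, x)\<close> embeds it into the affine group.

  Conversely, differentiating \<open>h c(t) = c(t) h\<close> for a curve \<open>c\<close> through the identity of an abelian group
  \<open>H\<close> shows that \<open>L X = X + S\<^sub>X s\<close> for every \<open>h = (L, s)\<close> in \<open>H\<close>, so by symmetry \<open>L = 1 + S\<^sub>s\<close>. Hence
  \<open>H\<close> lies on this graph; as its projection to \<open>V\<close> is open by the inverse function theorem and \<open>H\<close> is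
  connected, \<open>H\<close> is exactly the graph over the component of \<open>0\<close> in the set of all \<open>x\<close> with \<open>1 + S\<^sub>x\<close>
  invertible, with its subspace topology. That \<open>x \<mapsto> 1 + S\<^sub>x\<close> is continuous into the possibly finer
  topology of \<open>G\<close> follows from its logarithmic derivative being in \<open>\<gg>\<close>.

  Simple transitivity means that all \<open>1 + S\<^sub>x\<close> are invertible, which for such an algebra is equivalent
  to nilpotency of all \<open>S\<^sub>x\<close>, and this in turn to the vanishing of all their traces.
\<close>

section \<open>Finite-dimensional normed spaces\<close>

text \<open>A group is represented by its topology, so injectivity of the correspondence demands
  that \<open>S\<close> determine the topology of \<open>H\<close> and not only its points. Passing
  to a component is forced: for V = R with x y the ordinary product, 1 + S_x is invertible exactly
  for x \<noteq> -1. The graph map is affine in x, so the graph is an open piece of a translated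
  linear subspace and has one global chart. The obstacle on the other side is that \<open>G\<close>
  may be merely immersed, like a dense line in a torus: a point of \<open>G\<close> near 1 in GL can
  be far from 1 in \<open>G\<close>, so continuity into \<open>G\<close> has to be obtained along
  with membership. Trace zero suffices for nilpotency because all positive powers of S_x are again
  of the form S_z: the linear conditions on \<open>S\<close> already control the traces of all these
  powers, and idempotents do the work of eigenvalues. Finite dimension is a hypothesis on the space
  and is carried as a predicate on types, which passes to products and to spaces of linear
  maps.\<close>

definition fin_dim :: "'a::real_vector itself \<Rightarrow> bool" where
  "fin_dim _ \<longleftrightarrow> (\<exists>B::'a set. finite B \<and> span B = UNIV)"

lemma fin_dim_basis:
  assumes "fin_dim TYPE('a::real_vector)"
  obtains B :: "'a::real_vector set" where "finite B" "independent B" "span B = UNIV"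
proof -
  obtain A :: "'a set" where A: "finite A" "span A = UNIV" using assms by (auto simp: fin_dim_def)
  obtain B where B: "B \<subseteq> A" "independent B" "A \<subseteq> span B"
    using maximal_independent_subset[of A] by blast
  have "span B = UNIV" using B(3) A(2) by (metis span_mono span_span top.extremum_uniqueI)
  then show thesis using that B A finite_subset by blast
qed

text \<open>One half of the equivalence of the norm with the maximum norm of coordinates;
  completeness of spans and boundedness of linear maps both come from it.\<close>

definition coord_bounded :: "'a::real_normed_vector set \<Rightarrow> bool" where
  "coord_bounded B \<longleftrightarrow> (\<exists>C\<ge>0. \<forall>c. \<forall>b\<in>B. \<bar>c b\<bar> \<le> C * norm (\<Sum>b\<in>B. c b *\<^sub>R b))"

lemma complete_span_if_coord_bounded:
  assumes "finite (B::'a::real_normed_vector set)" "coord_bounded B"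
  shows "complete (span B)"
proof (rule completeI)
  fix f :: "nat \<Rightarrow> 'a"
  assume f: "\<forall>n. f n \<in> span B" and Cauchy: "Cauchy f"
  obtain C where C: "C \<ge> 0" "\<And>c b. b \<in> B \<Longrightarrow> \<bar>c b\<bar> \<le> C * norm (\<Sum>b\<in>B. c b *\<^sub>R b)"
    using assms(2) by (auto simp: coord_bounded_def)
  have "\<forall>n. \<exists>c. f n = (\<Sum>b\<in>B. c b *\<^sub>R b)"
    using f span_finite[OF assms(1)] by auto
  then obtain c where c: "\<And>n. f n = (\<Sum>b\<in>B. c n b *\<^sub>R b)" by metis
  have "convergent (\<lambda>n. c n b)" if b: "b \<in> B" for b
  proof -
    have le: "\<bar>c m b - c n b\<bar> \<le> C * norm (f m - f n)" for m n
      using C(2)[OF b, of "\<lambda>b. c m b - c n b"] by (simp add: c scaleR_diff_left sum_subtractf)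
    have "Cauchy (\<lambda>n. c n b)"
    proof (rule metric_CauchyI)
      fix e :: real assume "e > 0"
      then obtain M where M: "\<And>m n. m \<ge> M \<Longrightarrow> n \<ge> M \<Longrightarrow> dist (f m) (f n) < e / (C + 1)"
        using metric_CauchyD[OF Cauchy, of "e / (C+1)"] C(1) by auto
      have "dist (c m b) (c n b) < e" if "m \<ge> M" "n \<ge> M" for m n
      proof -
        have "\<bar>c m b - c n b\<bar> \<le> C * norm (f m - f n)" by (rule le)
        also have "\<dots> \<le> (C + 1) * norm (f m - f n)" by (simp add: mult_right_mono)
        also have "\<dots> < e" using M[OF that] C(1) by (simp add: dist_norm field_simps)
        finally show ?thesis by (simp add: dist_real_def)
      qed
      then show "\<exists>M. \<forall>m\<ge>M. \<forall>n\<ge>M. dist (c m b) (c n b) < e" by blast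
    qed
    then show ?thesis by (rule real_Cauchy_convergent)
  qed
  then have "\<forall>b\<in>B. \<exists>l. (\<lambda>n. c n b) \<longlonglongrightarrow> l" by (auto simp: convergent_def)
  then obtain l where l: "\<And>b. b \<in> B \<Longrightarrow> (\<lambda>n. c n b) \<longlonglongrightarrow> l b" by metis
  have "f \<longlonglongrightarrow> (\<Sum>b\<in>B. l b *\<^sub>R b)"
    unfolding c by (intro tendsto_intros l)
  moreover have "(\<Sum>b\<in>B. l b *\<^sub>R b) \<in> span B"
    by (intro span_sum span_scale span_base)
  ultimately show "\<exists>l\<in>span B. f \<longlonglongrightarrow> l" by blast
qed

text \<open>Induction on \<open>B\<close>: the span of the smaller set is complete, hence closed, so
  the new vector has a positive distance \<open>d\<close> from it, and this distance bounds its
  coefficient.\<close>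

lemma independent_coord_bounded:
  assumes "finite (B::'a::real_normed_vector set)" "independent B"
  shows "coord_bounded B"
  using assms
proof (induction B rule: finite_induct)
  case empty
  then show ?case by (auto simp: coord_bounded_def intro: exI[of _ 0])
next
  case (insert b B)
  have ind: "independent B" and nb: "b \<notin> span B"
    using insert by (auto simp: independent_insert)
  then have cb: "coord_bounded B" using insert by blast
  obtain C where C: "C \<ge> 0" "\<And>c b. b \<in> B \<Longrightarrow> \<bar>c b\<bar> \<le> C * norm (\<Sum>b\<in>B. c b *\<^sub>R b)"
    using cb by (auto simp: coord_bounded_def)
  have "closed (span B)"
    by (rule complete_imp_closed[OF complete_span_if_coord_bounded[OF insert(1) cb]])
  then have "open (- span B)" by (simp add: open_Compl)
  then obtain d where d: "d > 0" "ball b d \<subseteq> - span B"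
    using nb by (meson ComplI openE)
  have d': "d \<le> norm (b - s)" if "s \<in> span B" for s
    using d(2) that by (force simp: subset_iff dist_norm not_less[symmetric])
  have scale: "\<bar>t\<bar> * d \<le> norm (t *\<^sub>R b + s)" if "s \<in> span B" for t s
  proof (cases "t = 0")
    case False
    have "(- 1 / t) *\<^sub>R s \<in> span B" using that by (rule span_scale)
    then have "d \<le> norm (b - (- 1 / t) *\<^sub>R s)" by (rule d')
    then have "\<bar>t\<bar> * d \<le> \<bar>t\<bar> * norm (b - (- 1 / t) *\<^sub>R s)" by (simp add: mult_left_mono)
    also have "\<dots> = norm (t *\<^sub>R (b - (- 1 / t) *\<^sub>R s))" by simp
    also have "t *\<^sub>R (b - (- 1 / t) *\<^sub>R s) = t *\<^sub>R b + s" using False by (simp add: algebra_simps)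
    finally show ?thesis .
  qed auto
  \<comment> \<open>The first entry bounds the coefficient of \<open>b\<close>; the second bounds
    the others, where removing the \<open>b\<close> term from the sum enlarges its norm at most by
    the factor 1 + norm b / d.\<close>
  define K where "K = max (1 / d) (C * (1 + norm b / d))"
  have "\<bar>c a\<bar> \<le> K * norm (\<Sum>b\<in>insert b B. c b *\<^sub>R b)" if a: "a \<in> insert b B" for c a
  proof -
    define s where "s = (\<Sum>b\<in>B. c b *\<^sub>R b)"
    have s: "s \<in> span B" unfolding s_def by (intro span_sum span_scale span_base)
    have eq: "(\<Sum>b\<in>insert b B. c b *\<^sub>R b) = c b *\<^sub>R b + s"
      using insert by (simp add: s_def)
    have cbb: "\<bar>c b\<bar> \<le> (1 / d) * norm (c b *\<^sub>R b + s)"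
      using scale[OF s, of "c b"] d(1) by (simp add: field_simps)
    show ?thesis
    proof (cases "a = b")
      case True
      have "(1 / d) * norm (c b *\<^sub>R b + s) \<le> K * norm (c b *\<^sub>R b + s)"
        by (intro mult_right_mono) (auto simp: K_def)
      with cbb True eq show ?thesis by simp
    next
      case False
      then have "a \<in> B" using a by auto
      then have "\<bar>c a\<bar> \<le> C * norm s" unfolding s_def by (rule C(2))
      also have "norm s \<le> norm (c b *\<^sub>R b + s) + norm (c b *\<^sub>R b)"
        by (metis add_diff_cancel_left' norm_triangle_ineq4)
      also have "norm (c b *\<^sub>R b) \<le> (1 / d) * norm (c b *\<^sub>R b + s) * norm b"
        using mult_right_mono[OF cbb norm_ge_zero[of b]] by simp
      finally have "\<bar>c a\<bar> \<le> C * (norm (c b *\<^sub>R b + s) + 1 / d * norm (c b *\<^sub>R b + s) * norm b)"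
        using C(1) by (simp add: mult_left_mono)
      also have "\<dots> = C * (1 + norm b / d) * norm (c b *\<^sub>R b + s)" by (simp add: algebra_simps)
      also have "\<dots> \<le> K * norm (c b *\<^sub>R b + s)"
        by (intro mult_right_mono) (auto simp: K_def)
      finally show ?thesis using eq by simp
    qed
  qed
  moreover have "K \<ge> 0" using d(1) by (simp add: K_def le_max_iff_disj)
  ultimately show ?case unfolding coord_bounded_def by blast
qed

lemma fin_dim_bounded_linear:
  fixes f :: "'a::real_normed_vector \<Rightarrow> 'b::real_normed_vector"
  assumes fd: "fin_dim TYPE('a)" and f: "linear f"
  shows "bounded_linear f"
proof -
  obtain B :: "'a set" where B: "finite B" "independent B" "span B = UNIV"
    using fin_dim_basis[OF fd] .
  obtain C where C: "C \<ge> 0" "\<And>c b. b \<in> B \<Longrightarrow> \<bar>c b\<bar> \<le> C * norm (\<Sum>b\<in>B. c b *\<^sub>R b)"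
    using independent_coord_bounded[OF B(1,2)] by (auto simp: coord_bounded_def)
  interpret linear f by fact
  have "norm (f x) \<le> norm x * (C * (\<Sum>b\<in>B. norm (f b)))" for x
  proof -
    obtain c where c: "x = (\<Sum>b\<in>B. c b *\<^sub>R b)"
      using B(3) span_finite[OF B(1)] by auto
    have "norm (f x) = norm (\<Sum>b\<in>B. c b *\<^sub>R f b)" by (simp add: c sum scale)
    also have "\<dots> \<le> (\<Sum>b\<in>B. \<bar>c b\<bar> * norm (f b))"
      by (rule order_trans[OF norm_sum]) simp
    also have "\<dots> \<le> (\<Sum>b\<in>B. (C * norm x) * norm (f b))"
      by (intro sum_mono mult_right_mono) (auto simp: c intro: C(2))
    also have "\<dots> = norm x * (C * (\<Sum>b\<in>B. norm (f b)))"
      by (simp add: sum_distrib_left algebra_simps)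
    finally show ?thesis .
  qed
  then show ?thesis by unfold_locales blast
qed

lemma fin_dim_finite_independent:
  assumes fd: "fin_dim TYPE('a::real_vector)" and "independent (A::'a set)"
  shows "finite A"
proof -
  obtain B :: "'a set" where B: "finite B" "independent B" "span B = UNIV"
    using fin_dim_basis[OF fd] .
  show ?thesis using independent_span_bound[OF B(1) assms(2)] B(3) by simp
qed

lemma fin_dim_complete_subspace:
  assumes fd: "fin_dim TYPE('a::real_normed_vector)" and W: "subspace (W::'a set)"
  shows "complete W"
proof -
  obtain A where A: "A \<subseteq> W" "independent A" "W \<subseteq> span A"
    using maximal_independent_subset[of W] by blast
  have "finite A" using fin_dim_finite_independent[OF fd A(2)] .
  moreover have "span A = W" using A W by (metis span_minimal subset_antisym)
  ultimately show ?thesis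
    using complete_span_if_coord_bounded independent_coord_bounded A by metis
qed

lemma fin_dim_complete_UNIV:
  "fin_dim TYPE('a::real_normed_vector) \<Longrightarrow> complete (UNIV::'a set)"
  by (simp add: fin_dim_complete_subspace)

lemma fin_dim_inj_imp_surj:
  fixes f :: "'a::real_vector \<Rightarrow> 'a"
  assumes fd: "fin_dim TYPE('a)" and f: "linear f" "inj f"
  shows "surj f"
proof -
  obtain B :: "'a set" where B: "finite B" "independent B" "span B = UNIV"
    using fin_dim_basis[OF fd] .
  interpret fd: finite_dimensional_vector_space "scaleR :: real \<Rightarrow> 'a \<Rightarrow> 'a" B
    by unfold_locales (use B in \<open>auto simp: real_vector.scale_right_distrib dependent_raw_def span_raw_def\<close>)
  show ?thesis using fd.linear_inj_imp_surj f by (simp add: linear_def)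
qed

lemma fin_dim_of_locale:
  assumes "finite_dimensional_vector_space (scaleR :: real \<Rightarrow> 'a::real_vector \<Rightarrow> 'a) B"
  shows "fin_dim TYPE('a)"
proof -
  interpret fd: finite_dimensional_vector_space "scaleR :: real \<Rightarrow> 'a \<Rightarrow> 'a" B by fact
  show ?thesis unfolding fin_dim_def
    using fd.finite_Basis fd.span_Basis by (auto simp: span_raw_def)
qed

lemma fin_dim_prod:
  assumes "fin_dim TYPE('a::real_vector)" "fin_dim TYPE('b::real_vector)"
  shows "fin_dim TYPE('a \<times> 'b)"
proof -
  obtain A :: "'a set" where A: "finite A" "span A = UNIV" using assms by (auto simp: fin_dim_def)
  obtain B :: "'b set" where B: "finite B" "span B = UNIV" using assms by (auto simp: fin_dim_def)
  let ?C = "(\<lambda>a. (a, 0::'b)) ` A \<union> (\<lambda>b. (0::'a, b)) ` B"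
  have l1: "linear (\<lambda>a. (a, 0::'b))" by (rule linearI) auto
  have l2: "linear (\<lambda>b. (0::'a, b))" by (rule linearI) auto
  have "(x, y) \<in> span ?C" for x y
  proof -
    have "(x, 0) \<in> span ((\<lambda>a. (a, 0::'b)) ` A)"
      unfolding linear_span_image[OF l1] using A by auto
    moreover have "(0, y) \<in> span ((\<lambda>b. (0::'a, b)) ` B)"
      unfolding linear_span_image[OF l2] using B by auto
    ultimately have "(x, 0) \<in> span ?C" "(0, y) \<in> span ?C"
      by (meson span_mono subsetD sup_ge1 sup_ge2)+
    from span_add[OF this] show ?thesis by simp
  qed
  then have "span ?C = UNIV" by auto
  then show ?thesis unfolding fin_dim_def using A B by (intro exI[of _ ?C]) auto
qed

lemma representation_linear:
  assumes "independent B" "span B = UNIV"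
  shows "linear (\<lambda>x. representation B x b)"
  using assms by (intro linearI) (auto simp: representation_add representation_scale)

lemma fin_dim_blinfun:
  assumes "fin_dim TYPE('a::real_normed_vector)" "fin_dim TYPE('b::real_normed_vector)"
  shows "fin_dim TYPE('a \<Rightarrow>\<^sub>L 'b)"
proof -
  obtain A :: "'a set" where A: "finite A" "independent A" "span A = UNIV"
    using fin_dim_basis[OF assms(1)] .
  obtain B :: "'b set" where B: "finite B" "independent B" "span B = UNIV"
    using fin_dim_basis[OF assms(2)] .
  \<comment> \<open>The matrix units for the bases \<open>A\<close> and \<open>B\<close>.\<close>
  define e where "e = (\<lambda>(a, b::'b). Blinfun (\<lambda>x. representation A x a *\<^sub>R b))"
  have e: "e (a, b) x = representation A x a *\<^sub>R b" for a b x
  proof -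
    have "linear (\<lambda>x. representation A x a *\<^sub>R b)"
      using A by (intro linearI) (auto simp: representation_add representation_scale scaleR_add_left)
    then show ?thesis using assms(1)
      by (simp add: e_def fin_dim_bounded_linear bounded_linear_Blinfun_apply)
  qed
  have "f \<in> span (e ` (A \<times> B))" for f :: "'a \<Rightarrow>\<^sub>L 'b"
  proof -
    have "f = (\<Sum>a\<in>A. \<Sum>b\<in>B. representation B (f a) b *\<^sub>R e (a, b))"
    proof (rule blinfun_eqI)
      fix x
      have x: "x = (\<Sum>a\<in>A. representation A x a *\<^sub>R a)"
        using sum_representation_eq[OF A(2), of x A] A by auto
      have fa: "(\<Sum>b\<in>B. representation B (f a) b *\<^sub>R b) = f a" for a
        using sum_representation_eq[OF B(2), of "f a" B] B by auto
      have "f x = (\<Sum>a\<in>A. representation A x a *\<^sub>R f a)"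
        by (subst x) (simp add: blinfun.sum_right blinfun.scaleR_right)
      also have "\<dots> = (\<Sum>a\<in>A. \<Sum>b\<in>B. representation A x a *\<^sub>R representation B (f a) b *\<^sub>R b)"
        by (subst fa[symmetric]) (simp add: scaleR_sum_right)
      also have "\<dots> = (\<Sum>a\<in>A. \<Sum>b\<in>B. representation B (f a) b *\<^sub>R e (a, b)) x"
        by (simp add: blinfun.sum_left blinfun.scaleR_left e algebra_simps)
      finally show "f x = \<dots>" .
    qed
    also have "\<dots> \<in> span (e ` (A \<times> B))"
      by (intro span_sum span_scale span_base) auto
    finally show ?thesis .
  qed
  then have "span (e ` (A \<times> B)) = UNIV" by auto
  then show ?thesis unfolding fin_dim_def using A B by (intro exI[of _ "e ` (A \<times> B)"]) auto
qed

text \<open>Rational multiples of the new vector are added to a countable set that approximates the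
  old span. This feeds the second countability demanded of an immersed submanifold.\<close>

lemma span_finite_separable:
  assumes "finite (B::'a::real_normed_vector set)"
  shows "\<exists>D. countable D \<and> (\<forall>x\<in>span B. \<forall>e>0. \<exists>d\<in>D. dist d x < e)"
  using assms
proof (induction B rule: finite_induct)
  case empty
  then show ?case by (intro exI[of _ "{0}"]) auto
next
  case (insert b B)
  then obtain D where D: "countable D" "\<forall>x\<in>span B. \<forall>e>0. \<exists>d\<in>D. dist d x < e" by blast
  let ?D = "(\<lambda>(q, d). q *\<^sub>R b + d) ` (\<rat> \<times> D)"
  have "\<exists>d\<in>?D. dist d x < e" if x: "x \<in> span (insert b B)" and e: "e > 0" for x e
  proof -
    obtain k where k: "x - k *\<^sub>R b \<in> span B" using x by (auto simp: span_insert)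
    then obtain d where d: "d \<in> D" "dist d (x - k *\<^sub>R b) < e / 2" using D(2) e by (meson half_gt_zero)
    obtain q where q: "q \<in> \<rat>" "\<bar>q - k\<bar> < e / (2 * (norm b + 1))"
    proof -
      have "k < k + e / (2 * (norm b + 1))" using e by (simp add: add_nonneg_pos)
      from Rats_dense_in_real[OF this] obtain r where "r \<in> \<rat>" "k < r" "r < k + e / (2 * (norm b + 1))"
        by blast
      then show thesis by (intro that[of r]) auto
    qed
    have "\<bar>q - k\<bar> * norm b \<le> \<bar>q - k\<bar> * (norm b + 1)" by (simp add: mult_left_mono)
    also have "\<dots> < e / 2"
    proof -
      have "0 < 2 * (norm b + 1)" by (simp add: add_nonneg_pos)
      from q(2)[unfolded pos_less_divide_eq[OF this]] show ?thesis by linarith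
    qed
    finally have 1: "norm ((q - k) *\<^sub>R b) < e / 2" by simp
    have "q *\<^sub>R b + d - x = (q - k) *\<^sub>R b + (d - (x - k *\<^sub>R b))" by (simp add: algebra_simps)
    then have "dist (q *\<^sub>R b + d) x \<le> norm ((q - k) *\<^sub>R b) + norm (d - (x - k *\<^sub>R b))"
      by (metis dist_norm norm_triangle_ineq)
    also have "\<dots> < e" using 1 d(2) by (simp add: dist_norm)
    finally show ?thesis using q d by (intro bexI[of _ "q *\<^sub>R b + d"]) auto
  qed
  moreover have "countable ?D" using D(1) countable_rat by auto
  ultimately show ?case by (intro exI[of _ ?D]) auto
qed

lemma fin_dim_second_countable:
  assumes fd: "fin_dim TYPE('a::real_normed_vector)"
  shows "second_countable (euclidean :: 'a topology)"
proof -
  obtain B :: "'a set" where B: "finite B" "span B = UNIV" using fd by (auto simp: fin_dim_def)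
  obtain D :: "'a set" where D: "countable D" "\<And>x e. e > 0 \<Longrightarrow> \<exists>d\<in>D. dist d x < e"
    using span_finite_separable[OF B(1)] B(2) by auto
  let ?B = "(\<lambda>(d, r). ball d r) ` (D \<times> \<rat>)"
  have "\<exists>V\<in>?B. x \<in> V \<and> V \<subseteq> U" if U: "open U" "x \<in> U" for U x
  proof -
    obtain e where e: "e > 0" "ball x e \<subseteq> U" using U openE by blast
    obtain r where r: "r \<in> \<rat>" "0 < r" "r < e / 2"
      using Rats_dense_in_real[of 0 "e/2"] e by auto
    obtain d where d: "d \<in> D" "dist d x < r" using D(2) r by blast
    have "ball d r \<subseteq> U"
    proof
      fix y assume "y \<in> ball d r"
      then have "dist x y < e" using d r dist_triangle[of x y d] by (simp add: dist_commute)
      then show "y \<in> U" using e by auto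
    qed
    then show ?thesis using d r by (intro bexI[of _ "ball d r"]) auto
  qed
  moreover have "countable ?B" using D(1) countable_rat by auto
  ultimately show ?thesis unfolding second_countable_def
    by (intro exI[of _ ?B]) (auto simp: open_openin[symmetric])
qed

section \<open>Calculus of smooth functions\<close>

lemma Ck_on_SucD_derivative:
  assumes "Ck_on (Suc k) S f" "x \<in> S"
  shows "(f has_derivative frechet_derivative f (at x)) (at x)"
  using assms by (simp add: frechet_derivative_works[symmetric])

text \<open>Openness of \<open>S\<close> matters: a derivative sees a neighbourhood of the point,
  not just the values on \<open>S\<close>.\<close>

lemma Ck_on_cong_imp:
  assumes "open S" "\<And>x. x \<in> S \<Longrightarrow> f x = g x" "Ck_on k S f"
  shows "Ck_on k S g"
  using assms(2,3)
proof (induction k arbitrary: f g)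
  case 0
  then show ?case using continuous_on_cong[of S S f g] by auto
next
  case (Suc k)
  have der: "(g has_derivative frechet_derivative f (at x)) (at x)" if "x \<in> S" for x
    using has_derivative_transform_within_open[OF Ck_on_SucD_derivative[OF Suc.prems(2) that] assms(1) that]
      Suc.prems(1) by blast
  have "Ck_on k S (\<lambda>x. frechet_derivative g (at x) v)" for v
  proof (rule Suc.IH)
    show "Ck_on k S (\<lambda>x. frechet_derivative f (at x) v)" using Suc.prems(2) by simp
    show "frechet_derivative f (at x) v = frechet_derivative g (at x) v" if "x \<in> S" for x
      using frechet_derivative_at[OF der[OF that]] by simp
  qed
  then show ?case using der by (auto simp: differentiable_def)
qed

text \<open>The source of the closure rules below: an explicit derivative \<open>D\<close> may stand
  in for the chosen \<open>frechet_derivative\<close>.\<close>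

lemma Ck_on_SucI:
  assumes "open S" "\<And>x. x \<in> S \<Longrightarrow> (f has_derivative D x) (at x)"
    and "\<And>v. Ck_on k S (\<lambda>x. D x v)"
  shows "Ck_on (Suc k) S f"
proof -
  have "Ck_on k S (\<lambda>x. frechet_derivative f (at x) v)" for v
    by (rule Ck_on_cong_imp[OF assms(1) _ assms(3)])
      (use frechet_derivative_at[OF assms(2)] in auto)
  then show ?thesis using assms(2) by (auto simp: differentiable_def)
qed

lemma Ck_on_subset: "Ck_on k S f \<Longrightarrow> T \<subseteq> S \<Longrightarrow> Ck_on k T f"
  by (induction k arbitrary: f) (auto intro: continuous_on_subset)

lemma Ck_on_SucD: "Ck_on (Suc k) S f \<Longrightarrow> Ck_on k S f"
proof (induction k arbitrary: f)
  case 0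
  then show ?case
    by (auto intro!: continuous_at_imp_continuous_on differentiable_imp_continuous_within)
next
  case (Suc k)
  then show ?case by (metis Ck_on.simps(2))
qed

lemma Ck_on_continuous: "Ck_on k S f \<Longrightarrow> continuous_on S f"
  by (induction k) (auto dest: Ck_on_SucD simp del: Ck_on.simps(2))

lemma Ck_on_const: "Ck_on k S (\<lambda>x. c)"
  by (induction k arbitrary: c) (auto simp: frechet_derivative_const)

lemma Ck_on_bounded_linear:
  assumes "bounded_linear L" shows "Ck_on k S L"
proof (cases k)
  case 0
  then show ?thesis using assms by (simp add: linear_continuous_on)
next
  case (Suc n)
  have "frechet_derivative L (at x) = L" for x
    using frechet_derivative_at[OF bounded_linear_imp_has_derivative[OF assms]] by simp
  then show ?thesis
    using bounded_linear_imp_differentiable[OF assms] Suc by (simp add: Ck_on_const)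
qed

lemma Ck_on_add:
  assumes "open S" "Ck_on k S f" "Ck_on k S g"
  shows "Ck_on k S (\<lambda>x. f x + g x)"
  using assms(2,3)
proof (induction k arbitrary: f g)
  case 0
  then show ?case by (auto intro: continuous_on_add)
next
  case (Suc k)
  show ?case
  proof (rule Ck_on_SucI[OF assms(1)])
    show "((\<lambda>x. f x + g x) has_derivative
      (\<lambda>v. frechet_derivative f (at x) v + frechet_derivative g (at x) v)) (at x)" if "x \<in> S" for x
      using Ck_on_SucD_derivative[OF _ that] Suc.prems by (intro has_derivative_add)
    show "Ck_on k S (\<lambda>x. frechet_derivative f (at x) v + frechet_derivative g (at x) v)" for v
      using Suc by simp
  qed
qed

lemma Ck_on_sum:
  assumes "open S" "finite A" "\<And>i. i \<in> A \<Longrightarrow> Ck_on k S (f i)"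
  shows "Ck_on k S (\<lambda>x. \<Sum>i\<in>A. f i x)"
  using assms(2,3) by (induction A rule: finite_induct) (auto intro: Ck_on_const Ck_on_add[OF assms(1)])

lemma Ck_on_bilinear:
  assumes "open S" "bounded_bilinear B" "Ck_on k S f" "Ck_on k S g"
  shows "Ck_on k S (\<lambda>x. B (f x) (g x))"
  using assms(3,4)
proof (induction k arbitrary: f g)
  case 0
  then show ?case using bounded_bilinear.continuous_on[OF assms(2)] by auto
next
  case (Suc k)
  show ?case
  proof (rule Ck_on_SucI[OF assms(1)])
    show "((\<lambda>x. B (f x) (g x)) has_derivative
      (\<lambda>v. B (f x) (frechet_derivative g (at x) v) + B (frechet_derivative f (at x) v) (g x))) (at x)"
      if "x \<in> S" for x
      by (rule bounded_bilinear.FDERIV[OF assms(2) Ck_on_SucD_derivative[OF Suc.prems(1) that]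
          Ck_on_SucD_derivative[OF Suc.prems(2) that]])
    show "Ck_on k S (\<lambda>x. B (f x) (frechet_derivative g (at x) v) + B (frechet_derivative f (at x) v) (g x))" for v
      using Suc.prems Ck_on_SucD[OF Suc.prems(1)] Ck_on_SucD[OF Suc.prems(2)]
      by (intro Ck_on_add assms(1) Suc.IH) auto
  qed
qed

lemma Ck_on_bounded_linear_compose:
  assumes "bounded_linear L" "Ck_on k S f" "open S"
  shows "Ck_on k S (\<lambda>x. L (f x))"
  using assms(2)
proof (induction k arbitrary: f)
  case 0
  then show ?case using bounded_linear.continuous_on[OF assms(1)] by auto
next
  case (Suc k)
  show ?case
  proof (rule Ck_on_SucI[OF assms(3)])
    show "((\<lambda>x. L (f x)) has_derivative (\<lambda>v. L (frechet_derivative f (at x) v))) (at x)"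
      if "x \<in> S" for x
      using Ck_on_SucD_derivative[OF _ that] Suc.prems by (intro bounded_linear.has_derivative[OF assms(1)])
    show "Ck_on k S (\<lambda>x. L (frechet_derivative f (at x) v))" for v
      using Suc by simp
  qed
qed

text \<open>The chain rule yields a derivative of \<open>g\<close> in a direction that varies with
  the point, whereas \<open>Ck_on\<close> speaks of fixed directions. Expanding the direction in a
  basis of the middle space gives a finite sum of products of a coordinate and a derivative in a
  fixed direction.\<close>

lemma Ck_on_compose:
  fixes f :: "'a::real_normed_vector \<Rightarrow> 'b::real_normed_vector" and g :: "'b \<Rightarrow> 'c::real_normed_vector"
  assumes fd: "fin_dim TYPE('b)" and S: "open S"
    and fg: "Ck_on k S f" "Ck_on k T g" "f ` S \<subseteq> T"
  shows "Ck_on k S (\<lambda>x. g (f x))"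
  using fg(1,2)
proof (induction k arbitrary: g)
  case 0
  then show ?case using continuous_on_compose2[of T g S f] fg(3) by auto
next
  case (Suc k)
  obtain B :: "'b set" where B: "finite B" "independent B" "span B = UNIV"
    using fin_dim_basis[OF fd] .
  show ?case
  proof (rule Ck_on_SucI[OF S])
    fix x assume x: "x \<in> S"
    then have fx: "f x \<in> T" using fg(3) by auto
    have df: "(f has_derivative frechet_derivative f (at x)) (at x)"
      by (rule Ck_on_SucD_derivative[OF Suc.prems(1) x])
    have dg: "(g has_derivative frechet_derivative g (at (f x))) (at (f x))"
      by (rule Ck_on_SucD_derivative[OF Suc.prems(2) fx])
    have "frechet_derivative g (at (f x)) w = (\<Sum>b\<in>B. representation B w b *\<^sub>R frechet_derivative g (at (f x)) b)" for w
    proof -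
      interpret D: linear "frechet_derivative g (at (f x))"
        using dg has_derivative_linear by blast
      have "(\<Sum>b\<in>B. representation B w b *\<^sub>R b) = w"
        using sum_representation_eq[OF B(2), of w B] B by auto
      moreover have "frechet_derivative g (at (f x)) (\<Sum>b\<in>B. representation B w b *\<^sub>R b)
          = (\<Sum>b\<in>B. representation B w b *\<^sub>R frechet_derivative g (at (f x)) b)"
        by (simp add: D.sum D.scale)
      ultimately show ?thesis by simp
    qed
    then have eq: "(\<lambda>v. frechet_derivative g (at (f x)) (frechet_derivative f (at x) v)) =
        (\<lambda>v. \<Sum>b\<in>B. representation B (frechet_derivative f (at x) v) b *\<^sub>R frechet_derivative g (at (f x)) b)"
      by (rule ext)
    show "((\<lambda>x. g (f x)) has_derivative
        (\<lambda>v. \<Sum>b\<in>B. representation B (frechet_derivative f (at x) v) b *\<^sub>R frechet_derivative g (at (f x)) b)) (at x)"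
      using has_derivative_compose[OF df dg] unfolding eq .
  next
    fix v
    show "Ck_on k S (\<lambda>x. \<Sum>b\<in>B. representation B (frechet_derivative f (at x) v) b *\<^sub>R frechet_derivative g (at (f x)) b)"
    proof (intro Ck_on_sum[OF S] B Ck_on_bilinear[OF S bounded_bilinear_scaleR])
      fix b assume "b \<in> B"
      have "Ck_on k S (\<lambda>x. frechet_derivative f (at x) v)" using Suc.prems(1) by simp
      then show "Ck_on k S (\<lambda>x. representation B (frechet_derivative f (at x) v) b)"
        by (rule Ck_on_bounded_linear_compose[OF fin_dim_bounded_linear[OF fd representation_linear[OF B(2,3)]] _ S])
      have "Ck_on k T (\<lambda>y. frechet_derivative g (at y) b)" using Suc.prems(2) by simp
      then show "Ck_on k S (\<lambda>x. frechet_derivative g (at (f x)) b)"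
        by (rule Suc.IH[OF Ck_on_SucD[OF Suc.prems(1)]])
    qed
  qed
qed

lemma smooth_on_subset: "smooth_on S f \<Longrightarrow> T \<subseteq> S \<Longrightarrow> smooth_on T f"
  unfolding smooth_on_def using Ck_on_subset by blast

lemma smooth_on_const: "smooth_on S (\<lambda>x. c)"
  by (simp add: smooth_on_def Ck_on_const)

lemma smooth_on_bounded_linear: "bounded_linear L \<Longrightarrow> smooth_on S L"
  by (simp add: smooth_on_def Ck_on_bounded_linear)

lemma smooth_on_ident: "smooth_on S (\<lambda>x. x)"
  by (rule smooth_on_bounded_linear[OF bounded_linear_ident])

lemma smooth_on_add:
  "open S \<Longrightarrow> smooth_on S f \<Longrightarrow> smooth_on S g \<Longrightarrow> smooth_on S (\<lambda>x. f x + g x)"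
  by (simp add: smooth_on_def Ck_on_add)

lemma smooth_on_bilinear:
  "open S \<Longrightarrow> bounded_bilinear B \<Longrightarrow> smooth_on S f \<Longrightarrow> smooth_on S g \<Longrightarrow> smooth_on S (\<lambda>x. B (f x) (g x))"
  by (simp add: smooth_on_def Ck_on_bilinear)

lemma smooth_on_bounded_linear_compose:
  "bounded_linear L \<Longrightarrow> smooth_on S f \<Longrightarrow> open S \<Longrightarrow> smooth_on S (\<lambda>x. L (f x))"
  by (simp add: smooth_on_def Ck_on_bounded_linear_compose)

lemma bounded_linear_Pair_left: "bounded_linear (\<lambda>a. (a, 0))"
  by (rule bounded_linear_Pair[OF bounded_linear_ident bounded_linear_zero])

lemma bounded_linear_Pair_right: "bounded_linear (\<lambda>b. (0, b))"
  by (rule bounded_linear_Pair[OF bounded_linear_zero bounded_linear_ident])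

lemma smooth_on_Pair:
  assumes "open S" "smooth_on S f" "smooth_on S g"
  shows "smooth_on S (\<lambda>x. (f x, g x))"
  using smooth_on_add[OF assms(1) smooth_on_bounded_linear_compose[OF bounded_linear_Pair_left assms(2,1)]
      smooth_on_bounded_linear_compose[OF bounded_linear_Pair_right assms(3,1)]] by simp

lemma smooth_on_compose:
  fixes f :: "'a::real_normed_vector \<Rightarrow> 'b::real_normed_vector" and g :: "'b \<Rightarrow> 'c::real_normed_vector"
  assumes "fin_dim TYPE('b)" "open S" "smooth_on S f" "smooth_on T g" "f ` S \<subseteq> T"
  shows "smooth_on S (\<lambda>x. g (f x))"
  using assms(3,4) Ck_on_compose[OF assms(1,2) _ _ assms(5)] unfolding smooth_on_def by blast

lemma smooth_on_continuous: "smooth_on S f \<Longrightarrow> continuous_on S f"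
  unfolding smooth_on_def using Ck_on_continuous by blast

lemma smooth_on_has_derivative:
  "smooth_on S f \<Longrightarrow> x \<in> S \<Longrightarrow> (f has_derivative frechet_derivative f (at x)) (at x)"
  unfolding smooth_on_def using Ck_on_SucD_derivative by blast

lemma smooth_on_continuous_derivative:
  "smooth_on S f \<Longrightarrow> continuous_on S (\<lambda>x. frechet_derivative f (at x) v)"
  unfolding smooth_on_def by (metis Ck_on.simps)

section \<open>Smooth maps between immersed submanifolds\<close>

lemma smooth_mapI_global:
  assumes "continuous_map M N f" "smooth_on \<Omega> F" "open \<Omega>" "topspace M \<subseteq> \<Omega>" "\<And>x. x \<in> topspace M \<Longrightarrow> f x = F x"
  shows "smooth_map M N f"
  unfolding smooth_map_def using assms openin_topspace by blast

text \<open>The local extension of \<open>g\<close> is valid on a set open in the topology of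
  \<open>N\<close>; it is pulled back to \<open>M\<close> by continuity of \<open>f\<close> into
  \<open>N\<close>, which is stronger than continuity into the ambient space.\<close>

lemma smooth_map_compose:
  fixes M :: "'a::real_normed_vector topology" and N :: "'b::real_normed_vector topology"
    and P :: "'c::real_normed_vector topology"
  assumes fd: "fin_dim TYPE('b)" and f: "smooth_map M N f" and g: "smooth_map N P g"
  shows "smooth_map M P (g \<circ> f)"
proof -
  have cf: "continuous_map M N f" and cg: "continuous_map N P g"
    using f g by (auto simp: smooth_map_def)
  have "\<exists>U \<Omega> F. openin M U \<and> p \<in> U \<and> open \<Omega> \<and> U \<subseteq> \<Omega> \<and> smooth_on \<Omega> F \<and> (\<forall>x\<in>U. (g \<circ> f) x = F x)"
    if p: "p \<in> topspace M" for p
  proof -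
    obtain U \<Omega> F where F: "openin M U" "p \<in> U" "open \<Omega>" "U \<subseteq> \<Omega>" "smooth_on \<Omega> F" "\<And>x. x \<in> U \<Longrightarrow> f x = F x"
      using f p by (auto simp: smooth_map_def)
    have "f p \<in> topspace N" using cf p by (auto simp: continuous_map_def)
    then obtain U' \<Omega>' F' where F': "openin N U'" "f p \<in> U'" "open \<Omega>'" "U' \<subseteq> \<Omega>'" "smooth_on \<Omega>' F'" "\<And>x. x \<in> U' \<Longrightarrow> g x = F' x"
      using g by (auto simp: smooth_map_def)
    let ?U = "U \<inter> {x \<in> topspace M. f x \<in> U'}" and ?O = "\<Omega> \<inter> F -` \<Omega>'"
    have oO: "open ?O"
      using continuous_open_preimage[OF smooth_on_continuous[OF F(5)] F(3) F'(3)] .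
    have "openin M ?U" using F(1) openin_continuous_map_preimage[OF cf F'(1)] by blast
    moreover have "p \<in> ?U" using p F F' by auto
    moreover have "?U \<subseteq> ?O" using F F' by auto
    moreover have "smooth_on ?O (\<lambda>x. F' (F x))"
      by (rule smooth_on_compose[OF fd oO smooth_on_subset[OF F(5)] F'(5)]) auto
    moreover have "\<forall>x\<in>?U. (g \<circ> f) x = F' (F x)" using F F' by auto
    ultimately show ?thesis using oO by blast
  qed
  then show ?thesis unfolding smooth_map_def using continuous_map_compose[OF cf cg] by blast
qed

lemma curve_through_image:
  fixes M :: "'a::real_normed_vector topology" and N :: "'b::real_normed_vector topology"
  assumes fd: "fin_dim TYPE('a)" and f: "smooth_map M N f" and c: "curve_through M p v c"
    and w: "((\<lambda>t. f (c t)) has_vector_derivative w) (at 0)"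
  shows "curve_through N (f p) w (\<lambda>t. f (c t))"
  using c w smooth_map_compose[OF fd _ f] unfolding curve_through_def o_def by blast

section \<open>Inverse functions and tangent spaces\<close>

lemma bounded_linear_pos_bound:
  assumes "bounded_linear f"
  obtains K where "K > 0" "\<And>x. norm (f x) \<le> K * norm x"
  using bounded_linear.pos_bounded[OF assms] by (auto simp: mult.commute)

text \<open>\<open>smooth_on\<close> gives continuity of the derivative one direction at a time;
  coordinates combine the finitely many basis directions into continuity in the operator
  norm.\<close>

lemma smooth_on_derivative_near:
  fixes f :: "'a::real_normed_vector \<Rightarrow> 'b::real_normed_vector"
  assumes fd: "fin_dim TYPE('a)" and \<Omega>: "open \<Omega>" "x0 \<in> \<Omega>" and f: "smooth_on \<Omega> f" and e: "e > 0"
  obtains r where "r > 0" "ball x0 r \<subseteq> \<Omega>"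
    "\<And>x v. x \<in> ball x0 r \<Longrightarrow> norm (frechet_derivative f (at x) v - frechet_derivative f (at x0) v) \<le> e * norm v"
proof -
  obtain B :: "'a set" where B: "finite B" "independent B" "span B = UNIV"
    using fin_dim_basis[OF fd] .
  obtain C where C: "C \<ge> 0" "\<And>c b. b \<in> B \<Longrightarrow> \<bar>c b\<bar> \<le> C * norm (\<Sum>b\<in>B. c b *\<^sub>R b)"
    using independent_coord_bounded[OF B(1,2)] by (auto simp: coord_bounded_def)
  define D where "D x = frechet_derivative f (at x)" for x
  \<comment> \<open>Dominates the operator norm of \<open>D x - D x0\<close>, is continuous in
    \<open>x\<close> on \<open>\<Omega>\<close>, and vanishes at \<open>x0\<close>.\<close>
  define s where "s x = C * (\<Sum>b\<in>B. norm (D x b - D x0 b))" for x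
  have "continuous_on \<Omega> s"
    unfolding s_def D_def by (intro continuous_intros smooth_on_continuous_derivative[OF f])
  then have "isCont s x0" using \<Omega> by (simp add: continuous_on_eq_continuous_at)
  then obtain r1 where "r1 > 0" "\<And>x. dist x x0 < r1 \<Longrightarrow> dist (s x) (s x0) < e"
    using e unfolding continuous_at_eps_delta by blast
  moreover have "s x0 = 0" by (simp add: s_def)
  ultimately have r1: "r1 > 0" "\<And>x. dist x x0 < r1 \<Longrightarrow> s x < e"
    by (auto simp: dist_real_def abs_less_iff)
  obtain r2 where r2: "r2 > 0" "ball x0 r2 \<subseteq> \<Omega>" using \<Omega> openE by blast
  have "norm (D x v - D x0 v) \<le> e * norm v" if x: "x \<in> ball x0 (min r1 r2)" for x v
  proof -
    have "x \<in> \<Omega>" using x r2 by auto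
    then interpret Dx: linear "D x"
      unfolding D_def using smooth_on_has_derivative[OF f] has_derivative_linear by blast
    interpret D0: linear "D x0"
      unfolding D_def using smooth_on_has_derivative[OF f \<Omega>(2)] has_derivative_linear by blast
    obtain c where c: "v = (\<Sum>b\<in>B. c b *\<^sub>R b)" using B span_finite[OF B(1)] by auto
    have "D x v - D x0 v = (\<Sum>b\<in>B. c b *\<^sub>R (D x b - D x0 b))"
      by (simp add: c Dx.sum Dx.scale D0.sum D0.scale scaleR_diff_right sum_subtractf)
    also have "norm \<dots> \<le> (\<Sum>b\<in>B. (C * norm v) * norm (D x b - D x0 b))"
    proof (rule order_trans[OF norm_sum], rule sum_mono)
      fix b assume "b \<in> B"
      then have "\<bar>c b\<bar> * norm (D x b - D x0 b) \<le> (C * norm v) * norm (D x b - D x0 b)"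
        unfolding c by (intro mult_right_mono C(2)) auto
      then show "norm (c b *\<^sub>R (D x b - D x0 b)) \<le> (C * norm v) * norm (D x b - D x0 b)" by simp
    qed
    also have "\<dots> = s x * norm v" by (simp add: s_def sum_distrib_left sum_distrib_right algebra_simps)
    also have "\<dots> \<le> e * norm v"
      using r1(2)[of x] x by (intro mult_right_mono) (auto simp: dist_commute)
    finally show ?thesis .
  qed
  moreover have "ball x0 (min r1 r2) \<subseteq> \<Omega>" "min r1 r2 > 0" using r1(1) r2 by auto
  ultimately show thesis using that unfolding D_def by blast
qed

text \<open>With the derivative at \<open>x0\<close> normalised to the identity,
  \<open>f x - x\<close> is a contraction near \<open>x0\<close>. Only differentiability of the
  local inverse is asserted: later arguments use its values and its first derivative.\<close>

lemma inverse_function: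
  fixes f :: "'a::real_normed_vector \<Rightarrow> 'a"
  assumes fd: "fin_dim TYPE('a)" and \<Omega>: "open \<Omega>" "x0 \<in> \<Omega>" and f: "smooth_on \<Omega> f"
    and f0: "(f has_derivative (\<lambda>v. v)) (at x0)"
  obtains \<delta> k where "\<delta> > 0" "k (f x0) = x0" "k ` ball (f x0) \<delta> \<subseteq> \<Omega>"
    "\<And>y. y \<in> ball (f x0) \<delta> \<Longrightarrow> f (k y) = y"
    "\<And>y. y \<in> ball (f x0) \<delta> \<Longrightarrow> k differentiable (at y)"
proof -
  define D where "D x = frechet_derivative f (at x)" for x
  have D0: "D x0 = (\<lambda>v. v)" using frechet_derivative_at[OF f0] by (simp add: D_def)
  have derf: "(f has_derivative D x) (at x)" if "x \<in> \<Omega>" for x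
    unfolding D_def by (rule smooth_on_has_derivative[OF f that])
  obtain r0 where r0: "r0 > 0" "ball x0 r0 \<subseteq> \<Omega>"
    and near0: "\<And>x v. x \<in> ball x0 r0 \<Longrightarrow> norm (D x v - v) \<le> (1/2) * norm v"
    using smooth_on_derivative_near[OF fd \<Omega> f, of "1/2"] D0 unfolding D_def by auto
  \<comment> \<open>Half the radius, so that the closed ball, which is complete, still lies where
    the derivative estimate holds.\<close>
  define r where "r = r0 / 2"
  have r: "r > 0" "cball x0 r \<subseteq> ball x0 r0" using r0 by (auto simp: r_def)
  have near: "norm (D x v - v) \<le> (1/2) * norm v" if "x \<in> cball x0 r" for x v
    using near0 r that by blast
  have cO: "cball x0 r \<subseteq> \<Omega>" using r r0 by blast
  have contr: "norm ((f x - x) - (f y - y)) \<le> 1/2 * norm (x - y)"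
    if "x \<in> cball x0 r" "y \<in> cball x0 r" for x y
  proof (rule differentiable_bound[of "cball x0 r" "\<lambda>x. f x - x" "\<lambda>x v. D x v - v"])
    show "((\<lambda>x. f x - x) has_derivative (\<lambda>v. D x v - v)) (at x within cball x0 r)" if "x \<in> cball x0 r" for x
    proof -
      have "x \<in> \<Omega>" using that cO by blast
      then show ?thesis
        by (intro has_derivative_diff has_derivative_ident has_derivative_at_withinI[OF derf])
    qed
    show "onorm (\<lambda>v. D x v - v) \<le> 1/2" if "x \<in> cball x0 r" for x
      using near[OF that] by (intro onorm_bound) auto
  qed (use that in auto)
  have lip: "norm (x - y) \<le> 2 * norm (f x - f y)" if "x \<in> cball x0 r" "y \<in> cball x0 r" for x y
  proof -
    have "x - y = (f x - f y) - ((f x - x) - (f y - y))" by simp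
    then have "norm (x - y) \<le> norm (f x - f y) + norm ((f x - x) - (f y - y))"
      by (metis norm_triangle_ineq4)
    then show ?thesis using contr[OF that] by simp
  qed
  have ex: "\<exists>x\<in>cball x0 r. f x = y" if y: "y \<in> ball (f x0) (r/2)" for y
  proof -
    \<comment> \<open>A fixed point of \<open>\<lambda>x. y - (f x - x)\<close> is a solution of
      \<open>f x = y\<close>. The radius \<open>r/2\<close> for \<open>y\<close> leaves the other
      \<open>r/2\<close> for the contraction, so the ball is mapped to itself.\<close>
    have "\<exists>!x\<in>cball x0 r. y - (f x - x) = x"
    proof (rule Banach_fix[of "cball x0 r" "1/2"])
      show "complete (cball x0 r)"
        using complete_Int_closed[OF fin_dim_complete_UNIV[OF fd], of "cball x0 r"] by simp
      show "(\<lambda>x. y - (f x - x)) ` cball x0 r \<subseteq> cball x0 r"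
      proof clarify
        fix x assume x: "x \<in> cball x0 r"
        have "x0 - (y - (f x - x)) = (f x0 - y) + ((f x - x) - (f x0 - x0))" by simp
        then have "norm (x0 - (y - (f x - x))) \<le> norm (f x0 - y) + norm ((f x - x) - (f x0 - x0))"
          by (metis norm_triangle_ineq)
        also have "\<dots> \<le> r / 2 + 1/2 * norm (x - x0)"
          using y contr[OF x, of x0] r by (intro add_mono) (auto simp: dist_norm)
        also have "\<dots> \<le> r" using x by (simp add: dist_norm norm_minus_commute)
        finally show "y - (f x - x) \<in> cball x0 r" by (simp add: dist_norm)
      qed
      fix u v assume "u \<in> cball x0 r" "v \<in> cball x0 r"
      from contr[OF this] show "dist (y - (f u - u)) (y - (f v - v)) \<le> 1/2 * dist u v"
        by (simp add: dist_norm norm_minus_commute algebra_simps)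
    qed (use r in auto)
    then obtain x where "x \<in> cball x0 r" "y - (f x - x) = x" by auto
    then show ?thesis by (intro bexI[of _ x]) (auto simp: algebra_simps)
  qed
  define k where "k y = (SOME x. x \<in> cball x0 r \<and> f x = y)" for y
  have k: "k y \<in> cball x0 r" "f (k y) = y" if "y \<in> ball (f x0) (r/2)" for y
    using someI_ex[OF ex[OF that, unfolded Bex_def]] unfolding k_def by auto
  have fx0: "f x0 \<in> ball (f x0) (r/2)" using r by simp
  have k0: "k (f x0) = x0"
    using lip[OF k(1)[OF fx0], of x0] k(2)[OF fx0] r by simp
  have klip: "norm (k y - k z) \<le> 2 * norm (y - z)"
    if "y \<in> ball (f x0) (r/2)" "z \<in> ball (f x0) (r/2)" for y z
    using lip[OF k(1)[OF that(1)] k(1)[OF that(2)]] k(2) that by simp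
  have "k differentiable (at y)" if y: "y \<in> ball (f x0) (r/2)" for y
  proof -
    have ky: "k y \<in> cball x0 r" "k y \<in> \<Omega>" using k(1)[OF y] cO by auto
    have linD: "linear (D (k y))" using derf[OF ky(2)] has_derivative_linear by blast
    have "inj (D (k y))"
    proof (subst linear_injective_0[OF linD], clarify)
      fix v assume "D (k y) v = 0"
      then show "v = 0" using near[OF ky(1), of v] by simp
    qed
    then obtain g where g: "linear g" "g \<circ> D (k y) = id"
      using linear_injective_left_inverse[OF linD] by blast
    have cont: "continuous (at y) k"
    proof -
      have "continuous_on (ball (f x0) (r/2)) k"
      proof (rule lipschitz_on_continuous_on[of 2])
        show "2-lipschitz_on (ball (f x0) (r/2)) k"
          by (rule lipschitz_onI) (auto simp: dist_norm klip)
      qed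
      then show ?thesis using y by (simp add: continuous_on_eq_continuous_at)
    qed
    have "(k has_derivative g) (at y)"
      by (rule has_derivative_inverse_basic[OF derf[OF ky(2)] fin_dim_bounded_linear[OF fd g(1)] g(2) cont
            open_ball y k(2)])
    then show ?thesis by (auto simp: differentiable_def)
  qed
  moreover have "k ` ball (f x0) (r/2) \<subseteq> \<Omega>" using k(1) cO by blast
  moreover have "r / 2 > 0" using r by simp
  ultimately show thesis using that k0 k(2) by blast
qed

section \<open>Charts, curves and tangent spaces\<close>

definition chart :: "'e::real_normed_vector topology \<Rightarrow> 'e set \<Rightarrow> 'e set \<Rightarrow> ('e \<Rightarrow> 'e) \<Rightarrow> bool" where
  "chart M W \<Omega> \<psi> \<longleftrightarrow> subspace W \<and> open \<Omega> \<and> smooth_on \<Omega> \<psi> \<and>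
       (\<forall>x\<in>W \<inter> \<Omega>. inj_on (frechet_derivative \<psi> (at x)) W) \<and> openin M (\<psi> ` (W \<inter> \<Omega>)) \<and>
       homeomorphic_map (top_of_set (W \<inter> \<Omega>)) (subtopology M (\<psi> ` (W \<inter> \<Omega>))) \<psi>"

lemma immersed_submanifold_chart:
  assumes "immersed_submanifold M" "p \<in> topspace M"
  obtains W \<Omega> \<psi> w where "chart M W \<Omega> \<psi>" "w \<in> W" "w \<in> \<Omega>" "\<psi> w = p"
proof -
  have "\<exists>W \<Omega> \<psi>. chart M W \<Omega> \<psi> \<and> p \<in> \<psi> ` (W \<inter> \<Omega>)"
    using bspec[OF conjunct2[OF assms(1)[unfolded immersed_submanifold_def]] assms(2)]
    unfolding chart_def by (elim exE conjE) (intro exI conjI; assumption)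
  then show thesis using that by blast
qed

lemma chart_continuous_map:
  "chart M W \<Omega> \<psi> \<Longrightarrow> continuous_map (top_of_set (W \<inter> \<Omega>)) M \<psi>"
  unfolding chart_def
  using homeomorphic_imp_continuous_map continuous_map_in_subtopology by blast

lemma chart_smooth_curve:
  fixes M :: "'e::real_normed_vector topology"
  assumes fd: "fin_dim TYPE('e)" and ch: "chart M W \<Omega> \<psi>" and w: "w \<in> W" "w \<in> \<Omega>" and z: "z \<in> W"
  shows "curve_through M (\<psi> w) (frechet_derivative \<psi> (at w) z) (\<lambda>t. \<psi> (w + t *\<^sub>R z))"
proof -
  have W: "subspace W" and \<Omega>: "open \<Omega>" and \<psi>: "smooth_on \<Omega> \<psi>" using ch by (auto simp: chart_def)
  let ?l = "\<lambda>t. w + t *\<^sub>R z"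
  have bl: "bounded_linear (\<lambda>t::real. t *\<^sub>R z)" by (rule bounded_linear_scaleR_left)
  have cl: "continuous_on UNIV ?l" by (intro continuous_intros)
  have "open (?l -` \<Omega>)" using open_vimage[OF \<Omega> cl] .
  moreover have "0 \<in> ?l -` \<Omega>" using w by simp
  ultimately obtain \<epsilon> where \<epsilon>: "\<epsilon> > 0" "ball 0 \<epsilon> \<subseteq> ?l -` \<Omega>" using openE by blast
  define I where "I = {- \<epsilon><..<\<epsilon>}"
  have I: "open I" "\<And>t. t \<in> I \<Longrightarrow> ?l t \<in> \<Omega>" using \<epsilon>(2) by (auto simp: I_def subset_iff dist_real_def)
  have sm: "smooth_on I (\<lambda>t. \<psi> (?l t))"
  proof (rule smooth_on_compose[OF fd I(1) _ \<psi>])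
    show "smooth_on I ?l"
      by (intro smooth_on_add smooth_on_const smooth_on_bounded_linear bl I)
  qed (use I in auto)
  have "continuous_map (top_of_set I) (top_of_set (W \<inter> \<Omega>)) ?l"
    using I w z W by (auto simp: continuous_map_in_subtopology subspace_add subspace_scale
        intro: continuous_on_subset[OF cl])
  then have "continuous_map (top_of_set I) M (\<lambda>t. \<psi> (?l t))"
    using continuous_map_compose[OF _ chart_continuous_map[OF ch]] unfolding o_def by blast
  then have "smooth_map (top_of_set I) M (\<lambda>t. \<psi> (?l t))"
    by (rule smooth_mapI_global[OF _ sm I(1)]) auto
  moreover have "((\<lambda>t. \<psi> (?l t)) has_vector_derivative frechet_derivative \<psi> (at w) z) (at 0)"
  proof -
    have "(?l has_derivative (\<lambda>t. t *\<^sub>R z)) (at 0)"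
      by (auto intro!: derivative_eq_intros)
    moreover have d: "(\<psi> has_derivative frechet_derivative \<psi> (at w)) (at (?l 0))"
      using smooth_on_has_derivative[OF \<psi> w(2)] by simp
    ultimately have "((\<lambda>t. \<psi> (?l t)) has_derivative (\<lambda>t. frechet_derivative \<psi> (at w) (t *\<^sub>R z))) (at 0)"
      by (rule has_derivative_compose)
    then show ?thesis unfolding has_vector_derivative_def
      using linear_cmul[OF has_derivative_linear[OF d]] by simp
  qed
  ultimately show ?thesis unfolding curve_through_def I_def using \<epsilon>(1) by auto
qed

lemma vector_derivative_quotient:
  assumes "(c has_vector_derivative v) (at 0)"
  shows "((\<lambda>t. (c t - c 0) /\<^sub>R t) \<longlongrightarrow> v) (at (0::real))"
proof -
  have "(\<lambda>h. norm (c h - c 0 - h *\<^sub>R v) / norm h) \<midarrow>0\<rightarrow> 0"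
    using assms unfolding has_vector_derivative_def has_derivative_at by simp
  moreover have "\<forall>\<^sub>F h in at 0. norm (c h - c 0 - h *\<^sub>R v) / norm h = norm ((c h - c 0) /\<^sub>R h - v)"
  proof (rule eventually_at_filter[THEN iffD2], intro always_eventually allI impI)
    fix h :: real assume "h \<noteq> 0"
    then have "c h - c 0 - h *\<^sub>R v = h *\<^sub>R ((c h - c 0) /\<^sub>R h - v)" by (simp add: scaleR_diff_right)
    then show "norm (c h - c 0 - h *\<^sub>R v) / norm h = norm ((c h - c 0) /\<^sub>R h - v)"
      using \<open>h \<noteq> 0\<close> by (metis nonzero_mult_div_cancel_left norm_scaleR norm_eq_zero real_norm_def)
  qed
  ultimately have "(\<lambda>h. norm ((c h - c 0) /\<^sub>R h - v)) \<midarrow>0\<rightarrow> 0"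
    by (rule Lim_transform_eventually)
  then show ?thesis by (rule LIM_zero_cancel[OF tendsto_norm_zero_cancel])
qed

lemma tangent_vector_in_range:
  fixes \<psi> :: "'e::real_normed_vector \<Rightarrow> 'f::real_normed_vector" and c :: "real \<Rightarrow> 'f"
  assumes fd: "fin_dim TYPE('f)" and W: "subspace W"
    and der: "(\<psi> has_derivative D) (at w0)" and inj: "inj_on D W" and w0: "w0 \<in> W"
    and c: "(c has_vector_derivative v) (at 0)" "c 0 = \<psi> w0"
    and lift: "\<forall>\<^sub>F t in at 0. w t \<in> W \<and> \<psi> (w t) = c t" and lim: "(w \<longlongrightarrow> w0) (at 0)"
  shows "v \<in> D ` W"
proof -
  have linD: "linear D" using der has_derivative_linear by blast
  obtain R where R: "range R \<subseteq> W" "linear R" "\<And>z. z \<in> W \<Longrightarrow> R (D z) = z"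
    using linear_exists_left_inverse_on[OF linD W inj] by blast
  have blD: "bounded_linear D" using der has_derivative_bounded_linear by blast
  have blR: "bounded_linear R" using fin_dim_bounded_linear[OF fd R(2)] .
  \<comment> \<open>Zero on the image of \<open>W\<close> under \<open>D\<close>; conversely
    \<open>N v = 0\<close> exhibits \<open>v\<close> as \<open>D (R v)\<close> with
    \<open>R v\<close> in \<open>W\<close>.\<close>
  define N where "N x = D (R x) - x" for x
  have blN: "bounded_linear N" unfolding N_def
    by (intro bounded_linear_sub bounded_linear_compose[OF blD blR] bounded_linear_ident)
  have ND: "N (D z) = 0" if "z \<in> W" for z using R(3)[OF that] by (simp add: N_def)
  obtain \<rho> where \<rho>: "\<rho> > 0" "\<And>x. norm (R x) \<le> \<rho> * norm x" using bounded_linear_pos_bound[OF blR] by blast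
  obtain K where K: "K > 0" "\<And>x. norm (N x) \<le> K * norm x" using bounded_linear_pos_bound[OF blN] by blast
  \<comment> \<open>\<open>\<eta>\<close> is the relative error in the differentiability of
    \<open>\<psi>\<close> at \<open>w0\<close>. The side condition lets the term with norm z on the
    right be absorbed on the left, which bounds the increment of \<open>w\<close> by that of
    \<open>c\<close>.\<close>
  have main: "norm (N v) \<le> 2 * K * \<rho> * \<eta> * norm v" if \<eta>: "\<eta> > 0" "\<rho> * \<eta> \<le> 1/2" for \<eta>
  proof -
    obtain d where d: "d > 0" "\<And>y. norm (y - w0) < d \<Longrightarrow> norm (\<psi> y - \<psi> w0 - D (y - w0)) \<le> \<eta> * norm (y - w0)"
      using der \<eta>(1) unfolding has_derivative_at_alt by blast
    have "\<forall>\<^sub>F t in at 0. norm (w t - w0) < d"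
      using tendstoD[OF lim d(1)] by (simp add: dist_norm)
    then have ev: "\<forall>\<^sub>F t in at 0. norm (N ((c t - c 0) /\<^sub>R t)) \<le> 2 * K * \<rho> * \<eta> * norm ((c t - c 0) /\<^sub>R t)"
      using lift
    proof eventually_elim
      case (elim t)
      define z where "z = w t - w0"
      define \<Delta> where "\<Delta> = c t - c 0"
      have z: "z \<in> W" using elim w0 W by (auto simp: z_def subspace_diff)
      have le: "norm (\<Delta> - D z) \<le> \<eta> * norm z"
        using d(2)[OF elim(1)] elim(2) c(2) by (simp add: \<Delta>_def z_def)
      have "norm z = norm (R (D z))" using R(3)[OF z] by simp
      also have "\<dots> \<le> \<rho> * norm (D z)" by (rule \<rho>(2))
      also have "norm (D z) \<le> norm \<Delta> + norm (\<Delta> - D z)"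
        using norm_triangle_sub[of "D z" \<Delta>] by (simp add: norm_minus_commute)
      finally have "norm z \<le> \<rho> * (norm \<Delta> + norm (\<Delta> - D z))" using \<rho>(1) by simp
      also have "\<dots> \<le> \<rho> * (norm \<Delta> + \<eta> * norm z)" using le \<rho>(1) by simp
      finally have "norm z \<le> \<rho> * norm \<Delta> + \<rho> * \<eta> * norm z" by (simp add: algebra_simps)
      moreover have "\<rho> * \<eta> * norm z \<le> 1/2 * norm z" using \<eta>(2) by (intro mult_right_mono) auto
      ultimately have nz: "norm z \<le> 2 * \<rho> * norm \<Delta>" by linarith
      have "N \<Delta> = N (\<Delta> - D z)" using ND[OF z] by (simp add: linear_diff[OF bounded_linear.linear[OF blN]])
      then have "norm (N \<Delta>) \<le> K * norm (\<Delta> - D z)" using K(2) by simp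
      also have "\<dots> \<le> K * (\<eta> * (2 * \<rho> * norm \<Delta>))"
        using K(1) \<eta>(1) by (intro mult_left_mono order_trans[OF le] nz) auto
      finally have "norm (N \<Delta>) \<le> 2 * K * \<rho> * \<eta> * norm \<Delta>" by (simp add: algebra_simps)
      then have "\<bar>inverse t\<bar> * norm (N \<Delta>) \<le> \<bar>inverse t\<bar> * (2 * K * \<rho> * \<eta> * norm \<Delta>)"
        by (rule mult_left_mono) simp
      then show ?case
        by (simp add: \<Delta>_def[symmetric] linear_cmul[OF bounded_linear.linear[OF blN]] algebra_simps)
    qed
    have l: "((\<lambda>t. (c t - c 0) /\<^sub>R t) \<longlongrightarrow> v) (at 0)"
      by (rule vector_derivative_quotient[OF c(1)])
    show ?thesis
    proof (rule tendsto_le[OF _ _ _ ev])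
      show "((\<lambda>t. norm (N ((c t - c 0) /\<^sub>R t))) \<longlongrightarrow> norm (N v)) (at 0)"
        by (intro tendsto_norm bounded_linear.tendsto[OF blN] l)
      show "((\<lambda>t. 2 * K * \<rho> * \<eta> * norm ((c t - c 0) /\<^sub>R t)) \<longlongrightarrow> 2 * K * \<rho> * \<eta> * norm v) (at 0)"
        by (intro tendsto_mult tendsto_const tendsto_norm l)
    qed simp
  qed
  have "norm (N v) \<le> e" if e: "e > 0" for e
  proof -
    \<comment> \<open>The first entry gives the absorption condition, the second turns the bound of
      \<open>main\<close> into at most \<open>e\<close>; the added 1 keeps the denominator positive
      for \<open>v = 0\<close>.\<close>
    define \<eta> where "\<eta> = min (1 / (2 * \<rho>)) (e / (2 * K * \<rho> * (norm v + 1)))"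
    have pos: "0 < 2 * K * \<rho> * (norm v + 1)" using K \<rho> by (simp add: add_nonneg_pos)
    have "\<eta> > 0" using pos e \<rho> by (auto simp: \<eta>_def)
    moreover have "\<rho> * \<eta> \<le> \<rho> * (1 / (2 * \<rho>))" using \<rho>(1) by (intro mult_left_mono) (auto simp: \<eta>_def)
    then have "\<rho> * \<eta> \<le> 1/2" using \<rho>(1) by simp
    ultimately have "norm (N v) \<le> 2 * K * \<rho> * \<eta> * norm v" by (rule main)
    also have "\<dots> \<le> 2 * K * \<rho> * \<eta> * (norm v + 1)"
      using K \<rho> \<open>\<eta> > 0\<close> by (intro mult_left_mono) auto
    also have "\<dots> = \<eta> * (2 * K * \<rho> * (norm v + 1))" by simp
    also have "\<dots> \<le> e / (2 * K * \<rho> * (norm v + 1)) * (2 * K * \<rho> * (norm v + 1))"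
      using pos by (intro mult_right_mono) (auto simp: \<eta>_def)
    also have "\<dots> = e" using less_imp_neq[OF pos] by (metis nonzero_divide_eq_eq)
    finally show ?thesis .
  qed
  then have "norm (N v) \<le> 0" by (rule field_le_epsilon[where y = 0, simplified])
  then have "v = D (R v)" by (simp add: N_def)
  then show ?thesis using R(1) by (metis image_eqI rangeI subsetD)
qed

text \<open>Curves are smooth into the own topology of \<open>M\<close>, so they can be lifted
  through the homeomorphism of the chart. A curve continuous only for the ambient topology could
  leave the chart at once.\<close>

lemma tangent_space_chart:
  fixes M :: "'e::real_normed_vector topology"
  assumes fd: "fin_dim TYPE('e)" and ch: "chart M W \<Omega> \<psi>" and w: "w \<in> W" "w \<in> \<Omega>"
  shows "tangent_space M (\<psi> w) = frechet_derivative \<psi> (at w) ` W"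
proof
  show "frechet_derivative \<psi> (at w) ` W \<subseteq> tangent_space M (\<psi> w)"
    using chart_smooth_curve[OF fd ch w] by (auto simp: tangent_space_def)
  show "tangent_space M (\<psi> w) \<subseteq> frechet_derivative \<psi> (at w) ` W"
  proof
    fix v assume "v \<in> tangent_space M (\<psi> w)"
    then obtain c \<epsilon> where \<epsilon>: "\<epsilon> > 0" and c: "smooth_map (top_of_set {-\<epsilon><..<\<epsilon>}) M c" "c 0 = \<psi> w"
      "(c has_vector_derivative v) (at 0)"
      by (auto simp: tangent_space_def curve_through_def)
    let ?T = "top_of_set (W \<inter> \<Omega>)" and ?U = "\<psi> ` (W \<inter> \<Omega>)"
    have hom: "homeomorphic_map ?T (subtopology M ?U) \<psi>" and oU: "openin M ?U"
      and W: "subspace W" and \<psi>: "smooth_on \<Omega> \<psi>" and inj: "inj_on (frechet_derivative \<psi> (at w)) W"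
      using ch w by (auto simp: chart_def)
    obtain g where g: "homeomorphic_maps ?T (subtopology M ?U) \<psi> g"
      using hom homeomorphic_map_maps by blast
    have cont: "continuous_map (top_of_set {-\<epsilon><..<\<epsilon>}) M c" using c(1) by (simp add: smooth_map_def)
    have cont_g: "continuous_map (subtopology M ?U) ?T g" and
      g\<psi>: "\<And>x. x \<in> W \<inter> \<Omega> \<Longrightarrow> g (\<psi> x) = x" and
      \<psi>g: "\<And>y. y \<in> topspace M \<inter> ?U \<Longrightarrow> \<psi> (g y) = y"
      using g by (auto simp: homeomorphic_maps_def)
    define I where "I = {t \<in> {-\<epsilon><..<\<epsilon>}. c t \<in> ?U}"
    have oI': "openin (top_of_set {-\<epsilon><..<\<epsilon>}) I"
      using openin_continuous_map_preimage[OF cont oU] by (simp add: I_def)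
    then have oI: "open I" using openin_open_trans open_greaterThanLessThan by blast
    have I0: "0 \<in> I" using \<epsilon> c(2) w by (auto simp: I_def)
    have cI: "continuous_map (top_of_set I) (subtopology M ?U) c"
      using continuous_map_from_subtopology[OF cont, of I] 
      by (auto simp: continuous_map_in_subtopology subtopology_subtopology I_def Int_absorb1 subset_iff Int_def conj_commute cong: conj_cong)
    have gc: "continuous_map (top_of_set I) ?T (\<lambda>t. g (c t))"
      using continuous_map_compose[OF cI cont_g] by (simp add: o_def)
    then have "continuous_on I (\<lambda>t. g (c t))" and gcW: "\<And>t. t \<in> I \<Longrightarrow> g (c t) \<in> W \<inter> \<Omega>"
      by (auto simp: continuous_map_in_subtopology)
    then have "isCont (\<lambda>t. g (c t)) 0" using oI I0 by (simp add: continuous_on_eq_continuous_at)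
    then have lim: "((\<lambda>t. g (c t)) \<longlongrightarrow> w) (at 0)"
      using g\<psi>[of w] w c(2) by (simp add: isCont_def)
    have "\<forall>\<^sub>F t in at 0. t \<in> I" using oI I0 by (meson eventually_at_topological)
    then have lift: "\<forall>\<^sub>F t in at 0. g (c t) \<in> W \<and> \<psi> (g (c t)) = c t"
    proof eventually_elim
      case (elim t)
      have "c t \<in> topspace M \<inter> ?U" using elim oU openin_subset by (fastforce simp: I_def)
      then show ?case using gcW[OF elim] \<psi>g by blast
    qed
    show "v \<in> frechet_derivative \<psi> (at w) ` W"
      by (rule tangent_vector_in_range[OF fd W smooth_on_has_derivative[OF \<psi> w(2)] inj w(1) c(3,2) lift lim])
  qed
qed

lemma tangent_space_subspace:
  fixes M :: "'e::real_normed_vector topology"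
  assumes fd: "fin_dim TYPE('e)" and M: "immersed_submanifold M" "p \<in> topspace M"
  shows "subspace (tangent_space M p)"
proof -
  obtain W \<Omega> \<psi> w where ch: "chart M W \<Omega> \<psi>" and w: "w \<in> W" "w \<in> \<Omega>" "\<psi> w = p"
    using immersed_submanifold_chart[OF M] .
  have "linear (frechet_derivative \<psi> (at w))"
    using ch w smooth_on_has_derivative has_derivative_linear unfolding chart_def by blast
  then show ?thesis
    using tangent_space_chart[OF fd ch w(1,2)] w(3) ch by (metis chart_def linear_subspace_image)
qed

text \<open>\<open>differential\<close> is a definite description over all curves with velocity
  \<open>v\<close>. Membership in the tangent space supplies one such curve, and this makes the
  value unique.\<close>

lemma differential_eq:
  assumes "v \<in> tangent_space M p"
    and "\<And>c. curve_through M p v c \<Longrightarrow> ((\<lambda>t. f (c t)) has_vector_derivative w) (at 0)"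
  shows "differential M f p v = w"
proof -
  obtain c where c: "curve_through M p v c" using assms(1) by (auto simp: tangent_space_def)
  show ?thesis unfolding differential_def
  proof (rule the_equality)
    fix w' assume "\<forall>c. curve_through M p v c \<longrightarrow> ((\<lambda>t. f (c t)) has_vector_derivative w') (at 0)"
    then show "w' = w" using c assms(2) vector_derivative_unique_at by blast
  qed (use assms(2) in blast)
qed

text \<open>Sufficient for both maps that get differentiated later: the orbit map is
  \<open>snd\<close>, and the inclusion into \<open>Aff_G G\<close> is the identity.\<close>

lemma differential_bounded_linear:
  assumes "v \<in> tangent_space M p" "bounded_linear L" "\<And>x. f x = L x"
  shows "differential M f p v = L v"
  using assms
  by (intro differential_eq) (auto simp: curve_through_def intro: bounded_linear.has_vector_derivative)

section \<open>The general linear and the affine group\<close>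

lemma GL_mult [simp]: "a \<otimes>\<^bsub>GL\<^esub> b = a o\<^sub>L b"
  by (simp add: GL_def units_of_def)

lemma GL_one [simp]: "\<one>\<^bsub>GL\<^esub> = id_blinfun"
  by (simp add: GL_def units_of_def)

lemma blinfun_compose_id [simp]: "a o\<^sub>L id_blinfun = a" "id_blinfun o\<^sub>L a = a"
  by (auto intro: blinfun_eqI)

lemma blinfun_compose_assoc: "(a o\<^sub>L b) o\<^sub>L c = a o\<^sub>L (b o\<^sub>L c)"
  by (auto intro: blinfun_eqI)

lemma linear_blinfun_apply: "linear (blinfun_apply a)"
  by (rule bounded_linear.linear[OF blinfun.bounded_linear_right])

lemma GL_carrier: "a \<in> carrier GL \<longleftrightarrow> (\<exists>b. b o\<^sub>L a = id_blinfun \<and> a o\<^sub>L b = id_blinfun)"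
  by (simp add: GL_def units_of_def Units_def)

lemma group_GL: "group GL"
  unfolding GL_def
  by (rule monoid.units_group, unfold_locales) (auto simp: blinfun_compose_assoc)

lemma GL_inv_compose:
  assumes "a \<in> carrier GL"
  shows "inv\<^bsub>GL\<^esub> a o\<^sub>L a = id_blinfun" "a o\<^sub>L inv\<^bsub>GL\<^esub> a = id_blinfun"
  using group.l_inv[OF group_GL assms] group.r_inv[OF group_GL assms] by auto

lemma GL_inv_apply:
  assumes "a \<in> carrier GL"
  shows "(inv\<^bsub>GL\<^esub> a) (a x) = x" "a ((inv\<^bsub>GL\<^esub> a) x) = x"
  using GL_inv_compose[OF assms, THEN arg_cong[where f = "\<lambda>f. blinfun_apply f x"]] by auto

lemma GL_inv_eqI:
  assumes "b o\<^sub>L a = id_blinfun" "a o\<^sub>L b = id_blinfun"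
  shows "inv\<^bsub>GL\<^esub> a = b"
  by (rule group.inv_equality[OF group_GL]) (use assms in \<open>auto simp: GL_carrier\<close>)

lemma GL_iff_inj:
  fixes a :: "'v::real_normed_vector \<Rightarrow>\<^sub>L 'v"
  assumes fd: "fin_dim TYPE('v)"
  shows "a \<in> carrier GL \<longleftrightarrow> inj (blinfun_apply a)"
proof
  assume "a \<in> carrier GL"
  then show "inj (blinfun_apply a)" by (metis GL_inv_apply(1) injI)
next
  assume inj: "inj (blinfun_apply a)"
  have lin: "linear (blinfun_apply a)" by (simp add: linear_blinfun_apply)
  have surj: "surj (blinfun_apply a)" by (rule fin_dim_inj_imp_surj[OF fd lin inj])
  obtain g where g: "linear g" "g \<circ> blinfun_apply a = id"
    using linear_injective_left_inverse[OF lin inj] by blast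
  have gb: "blinfun_apply (Blinfun g) = g"
    by (rule bounded_linear_Blinfun_apply[OF fin_dim_bounded_linear[OF fd g(1)]])
  have ga: "g (a x) = x" for x using fun_cong[OF g(2), of x] by simp
  have ag: "a (g y) = y" for y using surj ga by (metis surjD)
  show "a \<in> carrier GL" unfolding GL_carrier
    by (intro exI[of _ "Blinfun g"]) (auto intro!: blinfun_eqI simp: gb ga ag)
qed

text \<open>The lower bound norm x \<le> 2 norm(A') norm(B x), with A' the inverse of
  \<open>A\<close>, gives injectivity of \<open>B\<close> and the norm of its inverse at
  once.\<close>

lemma GL_perturb:
  fixes A :: "'v::real_normed_vector \<Rightarrow>\<^sub>L 'v"
  assumes fd: "fin_dim TYPE('v)" and A: "A \<in> carrier GL" and B: "norm (B - A) * norm (inv\<^bsub>GL\<^esub> A) \<le> 1/2"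
  shows "B \<in> carrier GL" "norm (inv\<^bsub>GL\<^esub> B) \<le> 2 * norm (inv\<^bsub>GL\<^esub> A)"
proof -
  let ?A' = "inv\<^bsub>GL\<^esub> A"
  have le: "norm x \<le> 2 * norm ?A' * norm (B x)" for x
  proof -
    have "x = ?A' (B x) - ?A' ((B - A) x)"
      by (simp add: blinfun.diff_left blinfun.diff_right GL_inv_apply(1)[OF A])
    then have "norm x \<le> norm (?A' (B x)) + norm (?A' ((B - A) x))"
      by (metis norm_triangle_ineq4)
    also have "norm (?A' ((B - A) x)) \<le> norm ?A' * (norm (B - A) * norm x)"
      by (meson norm_blinfun mult_left_mono norm_ge_zero order_trans)
    also have "\<dots> \<le> 1/2 * norm x"
      using mult_right_mono[OF B norm_ge_zero[of x]] by (simp add: algebra_simps)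
    also have "norm (?A' (B x)) \<le> norm ?A' * norm (B x)"
      by (rule norm_blinfun)
    finally show ?thesis by linarith
  qed
  have "inj (blinfun_apply B)"
  proof (subst linear_injective_0[OF linear_blinfun_apply], clarify)
    fix v assume "B v = 0"
    then show "v = 0" using le[of v] by simp
  qed
  then show BG: "B \<in> carrier GL" using GL_iff_inj[OF fd] by blast
  show "norm (inv\<^bsub>GL\<^esub> B) \<le> 2 * norm ?A'"
  proof (rule norm_blinfun_bound)
    fix y show "norm ((inv\<^bsub>GL\<^esub> B) y) \<le> 2 * norm ?A' * norm y"
      using le[of "(inv\<^bsub>GL\<^esub> B) y"] GL_inv_apply(2)[OF BG] by simp
  qed simp
qed

lemma open_GL:
  assumes fd: "fin_dim TYPE('v::real_normed_vector)"
  shows "open (carrier GL :: ('v \<Rightarrow>\<^sub>L 'v) set)"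
proof (rule openI)
  fix A :: "'v \<Rightarrow>\<^sub>L 'v" assume A: "A \<in> carrier GL"
  define N where "N = norm (inv\<^bsub>GL\<^esub> A)"
  have "B \<in> carrier GL" if "B \<in> ball A (1 / (2 * (N + 1)))" for B
  proof (rule GL_perturb(1)[OF fd A])
    have N: "N \<ge> 0" by (simp add: N_def)
    have "norm (B - A) * (N + 1) \<le> 1 / (2 * (N + 1)) * (N + 1)"
      using that N by (intro mult_right_mono) (auto simp: dist_norm norm_minus_commute)
    also have "\<dots> = 1 / 2" using N by (simp add: field_simps)
    finally have "norm (B - A) * (N + 1) \<le> 1/2" .
    moreover have "norm (B - A) * N \<le> norm (B - A) * (N + 1)" by (simp add: mult_left_mono)
    ultimately show "norm (B - A) * norm (inv\<^bsub>GL\<^esub> A) \<le> 1/2" unfolding N_def by linarith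
  qed
  moreover have "0 < 1 / (2 * (N + 1))" by (simp add: N_def add_nonneg_pos)
  ultimately show "\<exists>e>0. ball A e \<subseteq> carrier GL" by blast
qed

lemma GL_inv_has_derivative:
  fixes A :: "'v::real_normed_vector \<Rightarrow>\<^sub>L 'v"
  assumes fd: "fin_dim TYPE('v)" and A: "A \<in> carrier GL"
  shows "((\<lambda>A. inv\<^bsub>GL\<^esub> A) has_derivative (\<lambda>v. - (inv\<^bsub>GL\<^esub> A o\<^sub>L v o\<^sub>L inv\<^bsub>GL\<^esub> A))) (at A)"
proof -
  let ?A' = "inv\<^bsub>GL\<^esub> A"
  define N where "N = norm ?A'"
  have N: "N \<ge> 0" by (simp add: N_def)
  have bl: "bounded_linear (\<lambda>v. - (?A' o\<^sub>L v o\<^sub>L ?A'))"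
    by (intro bounded_linear_minus bounded_linear_compose[OF bounded_bilinear.bounded_linear_left[OF bounded_bilinear_blinfun_compose]
         bounded_bilinear.bounded_linear_right[OF bounded_bilinear_blinfun_compose]])
  have main: "norm (inv\<^bsub>GL\<^esub> B - ?A' - - (?A' o\<^sub>L (B - A) o\<^sub>L ?A')) \<le> (2 * N ^ 3 * norm (B - A)) * norm (B - A)"
    if B: "norm (B - A) * N \<le> 1/2" for B
  proof -
    have BG: "B \<in> carrier GL" and nB: "norm (inv\<^bsub>GL\<^esub> B) \<le> 2 * N"
      using GL_perturb[OF fd A] B by (auto simp: N_def)
    let ?B' = "inv\<^bsub>GL\<^esub> B"
    \<comment> \<open>The remainder contains \<open>B - A\<close> twice and is therefore of second
      order.\<close>
    have eq: "?B' - ?A' + (?A' o\<^sub>L (B - A) o\<^sub>L ?A') = ?B' o\<^sub>L (B - A) o\<^sub>L ?A' o\<^sub>L (B - A) o\<^sub>L ?A'"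
      by (rule blinfun_eqI)
        (simp add: blinfun.diff_left blinfun.diff_right blinfun.add_left blinfun.add_right GL_inv_apply[OF A] GL_inv_apply[OF BG])
    have "norm (?B' o\<^sub>L (B - A) o\<^sub>L ?A' o\<^sub>L (B - A) o\<^sub>L ?A')
        \<le> norm (?B' o\<^sub>L (B - A) o\<^sub>L ?A' o\<^sub>L (B - A)) * N"
      unfolding N_def by (rule norm_blinfun_compose)
    also have "\<dots> \<le> norm (?B' o\<^sub>L (B - A) o\<^sub>L ?A') * norm (B - A) * N"
      by (intro mult_right_mono norm_blinfun_compose N)
    also have "\<dots> \<le> norm (?B' o\<^sub>L (B - A)) * N * norm (B - A) * N"
      unfolding N_def by (intro mult_right_mono norm_blinfun_compose) auto
    also have "\<dots> \<le> norm ?B' * norm (B - A) * N * norm (B - A) * N"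
      by (intro mult_right_mono norm_blinfun_compose N) auto
    also have "\<dots> \<le> 2 * N * norm (B - A) * N * norm (B - A) * N"
      by (intro mult_right_mono nB N) auto
    also have "\<dots> = (2 * N ^ 3 * norm (B - A)) * norm (B - A)" by (simp add: power3_eq_cube)
    finally show ?thesis using eq by simp
  qed
  show ?thesis unfolding has_derivative_at_alt
  proof (intro conjI bl allI impI)
    fix e :: real assume e: "0 < e"
    \<comment> \<open>The first entry keeps \<open>B\<close> within the range of
      \<open>GL_perturb\<close>, the second makes the factor \<open>2 * N ^ 3 * norm (B - A)\<close>
      at most \<open>e\<close>; the added ones cover \<open>N = 0\<close>, which occurs on the
      trivial space.\<close>
    define d where "d = min (1 / (2 * (N + 1))) (e / (2 * N ^ 3 + 1))"
    have pos: "2 * N ^ 3 + 1 > 0" using N by (simp add: add_nonneg_pos)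
    have d: "d > 0" using N e pos by (auto simp: d_def)
    have "norm (inv\<^bsub>GL\<^esub> B - ?A' - - (?A' o\<^sub>L (B - A) o\<^sub>L ?A')) \<le> e * norm (B - A)" if B: "norm (B - A) < d" for B
    proof -
      have "norm (B - A) * N \<le> (1 / (2 * (N + 1))) * (N + 1)"
        using B N by (intro mult_mono) (auto simp: d_def)
      also have "\<dots> = 1/2" using N by (simp add: field_simps)
      finally have 1: "norm (B - A) * N \<le> 1/2" .
      have "2 * N ^ 3 * norm (B - A) \<le> (2 * N ^ 3 + 1) * (e / (2 * N ^ 3 + 1))"
        using B N by (intro mult_mono) (auto simp: d_def)
      also have "\<dots> = e" using pos by simp
      finally show ?thesis
        using main[OF 1] by (meson mult_right_mono norm_ge_zero order_trans)
    qed
    then show "\<exists>d>0. \<forall>B. norm (B - A) < d \<longrightarrow>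
      norm (inv\<^bsub>GL\<^esub> B - ?A' - - (?A' o\<^sub>L (B - A) o\<^sub>L ?A')) \<le> e * norm (B - A)" using d by blast
  qed
qed

text \<open>The derivative of inversion is a product of inverses and a constant, so class C^k of
  inversion gives class C^(k+1).\<close>

lemma smooth_on_GL_inv:
  assumes fd: "fin_dim TYPE('v::real_normed_vector)"
  shows "smooth_on (carrier GL) (\<lambda>A :: 'v \<Rightarrow>\<^sub>L 'v. inv\<^bsub>GL\<^esub> A)"
  unfolding smooth_on_def
proof
  fix k show "Ck_on k (carrier GL) (\<lambda>A :: 'v \<Rightarrow>\<^sub>L 'v. inv\<^bsub>GL\<^esub> A)"
  proof (induction k)
    case 0
    show ?case using GL_inv_has_derivative[OF fd]
      by (auto intro!: continuous_at_imp_continuous_on has_derivative_continuous)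
  next
    case (Suc k)
    show ?case
    proof (rule Ck_on_SucI[OF open_GL[OF fd] GL_inv_has_derivative[OF fd]])
      fix v :: "'v \<Rightarrow>\<^sub>L 'v"
      have "Ck_on k (carrier GL) (\<lambda>A :: 'v \<Rightarrow>\<^sub>L 'v. (inv\<^bsub>GL\<^esub> A o\<^sub>L v) o\<^sub>L inv\<^bsub>GL\<^esub> A)"
        by (rule Ck_on_bilinear[OF open_GL[OF fd] bounded_bilinear_blinfun_compose
              Ck_on_bilinear[OF open_GL[OF fd] bounded_bilinear_blinfun_compose Suc.IH Ck_on_const] Suc.IH])
      then show "Ck_on k (carrier GL) (\<lambda>A :: 'v \<Rightarrow>\<^sub>L 'v. - (inv\<^bsub>GL\<^esub> A o\<^sub>L v o\<^sub>L inv\<^bsub>GL\<^esub> A))"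
        by (rule Ck_on_bounded_linear_compose[OF bounded_linear_minus[OF bounded_linear_ident] _ open_GL[OF fd]])
    qed
  qed
qed

lemma Aff_mult [simp]: "(L, s) \<otimes>\<^bsub>Aff\<^esub> (L', s') = (L o\<^sub>L L', L s' + s)"
  by (simp add: Aff_def)

lemma Aff_one [simp]: "\<one>\<^bsub>Aff\<^esub> = (id_blinfun, 0)"
  by (simp add: Aff_def)

lemma Aff_carrier: "(L, s) \<in> carrier Aff \<longleftrightarrow> L \<in> carrier GL"
  by (simp add: Aff_def)

lemma group_Aff: "group Aff"
proof (rule groupI)
  fix x assume x: "x \<in> carrier (Aff :: (('a \<Rightarrow>\<^sub>L 'a) \<times> 'a) monoid)"
  obtain L s where [simp]: "x = (L, s)" by force
  have L: "L \<in> carrier GL" using x by (simp add: Aff_carrier)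
  have "inv\<^bsub>GL\<^esub> L \<in> carrier GL" using group.inv_closed[OF group_GL L] .
  then show "\<exists>y\<in>carrier Aff. y \<otimes>\<^bsub>Aff\<^esub> x = \<one>\<^bsub>Aff\<^esub>"
    by (intro bexI[of _ "(inv\<^bsub>GL\<^esub> L, - (inv\<^bsub>GL\<^esub> L) s)"])
      (auto simp: Aff_carrier GL_inv_compose[OF L])
qed (use monoid.m_closed[OF group.is_monoid[OF group_GL]] monoid.one_closed[OF group.is_monoid[OF group_GL]]
  in \<open>auto simp: Aff_def blinfun_compose_assoc blinfun.add_right\<close>)

lemma Aff_inv:
  assumes L: "L \<in> carrier GL"
  shows "inv\<^bsub>Aff\<^esub> (L, s) = (inv\<^bsub>GL\<^esub> L, - (inv\<^bsub>GL\<^esub> L) s)"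
  using group.inv_closed[OF group_GL L] L
  by (intro group.inv_equality[OF group_Aff]) (auto simp: Aff_carrier GL_inv_compose[OF L])

section \<open>Translations in a Lie subgroup\<close>

lemma lie_translation:
  fixes K :: "'e::real_normed_vector monoid"
  assumes fd: "fin_dim TYPE('e)" and H: "lie_subgroup K H" and h: "h \<in> topspace H"
  shows lie_left_translation: "smooth_map H H (\<lambda>x. h \<otimes>\<^bsub>K\<^esub> x)"
    and lie_right_translation: "smooth_map H H (\<lambda>x. x \<otimes>\<^bsub>K\<^esub> h)"
proof -
  have mult: "smooth_map (prod_topology H H) H (\<lambda>(x, y). x \<otimes>\<^bsub>K\<^esub> y)"
    using H by (simp add: lie_subgroup_def)
  have "smooth_map H (prod_topology H H) (\<lambda>x. (h, x))"
    by (rule smooth_mapI_global[where F = "\<lambda>x. (h, x)" and \<Omega> = UNIV])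
      (use h in \<open>auto intro!: continuous_map_pairedI smooth_on_Pair smooth_on_const smooth_on_ident\<close>)
  from smooth_map_compose[OF fin_dim_prod[OF fd fd] this mult]
  show "smooth_map H H (\<lambda>x. h \<otimes>\<^bsub>K\<^esub> x)" by (simp add: o_def)
  have "smooth_map H (prod_topology H H) (\<lambda>x. (x, h))"
    by (rule smooth_mapI_global[where F = "\<lambda>x. (x, h)" and \<Omega> = UNIV])
      (use h in \<open>auto intro!: continuous_map_pairedI smooth_on_Pair smooth_on_const smooth_on_ident\<close>)
  from smooth_map_compose[OF fin_dim_prod[OF fd fd] this mult]
  show "smooth_map H H (\<lambda>x. x \<otimes>\<^bsub>K\<^esub> h)" by (simp add: o_def)
qed

lemma lie_subgroup_carrier: "lie_subgroup K H \<Longrightarrow> h \<in> topspace H \<Longrightarrow> h \<in> carrier K"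
  by (auto simp: lie_subgroup_def dest: subgroup.mem_carrier)

lemma lie_algebra_subspace:
  fixes K :: "'e::real_normed_vector monoid"
  assumes "fin_dim TYPE('e)" "lie_subgroup K H"
  shows "subspace (lie_algebra K H)"
  unfolding lie_algebra_def
  by (rule tangent_space_subspace[OF assms(1)])
    (use assms(2) in \<open>auto simp: lie_subgroup_def dest: subgroup.one_closed\<close>)

lemma curve_blinfun_compose:
  assumes "(c has_vector_derivative v) F"
  shows "((\<lambda>t. a o\<^sub>L c t) has_vector_derivative a o\<^sub>L v) F" "((\<lambda>t. c t o\<^sub>L a) has_vector_derivative v o\<^sub>L a) F"
  by (rule bounded_linear.has_vector_derivative[OF _ assms],
      simp add: bounded_bilinear.bounded_linear_right[OF bounded_bilinear_blinfun_compose]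
        bounded_bilinear.bounded_linear_left[OF bounded_bilinear_blinfun_compose])+

text \<open>Left translation is smooth for the topology of \<open>G\<close> itself and carries
  curves through \<open>p\<close> to curves through 1. Hence logarithmic derivatives of maps into
  \<open>G\<close> take values in the Lie algebra.\<close>

lemma GL_tangent_left_translate:
  fixes G :: "('v::real_normed_vector \<Rightarrow>\<^sub>L 'v) topology"
  assumes fd: "fin_dim TYPE('v)" and G: "lie_subgroup GL G" and p: "p \<in> topspace G" and v: "v \<in> tangent_space G p"
  shows "inv\<^bsub>GL\<^esub> p o\<^sub>L v \<in> lie_algebra GL G"
proof -
  have fdE: "fin_dim TYPE('v \<Rightarrow>\<^sub>L 'v)" by (rule fin_dim_blinfun[OF fd fd])
  have pG: "p \<in> carrier GL" by (rule lie_subgroup_carrier[OF G p])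
  have ip: "inv\<^bsub>GL\<^esub> p \<in> topspace G"
    using G p by (auto simp: lie_subgroup_def dest: subgroup.m_inv_closed)
  obtain c where c: "curve_through G p v c" using v by (auto simp: tangent_space_def)
  have "((\<lambda>t. inv\<^bsub>GL\<^esub> p \<otimes>\<^bsub>GL\<^esub> c t) has_vector_derivative inv\<^bsub>GL\<^esub> p o\<^sub>L v) (at 0)"
    using c by (auto simp: curve_through_def intro: curve_blinfun_compose)
  from curve_through_image[OF fdE lie_left_translation[OF fdE G ip] c this]
  show ?thesis using GL_inv_compose[OF pG] unfolding lie_algebra_def tangent_space_def by auto
qed

text \<open>Left and right translation applied to one curve through 1; this makes the prolongation
  stable under \<open>act\<close>.\<close>

lemma GL_Ad_lie_algebra:
  fixes G :: "('v::real_normed_vector \<Rightarrow>\<^sub>L 'v) topology"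
  assumes fd: "fin_dim TYPE('v)" and G: "lie_subgroup GL G" and a: "a \<in> topspace G" and v: "v \<in> lie_algebra GL G"
  shows "a o\<^sub>L v o\<^sub>L inv\<^bsub>GL\<^esub> a \<in> lie_algebra GL G"
proof -
  have fdE: "fin_dim TYPE('v \<Rightarrow>\<^sub>L 'v)" by (rule fin_dim_blinfun[OF fd fd])
  have aG: "a \<in> carrier GL" by (rule lie_subgroup_carrier[OF G a])
  have ia: "inv\<^bsub>GL\<^esub> a \<in> topspace G"
    using G a by (auto simp: lie_subgroup_def dest: subgroup.m_inv_closed)
  obtain c where c: "curve_through G id_blinfun v c" using v by (auto simp: tangent_space_def lie_algebra_def)
  have d: "((\<lambda>t. a \<otimes>\<^bsub>GL\<^esub> c t) has_vector_derivative a o\<^sub>L v) (at 0)"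
    using c by (auto simp: curve_through_def intro: curve_blinfun_compose)
  have c2: "curve_through G (a \<otimes>\<^bsub>GL\<^esub> id_blinfun) (a o\<^sub>L v) (\<lambda>t. a \<otimes>\<^bsub>GL\<^esub> c t)"
    by (rule curve_through_image[OF fdE lie_left_translation[OF fdE G a] c d])
  have "((\<lambda>t. (a \<otimes>\<^bsub>GL\<^esub> c t) \<otimes>\<^bsub>GL\<^esub> inv\<^bsub>GL\<^esub> a) has_vector_derivative a o\<^sub>L v o\<^sub>L inv\<^bsub>GL\<^esub> a) (at 0)"
    using curve_blinfun_compose(2)[OF d] by simp
  from curve_through_image[OF fdE lie_right_translation[OF fdE G ia] c2 this]
  show ?thesis using GL_inv_compose[OF aG] unfolding lie_algebra_def tangent_space_def by auto
qed

section \<open>The commutative algebra defined by S\<close>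

text \<open>The quasi-regular elements of ring theory: those \<open>x\<close> for which 1 + x is
  invertible once a unit is adjoined.\<close>

definition unit_set :: "('v::real_normed_vector \<Rightarrow>\<^sub>L 'v \<Rightarrow>\<^sub>L 'v) \<Rightarrow> 'v set" where
  "unit_set S = {x. id_blinfun + S x \<in> carrier GL}"

definition unit_comp :: "('v::real_normed_vector \<Rightarrow>\<^sub>L 'v \<Rightarrow>\<^sub>L 'v) \<Rightarrow> 'v set" where
  "unit_comp S = connected_component_set (unit_set S) 0"

definition graph_point :: "('v::real_normed_vector \<Rightarrow>\<^sub>L 'v \<Rightarrow>\<^sub>L 'v) \<Rightarrow> 'v \<Rightarrow> ('v \<Rightarrow>\<^sub>L 'v) \<times> 'v" where
  "graph_point S x = (id_blinfun + S x, x)"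

definition graph_group :: "('v::real_normed_vector \<Rightarrow>\<^sub>L 'v \<Rightarrow>\<^sub>L 'v) \<Rightarrow> (('v \<Rightarrow>\<^sub>L 'v) \<times> 'v) topology" where
  "graph_group S = top_of_set (graph_point S ` unit_comp S)"

text \<open>The circle operation of ring theory, determined by (1 + x)(1 + y) = 1 + circ x
  y.\<close>

definition circ :: "('v::real_normed_vector \<Rightarrow>\<^sub>L 'v \<Rightarrow>\<^sub>L 'v) \<Rightarrow> 'v \<Rightarrow> 'v \<Rightarrow> 'v" where
  "circ S x y = x + y + S x y"

lemma snd_graph_point [simp]: "snd (graph_point S x) = x"
  by (simp add: graph_point_def)

lemma graph_point_0 [simp]: "graph_point S 0 = \<one>\<^bsub>Aff\<^esub>"
  by (simp add: graph_point_def)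

lemma graph_point_snd [simp]: "h \<in> graph_point S ` A \<Longrightarrow> graph_point S (snd h) = h"
  by auto

lemma snd_image_graph_point [simp]: "snd ` graph_point S ` A = A"
  by (auto simp: image_image)

lemma continuous_on_graph_point: "continuous_on A (graph_point S)"
  unfolding graph_point_def by (intro continuous_intros)

lemma topspace_graph_group [simp]: "topspace (graph_group S) = graph_point S ` unit_comp S"
  by (simp add: graph_group_def)

lemma unit_comp_subset: "unit_comp S \<subseteq> unit_set S"
  by (simp add: unit_comp_def connected_component_subset)

lemma unit_set_0: "0 \<in> unit_set S"
  using monoid.one_closed[OF group.is_monoid[OF group_GL]] by (simp add: unit_set_def)

lemma unit_comp_0: "0 \<in> unit_comp S"
  using unit_set_0 by (simp add: unit_comp_def)

lemma unit_compD: "x \<in> unit_comp S \<Longrightarrow> id_blinfun + S x \<in> carrier GL"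
  using unit_comp_subset by (auto simp: unit_set_def)

lemma graph_point_carrier: "x \<in> unit_comp S \<Longrightarrow> graph_point S x \<in> carrier Aff"
  by (simp add: graph_point_def Aff_carrier unit_compD)

lemma connected_unit_comp: "connected (unit_comp S)"
  by (simp add: unit_comp_def)

lemma unit_comp_maximal:
  assumes "x \<in> unit_comp S" "x \<in> A" "connected A" "A \<subseteq> unit_set S"
  shows "A \<subseteq> unit_comp S"
  using connected_component_maximal[OF assms(2-4)] connected_component_eq[of x "unit_set S" 0] assms(1)
  unfolding unit_comp_def by auto

lemma open_unit_set:
  assumes "fin_dim TYPE('v::real_normed_vector)"
  shows "open (unit_set (S :: 'v \<Rightarrow>\<^sub>L 'v \<Rightarrow>\<^sub>L 'v))"
proof -
  have "continuous_on UNIV (\<lambda>x. id_blinfun + S x)" by (intro continuous_intros)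
  from open_vimage[OF open_GL[OF assms] this] show ?thesis by (simp add: unit_set_def vimage_def)
qed

lemma open_unit_comp:
  assumes "fin_dim TYPE('v::real_normed_vector)"
  shows "open (unit_comp (S :: 'v \<Rightarrow>\<^sub>L 'v \<Rightarrow>\<^sub>L 'v))"
  unfolding unit_comp_def by (rule open_connected_component[OF open_unit_set[OF assms]])

text \<open>\<open>snd\<close> maps the graph homeomorphically onto an open subset of the vector
  space. In this form the topology is compared both with that of an abstract group \<open>H\<close>
  and with that of a conjugate.\<close>

lemma openin_graph_group:
  assumes "fin_dim TYPE('v::real_normed_vector)"
  shows "openin (graph_group (S :: 'v \<Rightarrow>\<^sub>L 'v \<Rightarrow>\<^sub>L 'v)) X \<longleftrightarrow> X \<subseteq> graph_point S ` unit_comp S \<and> open (snd ` X)"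
proof safe
  assume "openin (graph_group S) X"
  then obtain T where T: "open T" "X = graph_point S ` unit_comp S \<inter> T"
    by (auto simp: graph_group_def openin_open)
  have "X = graph_point S ` (unit_comp S \<inter> graph_point S -` T)" using T(2) by auto
  then have "snd ` X = unit_comp S \<inter> graph_point S -` T" by simp
  moreover have "open (graph_point S -` T)" by (rule open_vimage[OF T(1) continuous_on_graph_point])
  ultimately show "open (snd ` X)" using open_unit_comp[OF assms] by auto
  show "x \<in> graph_point S ` unit_comp S" if "x \<in> X" for x using that T by auto
next
  assume X: "X \<subseteq> graph_point S ` unit_comp S" "open (snd ` X)"
  have "h \<in> X" if "h \<in> graph_point S ` unit_comp S" "snd h \<in> snd ` X" for h
  proof -
    obtain h' where h': "h' \<in> X" "snd h' = snd h" using \<open>snd h \<in> snd ` X\<close> by auto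
    then have "h' = h" using graph_point_snd[of h' S] graph_point_snd[OF that(1)] X(1) by (metis subsetD)
    then show ?thesis using h' by simp
  qed
  then have "X = graph_point S ` unit_comp S \<inter> snd -` (snd ` X)" using X(1) by blast
  moreover have "open (snd -` (snd ` X) :: (('v \<Rightarrow>\<^sub>L 'v) \<times> 'v) set)" by (rule open_vimage_snd[OF X(2)])
  ultimately show "openin (graph_group S) X" unfolding graph_group_def openin_open by blast
qed

locale comm_alg =
  fixes S :: "'v::real_normed_vector \<Rightarrow>\<^sub>L 'v \<Rightarrow>\<^sub>L 'v"
  assumes fd: "fin_dim TYPE('v)"
    and sym: "\<And>x y. S x y = S y x"
    and comm: "\<And>x y z. S x (S y z)
      = S y (S x z)"
begin

abbreviation m :: "'v \<Rightarrow> 'v \<Rightarrow> 'v" where "m x y \<equiv> S x y"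

text \<open>Commutativity turns the commuting of multiplications into associativity: (xy)z = z(xy) =
  x(zy) = x(yz).\<close>

lemma assoc: "m (m x y) z = m x (m y z)"
  by (metis sym comm)

lemma S_mult: "S (m x y) = S x o\<^sub>L S y"
  by (rule blinfun_eqI) (simp add: assoc)

lemma circ_compose:
  "(id_blinfun + S x) o\<^sub>L (id_blinfun + S y) = id_blinfun + S (circ S x y)"
  by (rule blinfun_eqI) (simp add: circ_def blinfun.add_left blinfun.add_right assoc)

lemma circ_commute: "circ S x y = circ S y x"
  by (simp add: circ_def sym[of x y])

lemma circ_0 [simp]: "circ S x 0 = x" "circ S 0 x = x"
  by (simp_all add: circ_def)

lemma graph_point_mult: "graph_point S x \<otimes>\<^bsub>Aff\<^esub> graph_point S y = graph_point S (circ S x y)"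
  unfolding graph_point_def by (simp add: circ_compose) (simp add: circ_def blinfun.add_left)

lemma unit_set_circ:
  assumes "x \<in> unit_set S" "y \<in> unit_set S" shows "circ S x y \<in> unit_set S"
  using monoid.m_closed[OF group.is_monoid[OF group_GL]] assms
  unfolding unit_set_def by (metis (no_types, lifting) GL_mult circ_compose mem_Collect_eq)

lemma unit_set_inverse:
  assumes "x \<in> unit_set S"
  obtains y where "y \<in> unit_set S" "circ S x y = 0" "circ S y x = 0"
proof -
  let ?A = "id_blinfun + S x"
  have A: "?A \<in> carrier GL" using assms by (simp add: unit_set_def)
  \<comment> \<open>The equation x + y + x y = 0 says that 1 + S_x sends \<open>y\<close> to
    \<open>-x\<close>.\<close>
  define y where "y = - (inv\<^bsub>GL\<^esub> ?A) x"
  have "?A y = - x" by (simp add: y_def blinfun.minus_right GL_inv_apply[OF A])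
  then have xy: "circ S x y = 0" by (simp add: circ_def blinfun.add_left algebra_simps)
  then have yx: "circ S y x = 0" by (simp add: circ_commute)
  have "id_blinfun + S y \<in> carrier GL"
    unfolding GL_carrier using circ_compose[of x y] circ_compose[of y x] xy yx
    by (intro exI[of _ ?A]) simp
  then show thesis using that xy yx by (simp add: unit_set_def)
qed

text \<open>Composition with \<open>x\<close> sends the component to a connected set through
  \<open>x = circ S x 0\<close>, which therefore stays in the component.\<close>

lemma unit_comp_circ:
  assumes x: "x \<in> unit_comp S" and y: "y \<in> unit_comp S" shows "circ S x y \<in> unit_comp S"
proof -
  have "circ S x ` unit_comp S \<subseteq> unit_comp S"
  proof (rule unit_comp_maximal[OF x])
    show "x \<in> circ S x ` unit_comp S" using unit_comp_0 by (metis circ_0(1) imageI)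
    have "continuous_on (unit_comp S) (circ S x)" unfolding circ_def by (intro continuous_intros)
    then show "connected (circ S x ` unit_comp S)" by (rule connected_continuous_image[OF _ connected_unit_comp])
    show "circ S x ` unit_comp S \<subseteq> unit_set S" using unit_set_circ x unit_comp_subset by blast
  qed
  then show ?thesis using y by auto
qed

text \<open>Composition with the quasi-inverse \<open>y\<close> sends the component to a connected
  set containing both \<open>circ S y x = 0\<close> and \<open>circ S y 0 = y\<close>.\<close>

lemma unit_comp_inverse:
  assumes x: "x \<in> unit_comp S"
  obtains y where "y \<in> unit_comp S" "circ S x y = 0" "circ S y x = 0"
proof -
  obtain y where y: "y \<in> unit_set S" "circ S x y = 0" "circ S y x = 0"
    using unit_set_inverse x unit_comp_subset by blast
  have "circ S y ` unit_comp S \<subseteq> unit_comp S"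
  proof (rule unit_comp_maximal[OF unit_comp_0])
    show "0 \<in> circ S y ` unit_comp S" using y x by (metis imageI)
    have "continuous_on (unit_comp S) (circ S y)" unfolding circ_def by (intro continuous_intros)
    then show "connected (circ S y ` unit_comp S)" by (rule connected_continuous_image[OF _ connected_unit_comp])
    show "circ S y ` unit_comp S \<subseteq> unit_set S" using unit_set_circ y unit_comp_subset by blast
  qed
  then have "y \<in> unit_comp S" using unit_comp_0 by (metis circ_0(1) imageI subsetD)
  then show thesis using that y by blast
qed

text \<open>\<open>d x'\<close> is the small element that moves \<open>x\<close> to
  \<open>x'\<close>. Continuity of \<open>d\<close> transports statements about a neighbourhood of 0
  to a neighbourhood of \<open>x\<close>.\<close>

lemma circ_local:
  assumes x: "x \<in> unit_set S"
  defines "d \<equiv> \<lambda>x'. (inv\<^bsub>GL\<^esub> (id_blinfun + S x)) (x' - x)"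
  shows "circ S x (d x') = x'" "d x = 0" "continuous_on UNIV d"
proof -
  have A: "id_blinfun + S x \<in> carrier GL" using x by (simp add: unit_set_def)
  have "d x' + m x (d x') = x' - x"
    using GL_inv_apply(2)[OF A, of "x' - x"] by (simp add: d_def blinfun.add_left)
  then show "circ S x (d x') = x'" by (simp add: circ_def algebra_simps)
  show "d x = 0" by (simp add: d_def)
  show "continuous_on UNIV d" unfolding d_def by (intro continuous_intros)
qed

text \<open>Membership in \<open>A\<close> is unchanged by small translations, hence locally
  constant on \<open>unit_set S\<close> and constant on the component. It is applied to the
  projection of \<open>H\<close> and to the set where 1 + S_x lies in \<open>G\<close>.\<close>

lemma unit_comp_subset_if_locally_invariant:
  assumes \<delta>: "\<delta> > 0" and 0: "0 \<in> A"
    and inv: "\<And>x y. x \<in> unit_set S \<Longrightarrow> y \<in> ball 0 \<delta> \<Longrightarrow> circ S x y \<in> unit_set S \<Longrightarrow> x \<in> A \<longleftrightarrow> circ S x y \<in> A"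
  shows "unit_comp S \<subseteq> A"
proof -
  have loc: "\<exists>N. open N \<and> x \<in> N \<and> (\<forall>x'\<in>N \<inter> unit_set S. x' \<in> A \<longleftrightarrow> x \<in> A)" if x: "x \<in> unit_set S" for x
  proof -
    let ?d = "\<lambda>x'. (inv\<^bsub>GL\<^esub> (id_blinfun + S x)) (x' - x)"
    have "open (?d -` ball 0 \<delta>)" by (rule open_vimage[OF open_ball circ_local(3)[OF x]])
    moreover have "x \<in> ?d -` ball 0 \<delta>" using \<delta> by simp
    moreover have "x' \<in> A \<longleftrightarrow> x \<in> A" if "x' \<in> ?d -` ball 0 \<delta>" "x' \<in> unit_set S" for x'
      using inv[OF x, of "?d x'"] that circ_local(1)[OF x, of x'] by simp
    ultimately show ?thesis by blast
  qed
  \<comment> \<open>Open sets of the whole space on whose trace in \<open>unit_set S\<close>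
    membership in \<open>A\<close> is locally always true, respectively always false.\<close>
  define U1 where "U1 = {x. \<exists>N. open N \<and> x \<in> N \<and> (\<forall>x'\<in>N \<inter> unit_set S. x' \<in> A)}"
  define U2 where "U2 = {x. \<exists>N. open N \<and> x \<in> N \<and> (\<forall>x'\<in>N \<inter> unit_set S. x' \<notin> A)}"
  have o: "open U1" "open U2" unfolding U1_def U2_def
    by (subst open_subopen; blast)+
  have cover: "unit_comp S \<subseteq> U1 \<union> U2"
  proof
    fix x assume "x \<in> unit_comp S"
    then have "x \<in> unit_set S" using unit_comp_subset by blast
    from loc[OF this] show "x \<in> U1 \<union> U2" unfolding U1_def U2_def by (cases "x \<in> A") auto
  qed
  have disj: "U1 \<inter> U2 \<inter> unit_comp S = {}" using unit_comp_subset unfolding U1_def U2_def by blast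
  have 01: "0 \<in> U1" using loc[OF unit_set_0] 0 unfolding U1_def by blast
  have "U2 \<inter> unit_comp S = {}"
    using connectedD[OF connected_unit_comp o disj cover] 01 unit_comp_0 by blast
  then show ?thesis using cover unit_comp_subset unfolding U1_def by blast
qed

section \<open>The graph as an Abelian Lie subgroup of the affine group\<close>

lemma graph_subgroup: "subgroup (graph_point S ` unit_comp S) Aff"
proof (rule group.subgroupI[OF group_Aff])
  show "graph_point S ` unit_comp S \<subseteq> carrier Aff"
    by (auto simp: graph_point_carrier)
  show "graph_point S ` unit_comp S \<noteq> {}" using unit_comp_0 by auto
  fix h assume "h \<in> graph_point S ` unit_comp S"
  then obtain x where x: "x \<in> unit_comp S" "h = graph_point S x" by auto
  obtain y where y: "y \<in> unit_comp S" "circ S x y = 0" "circ S y x = 0" using unit_comp_inverse[OF x(1)] .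
  have "inv\<^bsub>Aff\<^esub> h = graph_point S y"
    by (rule group.inv_equality[OF group_Aff]) (use x y graph_point_carrier in \<open>simp_all add: graph_point_mult\<close>)
  then show "inv\<^bsub>Aff\<^esub> h \<in> graph_point S ` unit_comp S" using y by simp
next
  fix h h' assume "h \<in> graph_point S ` unit_comp S" "h' \<in> graph_point S ` unit_comp S"
  then show "h \<otimes>\<^bsub>Aff\<^esub> h' \<in> graph_point S ` unit_comp S"
    using unit_comp_circ by (auto simp: graph_point_mult)
qed

lemma graph_comm_group: "comm_group (Aff\<lparr>carrier := topspace (graph_group S)\<rparr>)"
proof (rule group.group_comm_groupI)
  show "group (Aff\<lparr>carrier := topspace (graph_group S)\<rparr>)"
    using subgroup.subgroup_is_group[OF graph_subgroup group_Aff] by simp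
next
  fix x y assume "x \<in> carrier (Aff\<lparr>carrier := topspace (graph_group S)\<rparr>)" "y \<in> carrier (Aff\<lparr>carrier := topspace (graph_group S)\<rparr>)"
  then show "x \<otimes>\<^bsub>Aff\<lparr>carrier := topspace (graph_group S)\<rparr>\<^esub> y = y \<otimes>\<^bsub>Aff\<lparr>carrier := topspace (graph_group S)\<rparr>\<^esub> x"
    by (auto simp: graph_point_mult circ_commute)
qed

lemma fd_Aff: "fin_dim TYPE(('v \<Rightarrow>\<^sub>L 'v) \<times> 'v)"
  by (intro fin_dim_prod fin_dim_blinfun fd)

lemma graph_linear_subspace: "subspace (range (\<lambda>x. (S x, x)))"
  by (rule linear_subspace_image[OF linearI subspace_UNIV]) (auto simp: blinfun.add_right blinfun.scaleR_right)

text \<open>The graph lies in the translate by \<open>(id_blinfun, 0)\<close> of the linear subspace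
  of all (S_x, x), so this translation is a single chart around every point.\<close>

lemma graph_immersed: "immersed_submanifold (graph_group S)"
  unfolding immersed_submanifold_def
proof (intro conjI ballI)
  show "second_countable (graph_group S)"
    unfolding graph_group_def by (rule second_countable_subtopology[OF fin_dim_second_countable[OF fd_Aff]])
  fix p assume p: "p \<in> topspace (graph_group S)"
  define W where "W = range (\<lambda>x. (S x, x))"
  define \<Omega> :: "(('v \<Rightarrow>\<^sub>L 'v) \<times> 'v) set" where "\<Omega> = snd -` unit_comp S"
  define \<psi> :: "('v \<Rightarrow>\<^sub>L 'v) \<times> 'v \<Rightarrow> ('v \<Rightarrow>\<^sub>L 'v) \<times> 'v" where "\<psi> = (\<lambda>h. h + (id_blinfun, 0))"
  have o\<Omega>: "open \<Omega>" unfolding \<Omega>_def by (rule open_vimage_snd[OF open_unit_comp[OF fd]])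
  have WO: "W \<inter> \<Omega> = (\<lambda>x. (S x, x)) ` unit_comp S" by (auto simp: W_def \<Omega>_def)
  have im: "\<psi> ` (W \<inter> \<Omega>) = graph_point S ` unit_comp S"
    unfolding WO image_image by (simp add: \<psi>_def graph_point_def add.commute)
  have der: "frechet_derivative \<psi> (at h) = (\<lambda>v. v)" for h
    unfolding \<psi>_def by (rule frechet_derivative_at[symmetric]) (auto intro!: derivative_eq_intros)
  have "smooth_on \<Omega> \<psi>" unfolding \<psi>_def by (intro smooth_on_add smooth_on_ident smooth_on_const o\<Omega>)
  moreover have "homeomorphic_map (top_of_set (W \<inter> \<Omega>)) (subtopology (graph_group S) (\<psi> ` (W \<inter> \<Omega>))) \<psi>"
  proof -
    have "homeomorphic_maps (top_of_set (W \<inter> \<Omega>)) (top_of_set (\<psi> ` (W \<inter> \<Omega>))) \<psi> (\<lambda>h. h - (id_blinfun, 0))"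
      unfolding homeomorphic_maps_def \<psi>_def
      by (auto simp: continuous_map_in_subtopology intro!: continuous_intros simp del: add_Pair diff_Pair)
    then show ?thesis unfolding graph_group_def im
      by (auto simp: subtopology_subtopology homeomorphic_map_maps)
  qed
  moreover have "openin (graph_group S) (\<psi> ` (W \<inter> \<Omega>))"
    using openin_topspace[of "graph_group S"] by (simp add: im)
  moreover have "p \<in> \<psi> ` (W \<inter> \<Omega>)" using p im by simp
  moreover have "\<forall>x\<in>W \<inter> \<Omega>. inj_on (frechet_derivative \<psi> (at x)) W" by (simp add: der)
  moreover have "subspace W" unfolding W_def by (rule graph_linear_subspace)
  ultimately show "\<exists>(W :: (('v \<Rightarrow>\<^sub>L 'v) \<times> 'v) set) \<Omega> \<psi>. subspace W \<and> open \<Omega> \<and> smooth_on \<Omega> \<psi> \<and>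
       (\<forall>x\<in>W \<inter> \<Omega>. inj_on (frechet_derivative \<psi> (at x)) W) \<and>
       p \<in> \<psi> ` (W \<inter> \<Omega>) \<and> openin (graph_group S) (\<psi> ` (W \<inter> \<Omega>)) \<and>
       homeomorphic_map (top_of_set (W \<inter> \<Omega>)) (subtopology (graph_group S) (\<psi> ` (W \<inter> \<Omega>))) \<psi>"
    using o\<Omega> by - (rule exI[of _ W], rule exI[of _ \<Omega>], rule exI[of _ \<psi>], intro conjI; assumption)
qed

text \<open>The graph carries the subspace topology, so a map that is smooth into the ambient space
  and has values in the graph is smooth into it. The last assumption says that the topology of
  \<open>M\<close> is at least as fine as its subspace topology.\<close>

lemma smooth_map_into_graph:
  fixes M :: "'e::real_normed_vector topology" 
  assumes "topspace M \<subseteq> \<Omega>" "open \<Omega>" "smooth_on \<Omega> F" "\<And>x. x \<in> topspace M \<Longrightarrow> f x = F x"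
    and "f ` topspace M \<subseteq> graph_point S ` unit_comp S"
    and "continuous_map M (top_of_set (topspace M)) (\<lambda>x. x)"
  shows "smooth_map M (graph_group S) f"
proof (rule smooth_mapI_global[OF _ assms(3,2,1,4)])
  have "continuous_on (topspace M) f"
    by (rule continuous_on_eq[OF continuous_on_subset[OF smooth_on_continuous[OF assms(3)] assms(1)]])
      (simp add: assms(4))
  then have "continuous_map (top_of_set (topspace M)) (graph_group S) f"
    unfolding graph_group_def using assms(5) by (auto simp: continuous_map_in_subtopology)
  from continuous_map_compose[OF assms(6) this] show "continuous_map M (graph_group S) f" by (simp add: o_def)
qed

lemma graph_lie_subgroup: "lie_subgroup Aff (graph_group S)"
  unfolding lie_subgroup_def
proof (intro conjI)
  let ?g = "graph_point S ` unit_comp S"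
  show "subgroup (topspace (graph_group S)) Aff" using graph_subgroup by simp
  show "immersed_submanifold (graph_group S)" by (rule graph_immersed)
  define F :: "(('v \<Rightarrow>\<^sub>L 'v) \<times> 'v) \<times> (('v \<Rightarrow>\<^sub>L 'v) \<times> 'v) \<Rightarrow> ('v \<Rightarrow>\<^sub>L 'v) \<times> 'v" where
    "F z = (fst (fst z) o\<^sub>L fst (snd z), fst (fst z) (snd (snd z)) + snd (fst z))" for z
  have F: "smooth_on UNIV F" unfolding F_def
    by (intro smooth_on_Pair smooth_on_add smooth_on_bilinear[OF _ bounded_bilinear_blinfun_compose]
        smooth_on_bilinear[OF _ bounded_bilinear_blinfun_apply] smooth_on_bounded_linear open_UNIV
        bounded_linear_compose[OF bounded_linear_fst bounded_linear_fst] bounded_linear_compose[OF bounded_linear_fst bounded_linear_snd]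
        bounded_linear_compose[OF bounded_linear_snd bounded_linear_fst] bounded_linear_compose[OF bounded_linear_snd bounded_linear_snd])
  show "smooth_map (prod_topology (graph_group S) (graph_group S)) (graph_group S) (\<lambda>(x, y). x \<otimes>\<^bsub>Aff\<^esub> y)"
  proof (rule smooth_map_into_graph[OF subset_UNIV open_UNIV F])
    show "(\<lambda>(x, y). x \<otimes>\<^bsub>Aff\<^esub> y) ` topspace (prod_topology (graph_group S) (graph_group S)) \<subseteq> ?g"
      using graph_subgroup by (auto dest: subgroup.m_closed)
    show "continuous_map (prod_topology (graph_group S) (graph_group S))
        (top_of_set (topspace (prod_topology (graph_group S) (graph_group S)))) (\<lambda>x. x)"
      by (simp add: graph_group_def prod_topology_subtopology_eu)
  qed (auto simp: F_def graph_point_def)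
  define I :: "('v \<Rightarrow>\<^sub>L 'v) \<times> 'v \<Rightarrow> ('v \<Rightarrow>\<^sub>L 'v) \<times> 'v" where
    "I z = (inv\<^bsub>GL\<^esub> (fst z), - (inv\<^bsub>GL\<^esub> (fst z)) (snd z))" for z
  define \<Omega> :: "(('v \<Rightarrow>\<^sub>L 'v) \<times> 'v) set" where "\<Omega> = fst -` carrier GL"
  have o: "open \<Omega>" unfolding \<Omega>_def by (rule open_vimage_fst[OF open_GL[OF fd]])
  have si: "smooth_on \<Omega> (\<lambda>z. inv\<^bsub>GL\<^esub> (fst z))"
    by (rule smooth_on_compose[OF fin_dim_blinfun[OF fd fd] o smooth_on_bounded_linear[OF bounded_linear_fst] smooth_on_GL_inv[OF fd]])
      (auto simp: \<Omega>_def)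
  have I: "smooth_on \<Omega> I" unfolding I_def
    by (intro smooth_on_Pair si o smooth_on_bounded_linear_compose[OF bounded_linear_minus[OF bounded_linear_ident]]
      smooth_on_bilinear[OF o bounded_bilinear_blinfun_apply] smooth_on_bounded_linear[OF bounded_linear_snd])
  show "smooth_map (graph_group S) (graph_group S) (\<lambda>x. inv\<^bsub>Aff\<^esub> x)"
  proof (rule smooth_map_into_graph[OF _ o I])
    show sub: "topspace (graph_group S) \<subseteq> \<Omega>"
      by (auto simp: \<Omega>_def graph_point_def unit_compD)
    show "inv\<^bsub>Aff\<^esub> x = I x" if "x \<in> topspace (graph_group S)" for x
      using that by (auto simp: I_def graph_point_def Aff_inv unit_compD)
    show "(\<lambda>x. inv\<^bsub>Aff\<^esub> x) ` topspace (graph_group S) \<subseteq> ?g"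
      using graph_subgroup by (auto dest: subgroup.m_inv_closed)
    show "continuous_map (graph_group S) (top_of_set (topspace (graph_group S))) (\<lambda>x. x)"
      by (simp add: graph_group_def)
  qed
qed

lemma graph_connected: "connected_space (graph_group S)"
  unfolding graph_group_def
  using connected_continuous_image[OF continuous_on_graph_point connected_unit_comp]
  by (simp add: connectedin_iff_connected[symmetric] connectedin_def del: connectedin_iff_connected)

lemma graph_curve:
  assumes x: "x \<in> unit_comp S"
  shows "curve_through (graph_group S) (graph_point S x) (S X, X) (\<lambda>t. graph_point S (x + t *\<^sub>R X))"
proof -
  let ?l = "\<lambda>t::real. x + t *\<^sub>R X"
  have "open (?l -` unit_comp S)" by (rule open_vimage[OF open_unit_comp[OF fd]]) (intro continuous_intros)
  moreover have "0 \<in> ?l -` unit_comp S" using x by simp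
  ultimately obtain \<epsilon> where \<epsilon>: "\<epsilon> > 0" "ball 0 \<epsilon> \<subseteq> ?l -` unit_comp S" using openE by blast
  have I: "?l t \<in> unit_comp S" if "t \<in> {-\<epsilon><..<\<epsilon>}" for t
    using \<epsilon>(2) that by (auto simp: subset_iff dist_real_def)
  have "smooth_map (top_of_set {-\<epsilon><..<\<epsilon>}) (graph_group S) (\<lambda>t. graph_point S (?l t))"
  proof (rule smooth_map_into_graph[OF subset_UNIV open_UNIV])
    have sx: "smooth_on UNIV ?l"
      by (intro smooth_on_add smooth_on_const smooth_on_bounded_linear bounded_linear_scaleR_left open_UNIV)
    show "smooth_on UNIV (\<lambda>t. graph_point S (?l t))" unfolding graph_point_def
      by (intro smooth_on_Pair sx open_UNIV smooth_on_add[OF _ smooth_on_const smooth_on_bounded_linear_compose[OF _ sx]] blinfun.bounded_linear_right)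
  qed (use I in \<open>auto simp: image_subset_iff\<close>)
  moreover have "((\<lambda>t. graph_point S (?l t)) has_vector_derivative (S X, X)) (at 0)"
    unfolding graph_point_def
    by (auto intro!: derivative_eq_intros has_vector_derivative_Pair bounded_linear.has_vector_derivative[OF blinfun.bounded_linear_right]
       simp: has_vector_derivative_def blinfun.scaleR_right)
  ultimately show ?thesis unfolding curve_through_def using \<epsilon>(1) by auto
qed

lemma graph_tangent_space:
  assumes x: "x \<in> unit_comp S"
  shows "tangent_space (graph_group S) (graph_point S x) = range (\<lambda>X. (S X, X))"
proof
  show "range (\<lambda>X. (S X, X)) \<subseteq> tangent_space (graph_group S) (graph_point S x)"
    using graph_curve[OF x] by (auto simp: tangent_space_def)
  show "tangent_space (graph_group S) (graph_point S x) \<subseteq> range (\<lambda>X. (S X, X))"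
  proof
    fix v assume "v \<in> tangent_space (graph_group S) (graph_point S x)"
    then obtain c \<epsilon> where c: "\<epsilon> > 0" "smooth_map (top_of_set {-\<epsilon><..<\<epsilon>}) (graph_group S) c" "(c has_vector_derivative v) (at 0)"
      by (auto simp: tangent_space_def curve_through_def)
    have "c t \<in> graph_point S ` unit_comp S" if "t \<in> {-\<epsilon><..<\<epsilon>}" for t
      using c(2) that by (auto simp: smooth_map_def continuous_map_def Pi_iff)
    then have eq: "fst (c t) = id_blinfun + S (snd (c t))" if "t \<in> {-\<epsilon><..<\<epsilon>}" for t
      using that by (auto simp: graph_point_def image_iff) fastforce
    have s: "((\<lambda>t. snd (c t)) has_vector_derivative snd v) (at 0)"
      by (rule bounded_linear.has_vector_derivative[OF bounded_linear_snd c(3)])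
    have "((\<lambda>t. id_blinfun + S (snd (c t))) has_vector_derivative 0 + S (snd v)) (at 0)"
      by (intro has_vector_derivative_add has_vector_derivative_const bounded_linear.has_vector_derivative[OF blinfun.bounded_linear_right s])
    then have "((\<lambda>t. fst (c t)) has_vector_derivative 0 + S (snd v)) (at 0)"
      by (rule has_vector_derivative_transform_within_open[where S = "{-\<epsilon><..<\<epsilon>}"]) (use c(1) eq in auto)
    then have "fst v = 0 + S (snd v)"
      using bounded_linear.has_vector_derivative[OF bounded_linear_fst c(3)] vector_derivative_unique_at by blast
    then show "v \<in> range (\<lambda>X. (S X, X))"
      by (intro image_eqI[of _ _ "snd v"]) (auto simp: prod_eq_iff)
  qed
qed

end

section \<open>Abelian almost simply transitive groups are graphs\<close>

lemma orbit_map_eq: "orbit_map h = snd h"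
  by (simp add: orbit_map_def aff_apply_def)

lemma lie_algebraE:
  assumes "v \<in> lie_algebra K H"
  obtains c \<epsilon> where "\<epsilon> > 0" "\<And>t. \<bar>t\<bar> < \<epsilon> \<Longrightarrow> c t \<in> topspace H" "c 0 = \<one>\<^bsub>K\<^esub>" "(c has_vector_derivative v) (at 0)"
proof -
  obtain c \<epsilon> where c: "\<epsilon> > 0" "smooth_map (top_of_set {-\<epsilon><..<\<epsilon>}) H c" "c 0 = \<one>\<^bsub>K\<^esub>" "(c has_vector_derivative v) (at 0)"
    using assms by (auto simp: lie_algebra_def tangent_space_def curve_through_def)
  have "c t \<in> topspace H" if "\<bar>t\<bar> < \<epsilon>" for t
    using c(2) that by (auto simp: smooth_map_def continuous_map_def Pi_iff abs_less_iff)
  then show thesis using that c by blast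
qed

text \<open>Differentiates at the unit an affine identity holding on all of \<open>H\<close>. Every
  infinitesimal consequence of commutativity below is an instance.\<close>

lemma lie_algebra_linear_identity:
  fixes P Q :: "'e::real_normed_vector \<Rightarrow> 'f::real_normed_vector"
  assumes v: "v \<in> lie_algebra K H" and P: "bounded_linear P" and Q: "bounded_linear Q"
    and eq: "\<And>h. h \<in> topspace H \<Longrightarrow> P h = Q h + k"
  shows "P v = Q v"
proof -
  obtain c \<epsilon> where c: "\<epsilon> > 0" "\<And>t. \<bar>t\<bar> < \<epsilon> \<Longrightarrow> c t \<in> topspace H" "(c has_vector_derivative v) (at 0)"
    using lie_algebraE[OF v] by metis
  have "((\<lambda>t. Q (c t) + k) has_vector_derivative Q v + 0) (at 0)"
    by (intro has_vector_derivative_add has_vector_derivative_const bounded_linear.has_vector_derivative[OF Q c(3)])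
  then have "((\<lambda>t. P (c t)) has_vector_derivative Q v + 0) (at 0)"
    by (rule has_vector_derivative_transform_within_open[where S = "{-\<epsilon><..<\<epsilon>}"]) (use c(1,2) eq in auto)
  then show ?thesis
    using vector_derivative_unique_at[OF bounded_linear.has_vector_derivative[OF P c(3)]] by simp
qed

locale ast_group =
  fixes G :: "('v::real_normed_vector \<Rightarrow>\<^sub>L 'v) topology" and H :: "(('v \<Rightarrow>\<^sub>L 'v) \<times> 'v) topology"
  assumes fd: "fin_dim TYPE('v)" and H: "H \<in> AST G"
begin

lemma fdE: "fin_dim TYPE('v \<Rightarrow>\<^sub>L 'v)" by (rule fin_dim_blinfun[OF fd fd])
lemma fdA: "fin_dim TYPE(('v \<Rightarrow>\<^sub>L 'v) \<times> 'v)" by (rule fin_dim_prod[OF fdE fd])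

lemma lie: "lie_subgroup Aff H" and imm: "immersion H (Aff_G G) (\<lambda>h. h)" and conn: "connected_space H"
  and cgr: "comm_group (Aff\<lparr>carrier := topspace H\<rparr>)" and ast: "almost_simply_transitive H"
  using H by (auto simp: AST_def abelian_groups_of_type_def affine_group_of_type_def)

abbreviation "\<hh> \<equiv> lie_algebra Aff H"
abbreviation "S \<equiv> linear_part H"

lemma one_in: "\<one>\<^bsub>Aff\<^esub> \<in> topspace H"
  using lie by (auto simp: lie_subgroup_def dest: subgroup.one_closed)

lemma commute: "h \<in> topspace H \<Longrightarrow> h' \<in> topspace H \<Longrightarrow> h \<otimes>\<^bsub>Aff\<^esub> h' = h' \<otimes>\<^bsub>Aff\<^esub> h"
  using comm_monoid.m_comm[OF comm_group.axioms(1)[OF cgr]] by simp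

lemma orbit_differential_eq: "v \<in> \<hh> \<Longrightarrow> orbit_differential H v = snd v"
  unfolding orbit_differential_def lie_algebra_def
  by (rule differential_bounded_linear[OF _ bounded_linear_snd]) (auto simp: orbit_map_eq)

lemma bij_snd: "bij_betw snd \<hh> UNIV"
proof -
  have "bij_betw (orbit_differential H) \<hh> UNIV" using ast by (simp add: almost_simply_transitive_def)
  then show ?thesis using bij_betw_cong orbit_differential_eq by metis
qed

lemma rho: "rho H X \<in> \<hh>" "snd (rho H X) = X"
proof -
  have b: "bij_betw (orbit_differential H) \<hh> UNIV" using ast by (simp add: almost_simply_transitive_def)
  then have X: "X \<in> orbit_differential H ` \<hh>" by (simp add: bij_betw_def)
  show "rho H X \<in> \<hh>" unfolding rho_def by (rule inv_into_into[OF X])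
  then show "snd (rho H X) = X"
    using f_inv_into_f[OF X] orbit_differential_eq unfolding rho_def by simp
qed

lemma rho_unique: "v \<in> \<hh> \<Longrightarrow> rho H (snd v) = v"
  using bij_snd rho unfolding bij_betw_def by (auto dest: inj_onD)

text \<open>The Lie algebra is a subspace on which \<open>snd\<close> is injective, so sums and
  multiples of values of \<open>rho H\<close> are again its values.\<close>

lemma linear_rho: "linear (rho H)"
proof -
  have sub: "subspace \<hh>" by (rule lie_algebra_subspace[OF fdA lie])
  show ?thesis
  proof (rule linearI)
    fix x y :: 'v and r :: real
    show "rho H (x + y) = rho H x + rho H y"
      using rho_unique[OF subspace_add[OF sub rho(1)[of x] rho(1)[of y]]] by (simp add: rho(2))
    show "rho H (r *\<^sub>R x) = r *\<^sub>R rho H x"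
      using rho_unique[OF subspace_scale[OF sub rho(1)[of x], of r]] by (simp add: rho(2))
  qed
qed

lemma linear_part_apply: "S X = fst (rho H X)"
proof -
  have "linear (\<lambda>X. fst (rho H X))"
    using linear_rho by (intro linearI) (auto simp: linear_add linear_cmul)
  then show ?thesis
    unfolding linear_part_def by (subst bounded_linear_Blinfun_apply) (auto intro: fin_dim_bounded_linear[OF fd])
qed

lemma in_lie_algebra: "(S X, X) \<in> \<hh>"
  using rho[of X] linear_part_apply[of X] by (metis prod.collapse)

text \<open>The translational parts of h h' = h' h, with h' = (L', s'), read L s' + s = L' s + s'.
  Differentiation in h' along \<open>(S X, X)\<close> gives the formula.\<close>

lemma element_apply:
  assumes h: "(L, s) \<in> topspace H"
  shows "L X = S X s + X"
proof -
  have "(\<lambda>h. L (snd h)) (S X, X) = (\<lambda>h. blinfun_apply (fst h) s + snd h) (S X, X)"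
  proof (rule lie_algebra_linear_identity[OF in_lie_algebra, where P = "\<lambda>h. L (snd h)" and Q = "\<lambda>h. blinfun_apply (fst h) s + snd h"])
    show "bounded_linear (\<lambda>h. L (snd h))"
      by (rule bounded_linear_compose[OF blinfun.bounded_linear_right bounded_linear_snd])
    show "bounded_linear (\<lambda>h :: ('v \<Rightarrow>\<^sub>L 'v) \<times> 'v. blinfun_apply (fst h) s + snd h)"
      by (intro bounded_linear_add bounded_linear_snd bounded_linear_compose[OF blinfun.bounded_linear_left bounded_linear_fst])
    show "L (snd h') = blinfun_apply (fst h') s + snd h' + - s" if "h' \<in> topspace H" for h'
      using commute[OF h that] by (cases h') (auto simp: algebra_simps)
  qed
  then show ?thesis by simp
qed

lemma element_commute:
  assumes h: "(L, s) \<in> topspace H"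
  shows "L o\<^sub>L S X = S X o\<^sub>L L"
proof -
  have "(\<lambda>h. L o\<^sub>L fst h) (S X, X) = (\<lambda>h. fst h o\<^sub>L L) (S X, X)"
  proof (rule lie_algebra_linear_identity[OF in_lie_algebra, where P = "\<lambda>h. L o\<^sub>L fst h" and Q = "\<lambda>h. fst h o\<^sub>L L"])
    show "bounded_linear (\<lambda>h :: ('v \<Rightarrow>\<^sub>L 'v) \<times> 'v. L o\<^sub>L fst h)" "bounded_linear (\<lambda>h :: ('v \<Rightarrow>\<^sub>L 'v) \<times> 'v. fst h o\<^sub>L L)"
      by (rule bounded_linear_compose[OF _ bounded_linear_fst],
        simp add: bounded_bilinear.bounded_linear_right[OF bounded_bilinear_blinfun_compose]
        bounded_bilinear.bounded_linear_left[OF bounded_bilinear_blinfun_compose])+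
    show "L o\<^sub>L fst h' = (fst h' o\<^sub>L L) + 0" if "h' \<in> topspace H" for h'
      using commute[OF h that] by (cases h') auto
  qed
  then show ?thesis by simp
qed

text \<open>A second differentiation: \<open>element_apply\<close> is an affine identity in
  \<open>h\<close> and is differentiated along \<open>(S X, X)\<close>. \<open>S_comm\<close>
  follows in the same way from \<open>element_commute\<close>.\<close>

lemma S_sym: "S X Y = S Y X"
proof -
  have "(\<lambda>h. blinfun_apply (fst h) Y) (S X, X) = (\<lambda>h. S Y (snd h)) (S X, X)"
  proof (rule lie_algebra_linear_identity[OF in_lie_algebra, where P = "\<lambda>h. blinfun_apply (fst h) Y" and Q = "\<lambda>h. S Y (snd h)"])
    show "bounded_linear (\<lambda>h :: ('v \<Rightarrow>\<^sub>L 'v) \<times> 'v. blinfun_apply (fst h) Y)"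
      by (intro bounded_linear_compose[OF blinfun.bounded_linear_left bounded_linear_fst])
    show "bounded_linear (\<lambda>h. S Y (snd h))"
      by (rule bounded_linear_compose[OF blinfun.bounded_linear_right bounded_linear_snd])
    show "blinfun_apply (fst h) Y = S Y (snd h) + Y" if "h \<in> topspace H" for h
      using element_apply[of "fst h" "snd h" Y] that by simp
  qed
  then show ?thesis by simp
qed

lemma S_comm: "S X o\<^sub>L S Y = S Y o\<^sub>L S X"
proof -
  have "(\<lambda>h. fst h o\<^sub>L S Y) (S X, X) = (\<lambda>h. S Y o\<^sub>L fst h) (S X, X)"
  proof (rule lie_algebra_linear_identity[OF in_lie_algebra, where P = "\<lambda>h. fst h o\<^sub>L S Y" and Q = "\<lambda>h. S Y o\<^sub>L fst h"])
    show "bounded_linear (\<lambda>h :: ('v \<Rightarrow>\<^sub>L 'v) \<times> 'v. fst h o\<^sub>L S Y)" "bounded_linear (\<lambda>h :: ('v \<Rightarrow>\<^sub>L 'v) \<times> 'v. S Y o\<^sub>L fst h)"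
      by (rule bounded_linear_compose[OF _ bounded_linear_fst],
        simp add: bounded_bilinear.bounded_linear_right[OF bounded_bilinear_blinfun_compose]
        bounded_bilinear.bounded_linear_left[OF bounded_bilinear_blinfun_compose])+
    show "fst h o\<^sub>L S Y = (S Y o\<^sub>L fst h) + 0" if "h \<in> topspace H" for h
      using element_commute[of "fst h" "snd h" Y] that by simp
  qed
  then show ?thesis by simp
qed

sublocale comm_alg S
  using fd S_sym S_comm[THEN arg_cong[where f = "\<lambda>f. blinfun_apply f _"]] by unfold_locales auto

text \<open>The immersion into \<open>Aff_G G\<close> makes \<open>fst\<close> continuous into the
  topology of \<open>G\<close>, so curves in \<open>H\<close> project to curves of \<open>G\<close>
  and not only of the ambient space.\<close>

lemma S_in_lie_algebra: "S X \<in> lie_algebra GL G"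
proof -
  obtain c where c: "curve_through H \<one>\<^bsub>Aff\<^esub> (S X, X) c"
    using in_lie_algebra by (auto simp: lie_algebra_def tangent_space_def)
  have "continuous_map H (prod_topology G euclidean) (\<lambda>h. h)"
    using imm by (auto simp: immersion_def smooth_map_def Aff_G_def)
  then have "continuous_map H G fst"
    using continuous_map_compose[OF _ continuous_map_fst[of G "euclidean :: 'v topology"]] by (fastforce simp: o_def)
  then have sm: "smooth_map H G fst"
    by (rule smooth_mapI_global[where F = fst and \<Omega> = UNIV]) (auto intro: smooth_on_bounded_linear bounded_linear_fst)
  have "((\<lambda>t. fst (c t)) has_vector_derivative fst (S X, X)) (at 0)"
    using c by (intro bounded_linear.has_vector_derivative[OF bounded_linear_fst]) (simp add: curve_through_def)
  from curve_through_image[OF fdA sm c this] show ?thesis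
    by (auto simp: lie_algebra_def tangent_space_def)
qed

lemma linear_part_in_C': "S \<in> C' (lie_algebra GL G)"
  using S_in_lie_algebra S_sym S_comm by (auto simp: C'_def prolongation_def bracket_def)

lemma element_eq: "h \<in> topspace H \<Longrightarrow> h = graph_point S (snd h)"
  using element_apply[of "fst h" "snd h"] S_sym
  by (cases h) (auto simp: graph_point_def blinfun.add_left add.commute intro!: blinfun_eqI)

lemma continuous_map_snd_H: "continuous_map H euclidean snd"
proof -
  have "continuous_map H euclidean orbit_map"
    using ast by (auto simp: almost_simply_transitive_def immersion_def smooth_map_def)
  then show ?thesis by (simp add: orbit_map_eq[abs_def])
qed

section \<open>Recovering the points and the topology of \<open>H\<close> from
  \<open>S\<close>\<close>

lemma topspace_subset: "topspace H \<subseteq> graph_point S ` unit_comp S"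
proof -
  have sub: "snd ` topspace H \<subseteq> unit_set S"
  proof clarify
    fix L s assume h: "(L, s) \<in> topspace H"
    have "L \<in> carrier GL" using lie_subgroup_carrier[OF lie h] by (simp add: Aff_carrier)
    then show "snd (L, s) \<in> unit_set S" using element_eq[OF h] by (simp add: graph_point_def unit_set_def)
  qed
  have "connectedin euclidean (snd ` topspace H)"
    using connectedin_continuous_map_image[OF continuous_map_snd_H] conn
    by (simp add: connectedin_topspace del: connectedin_iff_connected)
  then have "connected (snd ` topspace H)" by simp
  moreover have "0 \<in> snd ` topspace H" using one_in by (force intro: image_eqI[of _ _ "\<one>\<^bsub>Aff\<^esub>"])
  ultimately have "snd ` topspace H \<subseteq> unit_comp S"
    using sub unit_comp_maximal[OF unit_comp_0] by blast
  then show ?thesis using element_eq by fastforce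
qed

text \<open>The inverse function theorem on the vector space, applied to a chart of \<open>H\<close>
  followed by \<open>snd\<close>, with the chart reparametrised by translational parts so that the
  derivative is the identity. The arbitrary neighbourhood \<open>N\<close> is what later yields
  openness for the topology of \<open>H\<close>.\<close>

lemma snd_open_at_one:
  assumes N: "openin H N" "\<one>\<^bsub>Aff\<^esub> \<in> N"
  obtains \<delta> where "\<delta> > 0" "ball 0 \<delta> \<subseteq> snd ` N"
proof -
  have im: "immersed_submanifold H" using lie by (simp add: lie_subgroup_def)
  obtain W \<Omega> \<psi> w where ch: "chart H W \<Omega> \<psi>" and w: "w \<in> W" "w \<in> \<Omega>" "\<psi> w = \<one>\<^bsub>Aff\<^esub>"
    using immersed_submanifold_chart[OF im one_in] .
  define D where "D = frechet_derivative \<psi> (at w)"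
  have \<psi>: "smooth_on \<Omega> \<psi>" and W: "subspace W" and o\<Omega>: "open \<Omega>" and inj: "inj_on D W"
    using ch w by (auto simp: chart_def D_def)
  have derD: "(\<psi> has_derivative D) (at w)" unfolding D_def by (rule smooth_on_has_derivative[OF \<psi> w(2)])
  have hD: "\<hh> = D ` W"
    using tangent_space_chart[OF fdA ch w(1,2)] w(3) by (simp add: lie_algebra_def D_def)
  obtain R where R: "range R \<subseteq> W" "linear R" "\<And>z. z \<in> W \<Longrightarrow> R (D z) = z"
    using linear_exists_left_inverse_on[OF has_derivative_linear[OF derD] W inj] by blast
  \<comment> \<open>The direction in the parameter space that represents the tangent vector
    \<open>(S x, x)\<close>.\<close>
  define Q where "Q x = R (S x, x)" for x
  have QW: "Q x \<in> W" for x using R(1) by (auto simp: Q_def)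
  have DQ: "D (Q x) = (S x, x)" for x
  proof -
    obtain z where "z \<in> W" "(S x, x) = D z" using in_lie_algebra[of x] hD by auto
    then show ?thesis using R(3) by (simp add: Q_def)
  qed
  have linQ: "linear Q"
    using R(2) linear_add[OF R(2)] linear_cmul[OF R(2)]
    by (intro linearI) (simp_all add: Q_def blinfun.add_right blinfun.scaleR_right flip: add_Pair scaleR_Pair)
  have blQ: "bounded_linear Q" by (rule fin_dim_bounded_linear[OF fd linQ])
  \<comment> \<open>Openness of the preimage of \<open>N\<close> is relative to
    \<open>W \<inter> \<Omega>\<close>; \<open>T\<close> makes it absolute, so that the domain
    \<open>A\<close> of \<open>f\<close> is open.\<close>
  obtain T where T: "open T" "{x \<in> W \<inter> \<Omega>. \<psi> x \<in> N} = W \<inter> \<Omega> \<inter> T"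
    using openin_continuous_map_preimage[OF chart_continuous_map[OF ch] N(1)] by (auto simp: openin_open)
  define A where "A = (\<lambda>x. w + Q x) -` (\<Omega> \<inter> T)"
  have cQ: "continuous_on UNIV (\<lambda>x. w + Q x)" by (intro continuous_intros linear_continuous_on blQ)
  have oA: "open A" unfolding A_def by (rule open_vimage[OF open_Int[OF o\<Omega> T(1)] cQ])
  have Q0: "Q 0 = 0" using linear_0[OF linQ] .
  have "w \<in> W \<inter> \<Omega> \<inter> T" using w N(2) by (subst T(2)[symmetric]) simp
  then have A0: "0 \<in> A" using Q0 by (simp add: A_def)
  define f where "f x = snd (\<psi> (w + Q x))" for x
  have smf: "smooth_on A f" unfolding f_def
    by (intro smooth_on_bounded_linear_compose[OF bounded_linear_snd _ oA] smooth_on_compose[OF fdA oA _ \<psi>]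
        smooth_on_add[OF oA smooth_on_const] smooth_on_bounded_linear blQ) (auto simp: A_def)
  have "((\<lambda>x. w + Q x) has_derivative Q) (at 0)"
    using has_derivative_add[OF has_derivative_const[of w] bounded_linear_imp_has_derivative[OF blQ]] by simp
  from has_derivative_compose[OF this] derD
  have "((\<lambda>x. \<psi> (w + Q x)) has_derivative (\<lambda>v. D (Q v))) (at 0)" by (simp add: Q0)
  from has_derivative_snd[OF this] have derf: "(f has_derivative (\<lambda>v. v)) (at 0)"
    unfolding f_def by (simp add: DQ)
  have f0: "f 0 = 0" using w(3) by (simp add: f_def Q0)
  obtain \<delta> k where k: "\<delta> > 0" "k ` ball 0 \<delta> \<subseteq> A" "\<And>y. y \<in> ball 0 \<delta> \<Longrightarrow> f (k y) = y"
    using inverse_function[OF fd oA A0 smf derf] unfolding f0 by metis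
  have "y \<in> snd ` N" if y: "y \<in> ball 0 \<delta>" for y
  proof -
    have "w + Q (k y) \<in> W \<inter> \<Omega> \<inter> T"
    proof -
      have "k y \<in> A" using k(2) y by blast
      then show ?thesis using QW w(1) W by (simp add: A_def subspace_add)
    qed
    then have "\<psi> (w + Q (k y)) \<in> N" by (subst (asm) T(2)[symmetric]) simp
    moreover have "snd (\<psi> (w + Q (k y))) = y" using k(3)[OF y] by (simp add: f_def)
    ultimately show ?thesis by force
  qed
  then show thesis using that[OF k(1)] by blast
qed

text \<open>Left translation by \<open>h\<close> moves the statement at the unit to
  \<open>h\<close>; on projections it acts as \<open>circ S x\<close>.\<close>

lemma snd_open_map:
  assumes X: "openin H X" shows "open (snd ` X)"
proof (rule openI)
  fix x assume "x \<in> snd ` X"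
  then obtain h where h: "h \<in> X" "x = snd h" by auto
  have hH: "h \<in> topspace H" using h(1) openin_subset[OF X] by blast
  have heq: "h = graph_point S x" using element_eq[OF hH] h(2) by simp
  have xU: "x \<in> unit_set S" using topspace_subset hH h(2) unit_comp_subset by fastforce
  let ?N = "{y \<in> topspace H. h \<otimes>\<^bsub>Aff\<^esub> y \<in> X}"
  have "continuous_map H H (\<lambda>y. h \<otimes>\<^bsub>Aff\<^esub> y)"
    using lie_left_translation[OF fdA lie hH] by (simp add: smooth_map_def)
  then have "openin H ?N" using X by (rule openin_continuous_map_preimage)
  moreover have "\<one>\<^bsub>Aff\<^esub> \<in> ?N"
    using h(1) one_in heq graph_point_mult[of x 0] by simp
  ultimately obtain \<delta> where \<delta>: "\<delta> > 0" "ball 0 \<delta> \<subseteq> snd ` ?N" using snd_open_at_one by blast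
  let ?d = "\<lambda>x'. (inv\<^bsub>GL\<^esub> (id_blinfun + S x)) (x' - x)"
  have "open (?d -` ball 0 \<delta>)" by (rule open_vimage[OF open_ball circ_local(3)[OF xU]])
  moreover have "x \<in> ?d -` ball 0 \<delta>" using \<delta> by simp
  ultimately obtain e where e: "e > 0" "ball x e \<subseteq> ?d -` ball 0 \<delta>" using openE by blast
  have "x' \<in> snd ` X" if "x' \<in> ball x e" for x'
  proof -
    have "?d x' \<in> ball 0 \<delta>" using e(2) that by blast
    then obtain y where y: "y \<in> topspace H" "h \<otimes>\<^bsub>Aff\<^esub> y \<in> X" "snd y = ?d x'" using \<delta>(2) by fastforce
    have "y = graph_point S (?d x')" using element_eq[OF y(1)] unfolding y(3) .
    then have "h \<otimes>\<^bsub>Aff\<^esub> y = graph_point S x'"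
      by (simp only: heq graph_point_mult circ_local(1)[OF xU])
    then show ?thesis using y(2) by (metis image_eqI snd_graph_point)
  qed
  then show "\<exists>e>0. ball x e \<subseteq> snd ` X" using e(1) by blast
qed

text \<open>The projection of \<open>H\<close> contains a ball around 0, and composing with an
  element of this ball neither enters nor leaves it, because \<open>H\<close> is a subgroup.\<close>

lemma topspace_eq: "topspace H = graph_point S ` unit_comp S"
proof -
  obtain \<delta> where \<delta>: "\<delta> > 0" "ball 0 \<delta> \<subseteq> snd ` topspace H"
    using snd_open_at_one[OF openin_topspace one_in] .
  have gp: "graph_point S x \<in> topspace H \<longleftrightarrow> x \<in> snd ` topspace H" for x
  proof
    assume "x \<in> snd ` topspace H"
    then obtain h where "h \<in> topspace H" "x = snd h" by blast
    then show "graph_point S x \<in> topspace H" using element_eq[of h] by simp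
  qed (auto intro: image_eqI[of _ _ "graph_point S x"])
  have sg: "subgroup (topspace H) Aff" using lie by (simp add: lie_subgroup_def)
  have "unit_comp S \<subseteq> snd ` topspace H"
  proof (rule unit_comp_subset_if_locally_invariant[OF \<delta>(1)])
    show "0 \<in> snd ` topspace H" using one_in gp[of 0] by simp
    fix x y assume x: "x \<in> unit_set S" and y: "y \<in> ball 0 \<delta>" and xy: "circ S x y \<in> unit_set S"
    have gy: "graph_point S y \<in> topspace H" using \<delta>(2) y gp by blast
    have cx: "graph_point S x \<in> carrier Aff" using x by (simp add: graph_point_def Aff_carrier unit_set_def)
    have "graph_point S x \<otimes>\<^bsub>Aff\<^esub> graph_point S y \<in> topspace H \<longleftrightarrow> graph_point S x \<in> topspace H"
    proof
      assume a: "graph_point S x \<otimes>\<^bsub>Aff\<^esub> graph_point S y \<in> topspace H"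
      have cy: "graph_point S y \<in> carrier Aff" using subgroup.mem_carrier[OF sg gy] .
      have "graph_point S x = (graph_point S x \<otimes>\<^bsub>Aff\<^esub> graph_point S y) \<otimes>\<^bsub>Aff\<^esub> inv\<^bsub>Aff\<^esub> (graph_point S y)"
        using group.inv_solve_right[OF group_Aff] cx cy group.inv_closed[OF group_Aff cy]
          monoid.m_assoc[OF group.is_monoid[OF group_Aff] cx cy] group.r_inv[OF group_Aff cy]
          monoid.r_one[OF group.is_monoid[OF group_Aff] cx] by metis
      then show "graph_point S x \<in> topspace H"
        using subgroup.m_closed[OF sg a subgroup.m_inv_closed[OF sg gy]] by simp
    qed (rule subgroup.m_closed[OF sg _ gy])
    then show "x \<in> snd ` topspace H \<longleftrightarrow> circ S x y \<in> snd ` topspace H"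
      unfolding graph_point_mult gp by blast
  qed
  then show ?thesis using topspace_subset gp by blast
qed

text \<open>Openness of \<open>snd\<close> on \<open>H\<close> shows that sets open in
  \<open>H\<close> are open in the graph; continuity of \<open>snd\<close> gives the
  converse.\<close>

theorem eq_graph_group: "H = graph_group S"
proof (rule topology_eq[THEN iffD2], intro allI iffI)
  fix X assume X: "openin H X"
  then show "openin (graph_group S) X"
    using openin_subset[OF X] snd_open_map topspace_eq by (simp add: openin_graph_group[OF fd])
next
  fix X assume "openin (graph_group S) X"
  then have X: "X \<subseteq> topspace H" "open (snd ` X)" by (simp_all add: openin_graph_group[OF fd] topspace_eq)
  have "h \<in> X" if "h \<in> topspace H" "snd h \<in> snd ` X" for h
  proof -
    obtain h' where h': "h' \<in> X" "snd h = snd h'" using \<open>snd h \<in> snd ` X\<close> by blast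
    then have "h' = graph_point S (snd h)" using element_eq[of h'] X(1) by auto
    then show ?thesis using h' element_eq[OF that(1)] by simp
  qed
  then have eq: "{h \<in> topspace H. snd h \<in> snd ` X} = X" using X(1) by blast
  have "openin euclidean (snd ` X)" using X(2) by simp
  from openin_continuous_map_preimage[OF continuous_map_snd_H this] show "openin H X" unfolding eq .
qed

end

section \<open>The linear parts lie in G\<close>

text \<open>Along a ray, the mean value inequality bounds the maximum of the norm of
  \<open>u\<close> by half of itself. The small radius, with \<open>C * \<delta>\<close> at most
  1/2, replaces the exponential of the usual estimate.\<close>

lemma gronwall_zero:
  fixes u :: "'a::real_normed_vector \<Rightarrow> 'b::real_normed_vector"
  assumes der: "\<And>x. x \<in> ball 0 \<delta> \<Longrightarrow> (u has_derivative u' x) (at x)"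
    and bd: "\<And>x y. x \<in> ball 0 \<delta> \<Longrightarrow> norm (u' x y) \<le> C * norm (u x) * norm y"
    and C: "C \<ge> 0" "C * \<delta> \<le> 1/2" and 0: "u 0 = 0" and x: "x \<in> ball 0 \<delta>"
  shows "u x = 0"
proof -
  define g where "g t = u (t *\<^sub>R x)" for t
  have seg: "t *\<^sub>R x \<in> ball 0 \<delta>" if "t \<in> {0..1}" for t
  proof -
    have "\<bar>t\<bar> * norm x \<le> 1 * norm x" using that by (intro mult_right_mono) auto
    then show ?thesis using x by simp
  qed
  have derg: "(g has_derivative (\<lambda>s. u' (t *\<^sub>R x) (s *\<^sub>R x))) (at t)" if t: "t \<in> {0..1}" for t
    unfolding g_def
    by (rule has_derivative_compose[OF bounded_linear_imp_has_derivative[OF bounded_linear_scaleR_left] der[OF seg[OF t]]])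
  then have "continuous_on {0..1} (\<lambda>t. norm (g t))"
    by (intro continuous_on_norm continuous_at_imp_continuous_on ballI has_derivative_continuous)
  then obtain t where t: "t \<in> {0..1}" "\<And>s. s \<in> {0..1} \<Longrightarrow> norm (g s) \<le> norm (g t)"
    using continuous_attains_sup[of "{0..1::real}" "\<lambda>t. norm (g t)"] by auto
  have "norm (g t - g 0) \<le> (norm (g t) / 2) * norm (t - 0)"
  proof (rule differentiable_bound[of "{0..1}" g "\<lambda>t s. u' (t *\<^sub>R x) (s *\<^sub>R x)"])
    show "(g has_derivative (\<lambda>s. u' (t *\<^sub>R x) (s *\<^sub>R x))) (at t within {0..1})" if "t \<in> {0..1}" for t
      by (rule has_derivative_at_withinI[OF derg[OF that]])
    show "onorm (\<lambda>s. u' (r *\<^sub>R x) (s *\<^sub>R x)) \<le> norm (g t) / 2" if r: "r \<in> {0..1}" for r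
    proof (rule onorm_bound)
      fix s :: real
      have "norm (u' (r *\<^sub>R x) (s *\<^sub>R x)) \<le> C * norm (g r) * (\<bar>s\<bar> * norm x)"
        using bd[OF seg[OF r], of "s *\<^sub>R x"] by (simp add: g_def)
      also have "\<dots> \<le> C * norm (g t) * (\<bar>s\<bar> * \<delta>)"
        using C t(2)[OF r] x by (intro mult_mono) auto
      also have "\<dots> = (C * \<delta>) * (norm (g t) * \<bar>s\<bar>)" by simp
      also have "\<dots> \<le> 1/2 * (norm (g t) * \<bar>s\<bar>)" using C(2) by (intro mult_right_mono) auto
      finally show "norm (u' (r *\<^sub>R x) (s *\<^sub>R x)) \<le> norm (g t) / 2 * norm s" by simp
    qed simp
  qed (use t in auto)
  also have "\<dots> \<le> norm (g t) / 2 * 1" using t(1) by (intro mult_left_mono) auto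
  finally have "norm (g t) \<le> 0" by (simp add: g_def 0)
  then have "norm (g 1) \<le> 0" using t(2)[of 1] by simp
  then show ?thesis by (simp add: g_def)
qed

locale comm_alg_in = comm_alg S for S :: "'v::real_normed_vector \<Rightarrow>\<^sub>L 'v \<Rightarrow>\<^sub>L 'v" +
  fixes G :: "('v \<Rightarrow>\<^sub>L 'v) topology"
  assumes G: "lie_subgroup GL G" and S_in: "\<And>x. S x \<in> lie_algebra GL G"
begin

abbreviation L :: "'v \<Rightarrow> 'v \<Rightarrow>\<^sub>L 'v" where "L x \<equiv> id_blinfun + S x"

lemma fdE: "fin_dim TYPE('v \<Rightarrow>\<^sub>L 'v)" by (rule fin_dim_blinfun[OF fd fd])

lemma id_in_G: "id_blinfun \<in> topspace G"
  using G by (auto simp: lie_subgroup_def dest: subgroup.one_closed)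

text \<open>The derivative of \<open>L\<close> at \<open>x\<close> along \<open>y\<close> is
  \<open>S y\<close>, which for \<open>y = L x z\<close> equals \<open>L x\<close> times
  \<open>S z\<close>. So the logarithmic derivative of \<open>L\<close> has its values among the
  \<open>S z\<close>, hence in the Lie algebra.\<close>

lemma S_log_derivative: "L x o\<^sub>L S z = S (L x z)"
  by (rule blinfun_eqI) (simp add: blinfun.add_left blinfun.add_right assoc)

text \<open>
  In a chart \<open>\<psi>\<close> of \<open>G\<close> at the identity one can write \<open>L x = \<psi> (w x) + u x\<close> with \<open>u x\<close> in a fixed
  complement (the kernel of \<open>R\<close>) of the Lie algebra. As \<open>L\<close> and \<open>\<psi>\<close> have logarithmic derivatives
  in the Lie algebra, \<open>u\<close> solves a linear differential inequality and hence vanishes.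
\<close>

lemma L_in_G_local:
  obtains \<delta> where "\<delta> > 0" "continuous_map (top_of_set (ball 0 \<delta>)) G L"
proof -
  have im: "immersed_submanifold G" using G by (simp add: lie_subgroup_def)
  obtain W \<Omega> \<psi> w0 where ch: "chart G W \<Omega> \<psi>" and w0: "w0 \<in> W" "w0 \<in> \<Omega>" "\<psi> w0 = id_blinfun"
    using immersed_submanifold_chart[OF im id_in_G] .
  define D where "D = frechet_derivative \<psi> (at w0)"
  have \<psi>: "smooth_on \<Omega> \<psi>" and W: "subspace W" and o\<Omega>: "open \<Omega>" and inj: "inj_on D W"
    using ch w0 by (auto simp: chart_def D_def)
  have derD: "(\<psi> has_derivative D) (at w0)" unfolding D_def by (rule smooth_on_has_derivative[OF \<psi> w0(2)])
  have gD: "lie_algebra GL G = D ` W"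
    using tangent_space_chart[OF fdE ch w0(1,2)] w0(3) by (simp add: lie_algebra_def D_def)
  have subg: "subspace (lie_algebra GL G)" by (rule lie_algebra_subspace[OF fdE G])
  obtain R where R: "range R \<subseteq> W" "linear R" "\<And>z. z \<in> W \<Longrightarrow> R (D z) = z"
    using linear_exists_left_inverse_on[OF has_derivative_linear[OF derD] W inj] by blast
  \<comment> \<open>A linear projection of the ambient space onto the parameter space
    \<open>W\<close>.\<close>
  obtain P where P: "range P \<subseteq> W" "linear P" "\<And>z. z \<in> W \<Longrightarrow> P z = z"
    using linear_exists_left_inverse_on[OF linear_ident W] by (auto simp: inj_on_def)
  have blR: "bounded_linear R" and blP: "bounded_linear P"
    by (rule fin_dim_bounded_linear[OF fdE], fact)+
  have blD: "bounded_linear D" using derD has_derivative_bounded_linear by blast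
  define A where "A = P -` \<Omega>"
  have oA: "open A" unfolding A_def by (rule open_vimage[OF o\<Omega> linear_continuous_on[OF blP]])
  have w0A: "w0 \<in> A" using w0 P(3) by (simp add: A_def)
  \<comment> \<open>Replaces the \<open>W\<close> component of \<open>e\<close> by \<open>R\<close>
    of the chart value. This extends \<open>R\<close> after \<open>\<psi>\<close> from
    \<open>W\<close> to the ambient space so that the derivative at \<open>w0\<close> is the
    identity.\<close>
  define f where "f e = (e - P e) + R (\<psi> (P e))" for e
  have smf: "smooth_on A f" unfolding f_def
    by (intro smooth_on_add[OF oA] smooth_on_bounded_linear_compose[OF blR _ oA]
        smooth_on_compose[OF fdE oA smooth_on_bounded_linear[OF blP] \<psi>]
        smooth_on_bounded_linear bounded_linear_sub bounded_linear_ident blP) (auto simp: A_def)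
  have "(\<psi> has_derivative D) (at (P w0))" using derD P(3)[OF w0(1)] by simp
  from has_derivative_compose[OF bounded_linear_imp_has_derivative[OF blP] this]
  have "((\<lambda>e. \<psi> (P e)) has_derivative (\<lambda>v. D (P v))) (at w0)" .
  then have "(f has_derivative (\<lambda>v. (v - P v) + R (D (P v)))) (at w0)" unfolding f_def
    by (intro has_derivative_add has_derivative_diff has_derivative_ident
        bounded_linear_imp_has_derivative blP bounded_linear.has_derivative[OF blR])
  moreover have "R (D (P v)) = P v" for v using R(3) P(1) by blast
  ultimately have derf: "(f has_derivative (\<lambda>v. v)) (at w0)" by simp
  define z0 where "z0 = R id_blinfun"
  have f0: "f w0 = z0" using w0 P(3) by (simp add: f_def z0_def)
  obtain \<delta>0 k where k: "\<delta>0 > 0" "k z0 = w0" "k ` ball z0 \<delta>0 \<subseteq> A"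
      "\<And>y. y \<in> ball z0 \<delta>0 \<Longrightarrow> f (k y) = y" "\<And>y. y \<in> ball z0 \<delta>0 \<Longrightarrow> k differentiable (at y)"
    using inverse_function[OF fdE oA w0A smf derf] unfolding f0 by metis
  define r where "r x = R (L x)" for x
  have blRS: "bounded_linear (\<lambda>x. R (S x))"
    by (rule bounded_linear_compose[OF blR blinfun.bounded_linear_right])
  have r_eq: "r = (\<lambda>x. z0 + R (S x))"
    by (rule ext) (simp add: r_def z0_def linear_add[OF R(2)])
  have derr: "(r has_derivative (\<lambda>y. R (S y))) (at x)" for x
    using has_derivative_add[OF has_derivative_const[of z0] bounded_linear_imp_has_derivative[OF blRS]]
    by (simp add: r_eq)
  define B1 where "B1 = r -` ball z0 \<delta>0"
  have oB1: "open B1" unfolding B1_def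
    by (rule open_vimage[OF open_ball continuous_at_imp_continuous_on]) (use derr has_derivative_continuous in blast)
  have r0: "r 0 = z0" by (simp add: r_def z0_def)
  have 0: "0 \<in> B1" using k(1) by (simp add: B1_def r0)
  \<comment> \<open>The parameter for which the chart and \<open>L x\<close> have the same image
    under \<open>R\<close>.\<close>
  define w where "w x = k (r x)" for x
  have w_0: "w 0 = w0" by (simp add: w_def r0 k(2))
  have wW: "w x \<in> W" "P (w x) = w x" "w x \<in> \<Omega>" "R (\<psi> (w x)) = R (L x)" if x: "x \<in> B1" for x
  proof -
    have rx: "r x \<in> ball z0 \<delta>0" using x by (simp add: B1_def)
    have fw: "(w x - P (w x)) + R (\<psi> (P (w x))) = R (L x)"
      using k(4)[OF rx] by (simp add: w_def f_def r_def)
    then have "w x - P (w x) = R (L x) - R (\<psi> (P (w x)))" by (simp add: algebra_simps)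
    moreover have "R (L x) - R (\<psi> (P (w x))) \<in> W" using R(1) by (intro subspace_diff[OF W]) auto
    ultimately have "w x - P (w x) \<in> W" by simp
    \<comment> \<open>\<open>P\<close> fixes this difference, which lies in \<open>W\<close>, and
      also kills it, being a projection; so \<open>w x\<close> lies in \<open>W\<close>.\<close>
    then have "w x - P (w x) = P (w x - P (w x))" using P(3) by simp
    also have "\<dots> = P (w x) - P (P (w x))" by (rule linear_diff[OF P(2)])
    also have "P (P (w x)) = P (w x)" using P(1,3) by blast
    finally show Pw: "P (w x) = w x" by simp
    show "w x \<in> W" using P(1) Pw by (metis rangeI subsetD)
    have "w x \<in> A" using k(3) rx by (auto simp: w_def)
    then show "w x \<in> \<Omega>" using Pw by (simp add: A_def)
    show "R (\<psi> (w x)) = R (L x)" using fw Pw by simp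
  qed
  define w' where "w' x = frechet_derivative w (at x)" for x
  have derw: "(w has_derivative w' x) (at x)" if x: "x \<in> B1" for x
  proof -
    have "k differentiable (at (r x))" using k(5) x by (simp add: B1_def)
    then obtain k' where k': "(k has_derivative k') (at (r x))" by (auto simp: differentiable_def)
    have "(w has_derivative (\<lambda>y. k' (R (S y)))) (at x)"
      unfolding w_def by (rule has_derivative_compose[OF derr k'])
    then show ?thesis unfolding w'_def using frechet_derivative_works by (auto simp: differentiable_def)
  qed
  have w'W: "w' x y \<in> W" if x: "x \<in> B1" for x y
  proof -
    \<comment> \<open>Since \<open>w = P w\<close> near \<open>x\<close>, the derivative of
      \<open>w\<close> takes its values in \<open>W\<close> as well.\<close>
    have "((\<lambda>x. P (w x)) has_derivative (\<lambda>y. P (w' x y))) (at x)"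
      by (rule bounded_linear.has_derivative[OF blP derw[OF x]])
    then have "(w has_derivative (\<lambda>y. P (w' x y))) (at x)"
      by (rule has_derivative_transform_within_open[OF _ oB1 x]) (use wW in auto)
    then have "w' x = (\<lambda>y. P (w' x y))" using has_derivative_unique[OF derw[OF x]] by blast
    then show ?thesis using P(1) by (metis rangeI subsetD)
  qed
  define u where "u x = L x - \<psi> (w x)" for x
  define D' where "D' x = frechet_derivative \<psi> (at (w x))" for x
  define u' where "u' x y = S y - D' x (w' x y)" for x y
  have der\<psi>w: "((\<lambda>x. \<psi> (w x)) has_derivative (\<lambda>y. D' x (w' x y))) (at x)" if x: "x \<in> B1" for x
    unfolding D'_def by (rule has_derivative_compose[OF derw[OF x] smooth_on_has_derivative[OF \<psi> wW(3)[OF x]]])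
  have derL: "(L has_derivative blinfun_apply S) (at x)" for x
    using has_derivative_add[OF has_derivative_const[of id_blinfun] bounded_linear_imp_has_derivative[OF blinfun.bounded_linear_right]]
    by simp
  have deru: "(u has_derivative u' x) (at x)" if x: "x \<in> B1" for x
    unfolding u_def u'_def by (rule has_derivative_diff[OF derL der\<psi>w[OF x]])
  have Ru: "R (u x) = 0" if x: "x \<in> B1" for x
    unfolding u_def using wW(4)[OF x] by (simp add: linear_diff[OF R(2)])
  have Ru': "R (u' x y) = 0" if x: "x \<in> B1" for x y
  proof -
    have "((\<lambda>x. 0) has_derivative (\<lambda>y. R (u' x y))) (at x)"
      by (rule has_derivative_transform_within_open[OF bounded_linear.has_derivative[OF blR deru[OF x]] oB1 x]) (use Ru in auto)
    then have "(\<lambda>y. R (u' x y)) = (\<lambda>y. 0)" using has_derivative_unique has_derivative_const by blast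
    then show ?thesis by meson
  qed
  obtain \<rho> where \<rho>: "\<rho> > 0" "\<And>x. norm (R x) \<le> \<rho> * norm x" using bounded_linear_pos_bound[OF blR] by blast
  obtain d where d: "d > 0" "\<And>x. norm (D x) \<le> d * norm x" using bounded_linear_pos_bound[OF blD] by blast
  \<comment> \<open>Chosen so that \<open>\<rho> * \<kappa> * d = 1/2\<close>, which lets norm v be
    absorbed in the estimate of \<open>v\<close> below.\<close>
  define \<kappa> where "\<kappa> = 1 / (2 * \<rho> * d)"
  have \<kappa>: "\<kappa> > 0" using \<rho> d by (simp add: \<kappa>_def)
  have "isCont (\<lambda>x. \<psi> (w x)) 0" by (rule has_derivative_continuous[OF der\<psi>w[OF 0]])
  then obtain \<delta>1 where \<delta>1: "\<delta>1 > 0" "\<And>x. dist x 0 < \<delta>1 \<Longrightarrow> dist (\<psi> (w x)) id_blinfun < \<kappa>"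
    using \<kappa> w_0 w0(3) unfolding continuous_at_eps_delta by metis
  obtain \<delta>2 where \<delta>2: "\<delta>2 > 0" "ball 0 \<delta>2 \<subseteq> B1" using oB1 0 openE by blast
  \<comment> \<open>The first factor bounds the derivative of \<open>u\<close> by norm(u x) times
    norm a; the second is the bound of \<open>a\<close> relative to \<open>y\<close>.\<close>
  define C where "C = ((1 + \<kappa>) * d * 2 * \<rho> + 1) * (2 * norm S)"
  have C: "C \<ge> 0" using \<kappa> d \<rho> by (simp add: C_def)
  \<comment> \<open>In turn: the chart value stays \<open>\<kappa>\<close>-close to 1;
    \<open>x\<close> stays in \<open>B1\<close>; \<open>C * \<delta>\<close> is at most 1/2; and
    \<open>S x\<close> has norm at most 1/2, which makes \<open>L x\<close> invertible.\<close>
  define \<delta> where "\<delta> = min (min \<delta>1 \<delta>2) (min (1 / (2 * (C + 1))) (1 / (2 * (norm S + 1))))"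
  have \<delta>: "\<delta> > 0" using \<delta>1(1) \<delta>2(1) C by (simp add: \<delta>_def add_nonneg_pos)
  have C\<delta>: "C * \<delta> \<le> 1/2"
  proof -
    have "C * \<delta> \<le> (C + 1) * (1 / (2 * (C + 1)))" using C \<delta> by (intro mult_mono) (auto simp: \<delta>_def)
    also have "\<dots> = 1/2" using C by (simp add: field_simps)
    finally show ?thesis .
  qed
  have bound: "norm (u' x y) \<le> C * norm (u x) * norm y" if x: "x \<in> ball 0 \<delta>" for x y
  proof -
    have xB: "x \<in> B1" using x \<delta>2 by (auto simp: \<delta>_def)
    let ?p = "\<psi> (w x)"
    have pid: "norm (?p - id_blinfun) \<le> \<kappa>" using \<delta>1(2)[of x] x by (simp add: \<delta>_def dist_norm)
    \<comment> \<open>Only an inequality, as the norm of the identity is 0 on the trivial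
      space.\<close>
    have idle: "norm (id_blinfun :: 'v \<Rightarrow>\<^sub>L 'v) \<le> 1" by (rule norm_blinfun_id_le)
    have pn: "norm ?p \<le> 1 + \<kappa>" using norm_triangle_sub[of ?p id_blinfun] pid idle by simp
    have "norm (S x) \<le> norm S * norm x" by (rule norm_blinfun)
    also have "\<dots> \<le> (norm S + 1) * (1 / (2 * (norm S + 1)))"
      using x by (intro mult_mono) (auto simp: \<delta>_def)
    also have "\<dots> = 1/2" by (simp add: field_simps add_nonneg_eq_0_iff)
    finally have Sx: "norm (S x) \<le> 1/2" .
    have idinv: "inv\<^bsub>GL\<^esub> id_blinfun = (id_blinfun :: 'v \<Rightarrow>\<^sub>L 'v)" by (rule GL_inv_eqI) auto
    have idGL: "(id_blinfun :: 'v \<Rightarrow>\<^sub>L 'v) \<in> carrier GL" by (auto simp: GL_carrier)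
    have "norm (L x - id_blinfun) * norm (inv\<^bsub>GL\<^esub> (id_blinfun :: 'v \<Rightarrow>\<^sub>L 'v)) \<le> 1/2 * 1"
      unfolding idinv using Sx idle by (intro mult_mono) auto
    then have LG: "L x \<in> carrier GL" and nL: "norm (inv\<^bsub>GL\<^esub> (L x)) \<le> 2 * norm (id_blinfun :: 'v \<Rightarrow>\<^sub>L 'v)"
      using GL_perturb[OF fd idGL, of "L x"] by (simp_all add: idinv)
    have nL2: "norm (inv\<^bsub>GL\<^esub> (L x)) \<le> 2" using nL idle by linarith
    \<comment> \<open>\<open>a = S z\<close> is the logarithmic derivative of \<open>L\<close> along
      \<open>y\<close>; \<open>b\<close> below is that of the chart curve. Both lie in the Lie
      algebra, so their difference is \<open>D v\<close> for some \<open>v\<close> in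
      \<open>W\<close>.\<close>
    define z where "z = (inv\<^bsub>GL\<^esub> (L x)) y"
    define a where "a = S z"
    have La: "L x o\<^sub>L a = S y"
      unfolding a_def S_log_derivative z_def by (simp add: GL_inv_apply(2)[OF LG])
    have "norm a \<le> norm S * norm z" unfolding a_def by (rule norm_blinfun)
    also have "norm z \<le> norm (inv\<^bsub>GL\<^esub> (L x)) * norm y" unfolding z_def by (rule norm_blinfun)
    also have "\<dots> \<le> 2 * norm y" by (intro mult_right_mono nL2) auto
    finally have na: "norm a \<le> 2 * norm S * norm y" by (simp add: mult_left_mono)
    have pG: "?p \<in> topspace G"
      using continuous_map_image_subset_topspace[OF chart_continuous_map[OF ch]] wW[OF xB] by auto
    have pGL: "?p \<in> carrier GL" by (rule lie_subgroup_carrier[OF G pG])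
    define b where "b = inv\<^bsub>GL\<^esub> ?p o\<^sub>L D' x (w' x y)"
    have "D' x (w' x y) \<in> tangent_space G ?p"
      using tangent_space_chart[OF fdE ch wW(1)[OF xB] wW(3)[OF xB]] w'W[OF xB] by (auto simp: D'_def)
    then have bg: "b \<in> lie_algebra GL G"
      unfolding b_def by (rule GL_tangent_left_translate[OF fd G pG])
    have pb: "?p o\<^sub>L b = D' x (w' x y)"
      by (simp add: b_def blinfun_compose_assoc[symmetric] GL_inv_compose[OF pGL])
    have "a - b \<in> lie_algebra GL G"
      using subspace_diff[OF subg S_in bg] by (simp add: a_def)
    then obtain v where v: "v \<in> W" "a - b = D v" using gD by auto
    \<comment> \<open>Splits the derivative of \<open>u\<close> into a tangential term at the chart
      point and a term already controlled by \<open>u x\<close>.\<close>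
    have u'eq: "u' x y = (?p o\<^sub>L D v) + (u x o\<^sub>L a)"
    proof -
      have "u' x y = (L x o\<^sub>L a) - (?p o\<^sub>L b)" by (simp add: u'_def La pb)
      also have "\<dots> = (?p o\<^sub>L (a - b)) + (u x o\<^sub>L a)"
        unfolding u_def by (rule blinfun_eqI) (simp add: blinfun.diff_left blinfun.diff_right blinfun.add_left)
      finally show ?thesis using v by simp
    qed
    have "D v = (?p o\<^sub>L D v) - ((?p - id_blinfun) o\<^sub>L D v)"
      by (rule blinfun_eqI) (simp add: blinfun.diff_left)
    moreover have "v = R (D v)" using R(3) v by simp
    ultimately have "v = R (?p o\<^sub>L D v) - R ((?p - id_blinfun) o\<^sub>L D v)"
      by (metis linear_diff[OF R(2)])
    \<comment> \<open>\<open>R\<close> annihilates the derivative of \<open>u\<close>, so the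
      tangential term is determined under \<open>R\<close> by the term with \<open>u x\<close>;
      closeness of the chart point to 1 then bounds \<open>v\<close> itself.\<close>
    moreover have "R (?p o\<^sub>L D v) = - R (u x o\<^sub>L a)"
      using Ru'[OF xB, of y] unfolding u'eq by (simp add: linear_add[OF R(2)] eq_neg_iff_add_eq_0)
    ultimately have "norm v \<le> norm (R (u x o\<^sub>L a)) + norm (R ((?p - id_blinfun) o\<^sub>L D v))"
      by (metis norm_minus_cancel norm_triangle_ineq4)
    also have "norm (R (u x o\<^sub>L a)) \<le> \<rho> * (norm (u x) * norm a)"
      using \<rho>(1) by (intro order_trans[OF \<rho>(2)] mult_left_mono norm_blinfun_compose) auto
    also have "norm (R ((?p - id_blinfun) o\<^sub>L D v)) \<le> \<rho> * (\<kappa> * (d * norm v))"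
      using \<rho>(1) \<kappa> by (intro order_trans[OF \<rho>(2)] mult_left_mono order_trans[OF norm_blinfun_compose] mult_mono pid d(2)) auto
    also have "\<rho> * (\<kappa> * (d * norm v)) = norm v / 2" using \<rho>(1) d(1) by (simp add: \<kappa>_def)
    finally have nv: "norm v \<le> 2 * \<rho> * (norm (u x) * norm a)" by linarith
    have "norm (u' x y) \<le> norm (?p o\<^sub>L D v) + norm (u x o\<^sub>L a)" unfolding u'eq by (rule norm_triangle_ineq)
    also have "norm (u x o\<^sub>L a) \<le> norm (u x) * norm a" by (rule norm_blinfun_compose)
    also have "norm (?p o\<^sub>L D v) \<le> (1 + \<kappa>) * (d * (2 * \<rho> * (norm (u x) * norm a)))"
      using \<kappa> d(1) by (intro order_trans[OF norm_blinfun_compose] mult_mono pn order_trans[OF d(2)] mult_left_mono nv) auto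
    also have "(1 + \<kappa>) * (d * (2 * \<rho> * (norm (u x) * norm a))) + norm (u x) * norm a
        = ((1 + \<kappa>) * d * 2 * \<rho> + 1) * norm (u x) * norm a" by (simp add: algebra_simps)
    also have "\<dots> \<le> ((1 + \<kappa>) * d * 2 * \<rho> + 1) * norm (u x) * (2 * norm S * norm y)"
      using \<kappa> d(1) \<rho>(1) by (intro mult_left_mono na) auto
    also have "\<dots> = C * norm (u x) * norm y" by (simp add: C_def algebra_simps)
    finally show ?thesis by linarith
  qed
  have u0: "u 0 = 0" by (simp add: u_def w_0 w0(3))
  have sub: "ball 0 \<delta> \<subseteq> B1" using \<delta>2 by (auto simp: \<delta>_def)
  have eq: "\<psi> (w x) = L x" if "x \<in> ball 0 \<delta>" for x
    using gronwall_zero[OF deru[OF subsetD[OF sub]] bound C C\<delta> u0 that] by (simp add: u_def)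
  \<comment> \<open>\<open>L\<close> is now the chart after \<open>w\<close>. The chart is
    continuous into the topology of \<open>G\<close>, and so \<open>L\<close> is too.\<close>
  have "continuous_on (ball 0 \<delta>) w"
    using derw sub has_derivative_continuous by (blast intro: continuous_at_imp_continuous_on)
  then have "continuous_map (top_of_set (ball 0 \<delta>)) (top_of_set (W \<inter> \<Omega>)) w"
    using wW sub by (auto simp: continuous_map_in_subtopology image_subset_iff)
  from continuous_map_compose[OF this chart_continuous_map[OF ch]]
  have "continuous_map (top_of_set (ball 0 \<delta>)) G (\<psi> \<circ> w)" .
  then have "continuous_map (top_of_set (ball 0 \<delta>)) G L"
    by (rule continuous_map_eq) (use eq in auto)
  then show thesis using that \<delta> by blast
qed

text \<open>The local result at 0 is spread by translations: first membership over the component,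
  then continuity at \<open>x\<close> by writing \<open>L x'\<close> as \<open>L x\<close> times
  \<open>L\<close> of a small element.\<close>

lemma L_in_G: "continuous_map (top_of_set (unit_comp S)) G L"
proof -
  obtain \<delta> where \<delta>: "\<delta> > 0" and cont: "continuous_map (top_of_set (ball 0 \<delta>)) G L"
    using L_in_G_local .
  have sg: "subgroup (topspace G) GL" using G by (simp add: lie_subgroup_def)
  have LG: "L y \<in> topspace G" if "y \<in> ball 0 \<delta>" for y :: 'v
    using continuous_map_image_subset_topspace[OF cont] that by auto
  have sub: "unit_comp S \<subseteq> {x. L x \<in> topspace G}"
  proof (rule unit_comp_subset_if_locally_invariant[OF \<delta>])
    show "0 \<in> {x. L x \<in> topspace G}" using id_in_G by simp
    fix x y :: 'v assume x: "x \<in> unit_set S" and y: "y \<in> ball 0 \<delta>"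
    have Lx: "L x \<in> carrier GL" using x by (simp add: unit_set_def)
    have Ly: "L y \<in> carrier GL" using subgroup.mem_carrier[OF sg LG[OF y]] .
    have "L x \<in> topspace G \<longleftrightarrow> L x \<otimes>\<^bsub>GL\<^esub> L y \<in> topspace G"
    proof
      assume a: "L x \<otimes>\<^bsub>GL\<^esub> L y \<in> topspace G"
      have "L x = (L x \<otimes>\<^bsub>GL\<^esub> L y) \<otimes>\<^bsub>GL\<^esub> inv\<^bsub>GL\<^esub> (L y)"
        by (simp add: blinfun_compose_assoc GL_inv_compose[OF Ly])
      then show "L x \<in> topspace G"
        using subgroup.m_closed[OF sg a subgroup.m_inv_closed[OF sg LG[OF y]]] by simp
    qed (rule subgroup.m_closed[OF sg _ LG[OF y]])
    then show "x \<in> {x. L x \<in> topspace G} \<longleftrightarrow> circ S x y \<in> {x. L x \<in> topspace G}"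
      by (simp add: circ_compose)
  qed
  have inG: "L x \<in> topspace G" if "x \<in> unit_comp S" for x using that sub by blast
  have "\<exists>U. openin (top_of_set (unit_comp S)) U \<and> x \<in> U \<and> (\<forall>x'\<in>U. L x' \<in> V)"
    if x: "x \<in> unit_comp S" and V: "openin G V" "L x \<in> V" for x V
  proof -
    have xU: "x \<in> unit_set S" using x unit_comp_subset by blast
    let ?d = "\<lambda>x'. (inv\<^bsub>GL\<^esub> (L x)) (x' - x)"
    let ?N = "{q \<in> topspace G. L x \<otimes>\<^bsub>GL\<^esub> q \<in> V}"
    have "continuous_map G G (\<lambda>q. L x \<otimes>\<^bsub>GL\<^esub> q)"
      using lie_left_translation[OF fdE G inG[OF x]] by (simp add: smooth_map_def)
    then have "openin G ?N" by (rule openin_continuous_map_preimage[OF _ V(1)])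
    from openin_continuous_map_preimage[OF cont this]
    have "open {y \<in> ball 0 \<delta>. L y \<in> ?N}" using openin_open_trans[OF _ open_ball] by simp
    then have o: "open (?d -` {y \<in> ball 0 \<delta>. L y \<in> ?N})"
      by (rule open_vimage[OF _ circ_local(3)[OF xU]])
    have "L x' \<in> V" if "x' \<in> ?d -` {y \<in> ball 0 \<delta>. L y \<in> ?N}" for x'
    proof -
      have "L x o\<^sub>L L (?d x') \<in> V" using that by simp
      then show ?thesis by (simp only: circ_compose circ_local(1)[OF xU])
    qed
    moreover have "x \<in> ?d -` {y \<in> ball 0 \<delta>. L y \<in> ?N}" using \<delta> V(2) id_in_G by simp
    ultimately show ?thesis
      using x o by (intro exI[of _ "unit_comp S \<inter> ?d -` {y \<in> ball 0 \<delta>. L y \<in> ?N}"]) (auto simp: openin_open)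
  qed
  then show ?thesis unfolding continuous_map_eq_topcontinuous_at topcontinuous_at_def
    using inG by auto
qed

end

section \<open>Traces and nilpotency\<close>

text \<open>\<open>endo_trace\<close> uses a chosen basis; an explicit one can be adapted to the
  endomorphism at hand.\<close>

definition trace_wrt :: "'v::real_normed_vector set \<Rightarrow> ('v \<Rightarrow>\<^sub>L 'v) \<Rightarrow> real" where
  "trace_wrt B a = (\<Sum>b\<in>B. representation B (a b) b)"

text \<open>Expanding \<open>b\<close> in \<open>C\<close> on one side and \<open>a c\<close> in
  \<open>B\<close> on the other leads to the same double sum.\<close>

lemma trace_wrt_eq:
  fixes B C :: "'v::real_normed_vector set"
  assumes fd: "fin_dim TYPE('v)" and B: "independent B" "span B = UNIV" and C: "independent C" "span C = UNIV"
  shows "trace_wrt B a = trace_wrt C a"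
proof -
  have fin: "finite B" "finite C" using fin_dim_finite_independent[OF fd] B C by auto
  have "trace_wrt B a = (\<Sum>b\<in>B. \<Sum>c\<in>C. representation C b c * representation B (a c) b)"
    unfolding trace_wrt_def
  proof (rule sum.cong[OF refl])
    fix b
    have "b = (\<Sum>c\<in>C. representation C b c *\<^sub>R c)"
      using sum_representation_eq[OF C(1), of b C] fin C by auto
    then have "a b = (\<Sum>c\<in>C. representation C b c *\<^sub>R a c)"
      by (metis (no_types, lifting) blinfun.sum_right blinfun.scaleR_right sum.cong)
    then show "representation B (a b) b = (\<Sum>c\<in>C. representation C b c * representation B (a c) b)"
      by (simp add: linear_sum[OF representation_linear[OF B]] linear_cmul[OF representation_linear[OF B]])
  qed
  also have "\<dots> = (\<Sum>c\<in>C. \<Sum>b\<in>B. representation C b c * representation B (a c) b)"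
    by (rule sum.swap)
  also have "\<dots> = trace_wrt C a"
    unfolding trace_wrt_def
  proof (rule sum.cong[OF refl])
    fix c
    have "a c = (\<Sum>b\<in>B. representation B (a c) b *\<^sub>R b)"
      using sum_representation_eq[OF B(1), of "a c" B] fin B by auto
    then have "representation C (a c) c = representation C (\<Sum>b\<in>B. representation B (a c) b *\<^sub>R b) c"
      by simp
    also have "\<dots> = (\<Sum>b\<in>B. representation C b c * representation B (a c) b)"
      by (simp add: linear_sum[OF representation_linear[OF C]] linear_cmul[OF representation_linear[OF C]] mult.commute)
    finally show "(\<Sum>b\<in>B. representation C b c * representation B (a c) b) = representation C (a c) c"
      by simp
  qed
  finally show ?thesis .
qed

lemma endo_trace_eq:
  fixes B :: "'v::real_normed_vector set"
  assumes fd: "fin_dim TYPE('v)" and B: "independent B" "span B = UNIV"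
  shows "endo_trace a = trace_wrt B a"
proof -
  define C where "C = (SOME B::'v set. independent B \<and> span B = UNIV)"
  have "independent C \<and> span C = UNIV"
    unfolding C_def by (rule someI[of _ B]) (use B in blast)
  then show ?thesis
    using trace_wrt_eq[OF fd _ _ B, of C a] by (simp add: endo_trace_def C_def[symmetric] trace_wrt_def Let_def)
qed

lemma linear_endo_trace:
  assumes fd: "fin_dim TYPE('v::real_normed_vector)"
  shows "linear (endo_trace :: ('v \<Rightarrow>\<^sub>L 'v) \<Rightarrow> real)"
proof -
  obtain B :: "'v set" where B: "finite B" "independent B" "span B = UNIV" using fin_dim_basis[OF fd] .
  have eq: "endo_trace a = (\<Sum>b\<in>B. representation B (a b) b)" for a :: "'v \<Rightarrow>\<^sub>L 'v"
    using endo_trace_eq[OF fd B(2,3)] by (simp add: trace_wrt_def)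
  show ?thesis
    by (rule linearI) (auto simp: eq blinfun.add_left blinfun.scaleR_left linear_add[OF representation_linear[OF B(2,3)]]
       linear_cmul[OF representation_linear[OF B(2,3)]] sum.distrib sum_distrib_left)
qed

section \<open>Powers, nilpotent and idempotent endomorphisms\<close>

definition bpow :: "('v::real_normed_vector \<Rightarrow>\<^sub>L 'v) \<Rightarrow> nat \<Rightarrow> 'v \<Rightarrow>\<^sub>L 'v" where
  "bpow a n = (((o\<^sub>L) a) ^^ n) id_blinfun"

lemma bpow_0 [simp]: "bpow a 0 = id_blinfun"
  by (simp add: bpow_def)

lemma bpow_Suc: "bpow a (Suc n) = a o\<^sub>L bpow a n"
  by (simp add: bpow_def)

lemma bpow_add: "bpow a (m + n) = bpow a m o\<^sub>L bpow a n"
  by (induction m) (auto simp: bpow_Suc blinfun_compose_assoc)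

lemma bpow_Suc2: "bpow a (Suc n) = bpow a n o\<^sub>L a"
  using bpow_add[of a n 1] by (simp add: bpow_Suc)

lemma bpow_commute:
  assumes "r o\<^sub>L a = a o\<^sub>L r" shows "r o\<^sub>L bpow a n = bpow a n o\<^sub>L r"
proof (induction n)
  case (Suc n)
  have "r o\<^sub>L bpow a (Suc n) = (r o\<^sub>L a) o\<^sub>L bpow a n" by (simp add: bpow_Suc blinfun_compose_assoc)
  also have "\<dots> = a o\<^sub>L (r o\<^sub>L bpow a n)" by (simp add: assms blinfun_compose_assoc)
  also have "\<dots> = bpow a (Suc n) o\<^sub>L r" by (simp add: Suc bpow_Suc blinfun_compose_assoc)
  finally show ?case .
qed simp

lemma bpow_compose:
  assumes "r o\<^sub>L a = a o\<^sub>L r" shows "bpow (r o\<^sub>L a) n = bpow r n o\<^sub>L bpow a n"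
proof (induction n)
  case (Suc n)
  have c: "a o\<^sub>L bpow r n = bpow r n o\<^sub>L a" by (rule bpow_commute) (simp add: assms)
  have "bpow (r o\<^sub>L a) (Suc n) = r o\<^sub>L ((a o\<^sub>L bpow r n) o\<^sub>L bpow a n)"
    by (simp add: Suc bpow_Suc blinfun_compose_assoc)
  also have "\<dots> = bpow r (Suc n) o\<^sub>L bpow a (Suc n)"
    unfolding c by (simp add: bpow_Suc blinfun_compose_assoc)
  finally show ?case .
qed simp

text \<open>A basis adapted to the filtration by the images of the powers of a nilpotent endomorphism
  makes its matrix strictly triangular.\<close>

lemma nilpotent_trace_0:
  fixes a :: "'v::real_normed_vector \<Rightarrow>\<^sub>L 'v"
  assumes fd: "fin_dim TYPE('v)" and nil: "bpow a n = 0"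
  shows "endo_trace a = 0"
proof -
  define I where "I k = range (blinfun_apply (bpow a k))" for k
  have sub: "subspace (I k)" for k
    unfolding I_def by (rule linear_subspace_image[OF linear_blinfun_apply subspace_UNIV])
  have down: "I (Suc k) \<subseteq> I k" for k by (auto simp: I_def bpow_Suc2)
  have aI: "a x \<in> I (Suc k)" if "x \<in> I k" for x k
    using that by (auto simp: I_def bpow_Suc)
  \<comment> \<open>The basis grows downwards in the exponent, from \<open>I n\<close>, which is
    zero, to \<open>I 0\<close>, the whole space.\<close>
  have "\<exists>B. independent B \<and> span B = I (n - j) \<and> (\<forall>b\<in>B. representation B (a b) b = 0)"
    if "j \<le> n" for j
    using that
  proof (induction j)
    case 0
    have "I n = {0}" using nil by (auto simp: I_def)
    then show ?case by (intro exI[of _ "{}"]) (auto simp: independent_empty)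
  next
    case (Suc j)
    define k where "k = n - Suc j"
    have k: "n - j = Suc k" using Suc.prems by (simp add: k_def)
    then obtain B where B: "independent B" "span B = I (Suc k)" "\<forall>b\<in>B. representation B (a b) b = 0"
      using Suc by auto
    have "B \<subseteq> I k" using B(2) span_superset down by blast
    then obtain B' where B': "B \<subseteq> B'" "B' \<subseteq> I k" "independent B'" "I k \<subseteq> span B'"
      by (rule maximal_independent_subset_extend[OF _ B(1)])
    have "span B' = I k" using B'(2,4) sub span_minimal by blast
    moreover have "representation B' (a b) b = 0" if b: "b \<in> B'" for b
    proof -
      \<comment> \<open>The image falls into the smaller space, so the coordinate at a newly added
        \<open>b\<close> vanishes, and at an old \<open>b\<close> it is unchanged.\<close>
      have "a b \<in> span B" using aI[of b k] b B'(2) B(2) by blast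
      then have "representation B' (a b) = representation B (a b)"
        by (rule representation_extend[OF B'(3) _ B'(1)])
      then show ?thesis using B(3) representation_ne_zero[of B "a b" b] by (cases "b \<in> B") auto
    qed
    ultimately show ?case using B'(3) unfolding k_def by blast
  qed
  from this[of n] obtain B where B: "independent B" "span B = UNIV" "\<forall>b\<in>B. representation B (a b) b = 0"
    by (auto simp: I_def)
  then show ?thesis using endo_trace_eq[OF fd B(1,2)] by (simp add: trace_wrt_def)
qed

text \<open>The trace of an idempotent is its rank: a basis of the image is fixed by it, and the
  vectors extending this basis contribute nothing to the diagonal.\<close>

lemma idempotent_trace_0:
  fixes a :: "'v::real_normed_vector \<Rightarrow>\<^sub>L 'v"
  assumes fd: "fin_dim TYPE('v)" and idem: "a o\<^sub>L a = a" and tr: "endo_trace a = 0"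
  shows "a = 0"
proof -
  let ?I = "range (blinfun_apply a)"
  have aa: "a (a x) = a x" for x
    using arg_cong[OF idem, of "\<lambda>f. blinfun_apply f x"] by simp
  obtain B where B: "B \<subseteq> ?I" "independent B" "?I \<subseteq> span B" using maximal_independent_subset[of ?I] by blast
  obtain B' where "B' \<subseteq> UNIV" and B': "B \<subseteq> B'" "independent B'" "UNIV \<subseteq> span B'"
    by (rule maximal_independent_subset_extend[OF subset_UNIV B(2)])
  have fin: "finite B'" using fin_dim_finite_independent[OF fd B'(2)] .
  have sp: "span B' = UNIV" using B'(3) by auto
  have "representation B' (a b) b = (if b \<in> B then 1 else 0)" if b: "b \<in> B'" for b
  proof (cases "b \<in> B")
    case True
    then have "a b = b" using B(1) aa by auto
    then show ?thesis using True representation_basis[OF B'(2) b] by simp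
  next
    case False
    have "a b \<in> span B" using B(3) by blast
    then have "representation B' (a b) b = representation B (a b) b"
      using representation_extend[OF B'(2) _ B'(1)] by metis
    then show ?thesis using False representation_ne_zero[of B "a b" b] by auto
  qed
  then have "endo_trace a = (\<Sum>b\<in>B'. if b \<in> B then 1 else 0)"
    using endo_trace_eq[OF fd B'(2) sp] by (simp add: trace_wrt_def)
  also have "\<dots> = card B" using fin B'(1) by (simp add: sum.If_cases Int_absorb1)
  finally have "card B = 0" using tr by simp
  then have "B = {}" using finite_subset[OF B'(1) fin] by simp
  then have "?I \<subseteq> {0}" using B(3) by simp
  then show ?thesis by (intro blinfun_eqI) auto
qed

text \<open>The index \<open>i\<close> of the lowest term with nonzero coefficient is singled out
  because the relation is later divided by that term.\<close>

lemma powers_dependent: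
  fixes e :: "nat \<Rightarrow> 'a::real_vector"
  assumes fd: "fin_dim TYPE('a)"
  shows "\<exists>K c i. finite K \<and> i \<in> K \<and> c i \<noteq> (0::real) \<and> (\<Sum>k\<in>K. c k *\<^sub>R e k) = 0 \<and> (\<forall>k\<in>K. i \<le> k)"
proof -
  have "\<exists>K c. finite K \<and> (\<exists>i\<in>K. c i \<noteq> (0::real)) \<and> (\<Sum>k\<in>K. c k *\<^sub>R e k) = 0"
  proof (cases "inj e")
    case True
    then have "infinite (range e)" using finite_imageD infinite_UNIV_nat by blast
    then have "dependent (range e)" using fin_dim_finite_independent[OF fd] by blast
    then obtain T u where T: "finite T" "T \<subseteq> range e" "\<exists>v\<in>T. u v \<noteq> 0" "(\<Sum>v\<in>T. u v *\<^sub>R v) = 0"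
      by (auto simp: dependent_explicit)
    define K where "K = e -` T"
    have "T = e ` K" using T(2) by (auto simp: K_def)
    moreover have "inj_on e K" using True by (rule inj_on_subset) simp
    ultimately have "(\<Sum>k\<in>K. u (e k) *\<^sub>R e k) = 0" "finite K" "\<exists>i\<in>K. u (e i) \<noteq> 0"
      using T by (auto simp: sum.reindex finite_image_iff)
    then show ?thesis by (intro exI[of _ K] exI[of _ "\<lambda>k. u (e k)"]) simp
  next
    case False
    \<comment> \<open>A repetition is invisible to the dependence of the range as a set, but two
      equal members give a relation directly.\<close>
    then obtain i j where "i \<noteq> j" "e i = e j" by (auto simp: inj_def)
    then show ?thesis by (intro exI[of _ "{i, j}"] exI[of _ "\<lambda>k. if k = i then 1 else -1"]) auto
  qed
  then obtain K c where K: "finite K" "\<exists>i\<in>K. c i \<noteq> (0::real)" "(\<Sum>k\<in>K. c k *\<^sub>R e k) = 0" by blast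
  \<comment> \<open>Without the zero terms, the least index carries a nonzero coefficient.\<close>
  let ?K = "{k \<in> K. c k \<noteq> 0}"
  have fin: "finite ?K" and "?K \<noteq> {}" using K(1,2) by auto
  then have i: "Min ?K \<in> ?K" by (rule Min_in)
  have "(\<Sum>k\<in>?K. c k *\<^sub>R e k) = (\<Sum>k\<in>K. c k *\<^sub>R e k)"
    by (rule sum.mono_neutral_left[OF K(1)]) auto
  then have sum0: "(\<Sum>k\<in>?K. c k *\<^sub>R e k) = 0" using K(3) by simp
  show ?thesis
    using fin i sum0 Min_le[OF fin] by (intro exI[of _ ?K] exI[of _ c] exI[of _ "Min ?K"]) simp
qed

context comm_alg begin

text \<open>\<open>pw x n\<close> is the power x^(n+1): the algebra has no unit, so the exponents
  start at 1.\<close>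

primrec pw :: "'v \<Rightarrow> nat \<Rightarrow> 'v" where
  "pw x 0 = x"
| "pw x (Suc n) = m x (pw x n)"

lemma S_pw: "S (pw x n) = bpow (S x) (Suc n)"
  by (induction n) (simp_all add: S_mult bpow_Suc)

text \<open>A linear relation between the powers of \<open>S x\<close>, divided by its lowest term.\<close>

lemma power_relation:
  obtains i K d where "finite K"
    "bpow (S x) (Suc i) o\<^sub>L (id_blinfun + S (\<Sum>k\<in>K. d k *\<^sub>R pw x k)) = 0"
proof -
  let ?a = "S x"
  obtain K c i where "finite K \<and> i \<in> K \<and> c i \<noteq> (0::real) \<and> (\<Sum>k\<in>K. c k *\<^sub>R bpow ?a (Suc k)) = 0 \<and> (\<forall>k\<in>K. i \<le> k)"
    using powers_dependent[OF fin_dim_blinfun[OF fd fd], of "\<lambda>k. bpow ?a (Suc k)"] by (elim exE) (rule that)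
  then have K: "finite K" "i \<in> K" "c i \<noteq> 0" "(\<Sum>k\<in>K. c k *\<^sub>R bpow ?a (Suc k)) = 0" "\<And>k. k \<in> K \<Longrightarrow> i \<le> k"
    by blast+
  \<comment> \<open>For \<open>k > i\<close>, the power k+1 of \<open>S x\<close> is its power i+1
    times \<open>S (pw x (k - Suc i))\<close>; the shift by \<open>Suc i\<close> accounts for the
    shifted exponents of \<open>pw\<close>.\<close>
  define J where "J = (\<lambda>k. k - Suc i) ` (K - {i})"
  define d where "d j = c (j + Suc i) / c i" for j
  have inj: "inj_on (\<lambda>k. k - Suc i) (K - {i})"
  proof (rule inj_onI)
    fix k l assume "k \<in> K - {i}" "l \<in> K - {i}" "k - Suc i = l - Suc i"
    then show "k = l" using K(5)[of k] K(5)[of l] by (cases "i < k"; cases "i < l") auto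
  qed
  have k_eq: "k - Suc i + Suc i = k" if "k \<in> K - {i}" for k
    using K(5)[of k] that by auto
  have "c i *\<^sub>R (bpow ?a (Suc i) o\<^sub>L (id_blinfun + S (\<Sum>j\<in>J. d j *\<^sub>R pw x j)))
      = c i *\<^sub>R bpow ?a (Suc i) + (\<Sum>j\<in>J. (c i * d j) *\<^sub>R bpow ?a (Suc (j + Suc i)))"
  proof -
    have "bpow ?a (Suc (j + Suc i)) = bpow ?a (Suc i) o\<^sub>L S (pw x j)" for j
      unfolding S_pw bpow_add[symmetric] by (simp add: add.commute)
    then show ?thesis
      by (intro blinfun_eqI) (simp add: blinfun.add_left blinfun.add_right blinfun.sum_left blinfun.sum_right
        blinfun.scaleR_left blinfun.scaleR_right scaleR_add_right scaleR_sum_right)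
  qed
  also have "(\<Sum>j\<in>J. (c i * d j) *\<^sub>R bpow ?a (Suc (j + Suc i))) = (\<Sum>k\<in>K - {i}. c k *\<^sub>R bpow ?a (Suc k))"
    unfolding J_def sum.reindex[OF inj] o_def d_def
    by (rule sum.cong[OF refl]) (simp only: k_eq nonzero_mult_div_cancel_left[OF K(3)] times_divide_eq_right)
  also have "c i *\<^sub>R bpow ?a (Suc i) + \<dots> = 0"
    using K(4) sum.remove[OF K(1,2), of "\<lambda>k. c k *\<^sub>R bpow ?a (Suc k)"] by simp
  finally have "bpow ?a (Suc i) o\<^sub>L (id_blinfun + S (\<Sum>j\<in>J. d j *\<^sub>R pw x j)) = 0"
    using K(3) by simp
  then show thesis using that K(1) by (metis J_def finite_Diff finite_imageI)
qed

text \<open>The second factor in the relation has the form 1 + S_z, so it can be cancelled and a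
  power of \<open>S x\<close> is zero.\<close>

lemma unit_set_UNIV_imp_trace_0:
  assumes "unit_set S = UNIV" shows "endo_trace (S x) = 0"
proof -
  obtain i K d where r: "bpow (S x) (Suc i) o\<^sub>L (id_blinfun + S (\<Sum>k\<in>K. d k *\<^sub>R pw x k)) = 0"
    using power_relation by metis
  let ?b = "id_blinfun + S (\<Sum>k\<in>K. d k *\<^sub>R pw x k)"
  have "?b \<in> carrier GL" using assms by (auto simp: unit_set_def)
  then have "bpow (S x) (Suc i) = (bpow (S x) (Suc i) o\<^sub>L ?b) o\<^sub>L inv\<^bsub>GL\<^esub> ?b"
    by (simp add: blinfun_compose_assoc GL_inv_compose)
  also have "\<dots> = 0" unfolding r by (rule blinfun_eqI) simp
  finally show ?thesis by (rule nilpotent_trace_0[OF fd])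
qed

text \<open>
  The relation gives an \<open>e\<close> without constant term in \<open>S x\<close> such that \<open>e\<close> acts as the identity on the image of
  \<open>(S x)\<^sup>n\<close>. Its power \<open>e\<^sup>n\<close> is idempotent, hence zero because its trace vanishes.
\<close>

lemma trace_0_imp_nilpotent:
  assumes tr: "\<And>x. endo_trace (S x) = 0"
  shows "\<exists>n. bpow (S x) n = 0"
proof -
  let ?a = "S x"
  obtain i K d where K: "finite K" and rel: "bpow ?a (Suc i) o\<^sub>L (id_blinfun + S (\<Sum>k\<in>K. d k *\<^sub>R pw x k)) = 0"
    using power_relation by metis
  define n where "n = Suc i"
  define y where "y = - (\<Sum>k\<in>K. d k *\<^sub>R pw x k)"
  let ?e = "S y"
  \<comment> \<open>A polynomial in \<open>S x\<close> with \<open>S y = r\<close> times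
    \<open>S x\<close>, so that powers of \<open>S y\<close> are left multiples of powers of
    \<open>S x\<close>.\<close>
  define r where "r = - (\<Sum>k\<in>K. d k *\<^sub>R bpow ?a k)"
  have ae: "bpow ?a n o\<^sub>L ?e = bpow ?a n"
  proof (rule blinfun_eqI)
    fix v
    from arg_cong[OF rel, of "\<lambda>f. blinfun_apply f v"]
    show "(bpow ?a n o\<^sub>L ?e) v = bpow ?a n v"
      by (simp add: n_def y_def blinfun.add_left blinfun.add_right blinfun.minus_left blinfun.minus_right)
        (simp add: add_eq_0_iff)
  qed
  have e: "?e = r o\<^sub>L ?a" "r o\<^sub>L ?a = ?a o\<^sub>L r"
  proof -
    show "?e = r o\<^sub>L ?a"
      by (rule blinfun_eqI)
        (simp add: y_def r_def S_pw bpow_Suc2 blinfun.minus_right blinfun.minus_left blinfun.sum_left blinfun.sum_right blinfun.scaleR_left blinfun.scaleR_right)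
    show "r o\<^sub>L ?a = ?a o\<^sub>L r"
    proof (rule blinfun_eqI)
      fix v
      have "bpow ?a k (?a v) = ?a (bpow ?a k v)" for k
        using arg_cong[OF bpow_Suc2[of ?a k], of "\<lambda>f. blinfun_apply f v"] by (simp add: bpow_Suc)
      then show "(r o\<^sub>L ?a) v = (?a o\<^sub>L r) v"
        by (simp add: r_def blinfun.minus_right blinfun.minus_left blinfun.sum_left blinfun.sum_right blinfun.scaleR_left blinfun.scaleR_right)
    qed
  qed
  define p where "p = bpow ?e n"
  have p: "p = bpow r n o\<^sub>L bpow ?a n" unfolding p_def e(1) by (rule bpow_compose[OF e(2)])
  have aej: "bpow ?a n o\<^sub>L bpow ?e j = bpow ?a n" for j
  proof (induction j)
    case (Suc j)
    have "bpow ?a n o\<^sub>L bpow ?e (Suc j) = (bpow ?a n o\<^sub>L ?e) o\<^sub>L bpow ?e j"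
      by (simp add: bpow_Suc blinfun_compose_assoc)
    then show ?case using Suc by (simp add: ae)
  qed simp
  \<comment> \<open>Together with p = r^n a^n for \<open>a = S x\<close>, this gives p p = r^n (a^n
    p) = p.\<close>
  have ap: "bpow ?a n o\<^sub>L p = bpow ?a n" unfolding p_def by (rule aej)
  have "p o\<^sub>L p = bpow r n o\<^sub>L (bpow ?a n o\<^sub>L p)" by (subst p) (simp add: blinfun_compose_assoc)
  also have "\<dots> = p" using ap p by simp
  finally have pp: "p o\<^sub>L p = p" .
  \<comment> \<open>As \<open>n\<close> is positive, \<open>p\<close> is itself of the form S_z, so
    the hypothesis covers its trace.\<close>
  have "p = S (pw y i)" by (simp add: p_def n_def S_pw)
  then have "endo_trace p = 0" using tr by simp
  then have "p = 0" by (rule idempotent_trace_0[OF fd pp])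
  then have "bpow ?a n = 0" using ap by (metis blinfun_compose_zero(2))
  then show ?thesis by blast
qed

text \<open>A vector killed by 1 + S_x is an eigenvector of S_x for -1; all powers preserve its
  norm, and one of them is zero.\<close>

lemma trace_0_imp_unit_set_UNIV:
  assumes tr: "\<And>x. endo_trace (S x) = 0"
  shows "unit_set S = UNIV"
proof -
  have "inj (blinfun_apply (id_blinfun + S x))" for x
  proof (subst linear_injective_0[OF linear_blinfun_apply], intro allI impI)
    fix v assume "(id_blinfun + S x) v = 0"
    then have av: "m x v = - v" by (simp add: blinfun.add_left eq_neg_iff_add_eq_0 add.commute)
    obtain n where n: "bpow (S x) n = 0" using trace_0_imp_nilpotent[OF tr] by blast
    have "norm (bpow (S x) k v) = norm v" for k
      by (induction k) (simp_all add: bpow_Suc2 av blinfun.minus_right)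
    from this[of n] n show "v = 0" by simp
  qed
  then show ?thesis unfolding unit_set_def using GL_iff_inj[OF fd] by auto
qed

end

section \<open>Bijections\<close>

context comm_alg begin

lemma continuous_map_snd_graph: "continuous_map (graph_group S) (top_of_set (unit_comp S)) snd"
  unfolding graph_group_def by (auto simp: continuous_map_in_subtopology intro!: continuous_intros)

lemma smooth_map_orbit_map_graph: "smooth_map (graph_group S) euclidean orbit_map"
proof (rule smooth_mapI_global[OF _ smooth_on_bounded_linear[OF bounded_linear_snd] open_UNIV])
  have "continuous_map (graph_group S) euclidean snd"
    using continuous_map_snd_graph continuous_map_in_subtopology by blast
  then show "continuous_map (graph_group S) euclidean orbit_map" by (simp add: orbit_map_eq[abs_def])
qed (auto simp: orbit_map_eq)

lemma graph_lie_algebra: "lie_algebra Aff (graph_group S) = range (\<lambda>X. (S X, X))"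
  using graph_tangent_space[OF unit_comp_0] by (simp add: lie_algebra_def)

lemma graph_almost_simply_transitive: "almost_simply_transitive (graph_group S)"
  unfolding almost_simply_transitive_def immersion_def
proof (intro conjI ballI smooth_map_orbit_map_graph)
  have d: "differential (graph_group S) orbit_map p v = snd v" if "v \<in> tangent_space (graph_group S) p" for p v
    by (rule differential_bounded_linear[OF that bounded_linear_snd orbit_map_eq])
  fix p assume "p \<in> topspace (graph_group S)"
  then obtain x where "x \<in> unit_comp S" "p = graph_point S x" by auto
  then have t: "tangent_space (graph_group S) p = range (\<lambda>X. (S X, X))"
    using graph_tangent_space by simp
  show "inj_on (differential (graph_group S) orbit_map p) (tangent_space (graph_group S) p)"
  proof (rule inj_onI)
    fix v w assume vw: "v \<in> tangent_space (graph_group S) p" "w \<in> tangent_space (graph_group S) p"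
      "differential (graph_group S) orbit_map p v = differential (graph_group S) orbit_map p w"
    then have "snd v = snd w" using d by simp
    then show "v = w" using vw(1,2) unfolding t by auto
  qed
next
  have d: "orbit_differential (graph_group S) v = snd v" if "v \<in> lie_algebra Aff (graph_group S)" for v
    using that unfolding orbit_differential_def lie_algebra_def
    by (rule differential_bounded_linear[OF _ bounded_linear_snd orbit_map_eq])
  have "bij_betw snd (lie_algebra Aff (graph_group S)) UNIV"
    unfolding graph_lie_algebra by (auto simp: bij_betw_def inj_on_def image_image)
  then show "bij_betw (orbit_differential (graph_group S)) (lie_algebra Aff (graph_group S)) UNIV"
    by (subst bij_betw_cong[where g = snd]) (rule d)
qed

end

lemma C'_comm_alg_in:
  fixes G :: "('v::real_normed_vector \<Rightarrow>\<^sub>L 'v) topology"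
  assumes fd: "fin_dim TYPE('v)" and G: "lie_subgroup GL G" and S: "S \<in> C' (lie_algebra GL G)"
  shows "comm_alg_in S G"
proof
  show "fin_dim TYPE('v)" "lie_subgroup GL G" by fact+
  show "S x \<in> lie_algebra GL G" for x using S by (simp add: C'_def prolongation_def)
  show "S x y = S y x" for x y
    using S by (simp add: C'_def prolongation_def)
  show "S x (S y z)
      = S y (S x z)" for x y z
  proof -
    have "bracket (S x) (S y) = 0" using S by (simp add: C'_def)
    from arg_cong[OF this, of "\<lambda>f. blinfun_apply f z"] show ?thesis
      by (simp add: bracket_def blinfun.diff_left)
  qed
qed

context comm_alg_in begin

lemma graph_group_AST: "graph_group S \<in> AST G"
proof -
  \<comment> \<open>Continuity for the possibly finer topology of \<open>G\<close>, supplied by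
    \<open>L_in_G\<close>; it makes the inclusion into \<open>Aff_G G\<close> continuous.\<close>
  have cf: "continuous_map (graph_group S) G fst"
  proof (rule continuous_map_eq)
    show "continuous_map (graph_group S) G (L \<circ> snd)"
      by (rule continuous_map_compose[OF continuous_map_snd_graph L_in_G])
  qed (auto simp: graph_point_def)
  have cs: "continuous_map (graph_group S) euclidean snd"
    using continuous_map_snd_graph continuous_map_in_subtopology by blast
  have "smooth_map (graph_group S) (Aff_G G) (\<lambda>h. h)"
    by (rule smooth_mapI_global[OF _ smooth_on_ident open_UNIV])
      (use cf cs in \<open>auto simp: Aff_G_def continuous_map_pairwise o_def\<close>)
  moreover have "inj_on (differential (graph_group S) (\<lambda>h. h) p) (tangent_space (graph_group S) p)" for p
    by (rule inj_onI) (simp add: differential_bounded_linear[OF _ bounded_linear_ident])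
  ultimately have "affine_group_of_type G (graph_group S)"
    using graph_lie_subgroup graph_connected by (simp add: affine_group_of_type_def immersion_def)
  then show ?thesis
    using graph_comm_group graph_almost_simply_transitive by (simp add: AST_def abelian_groups_of_type_def)
qed

lemma linear_part_graph_group: "linear_part (graph_group S) = S"
proof -
  interpret A: ast_group G "graph_group S" using fd graph_group_AST by unfold_locales
  show ?thesis
  proof (rule blinfun_eqI)
    fix X
    have "(linear_part (graph_group S) X, X) \<in> range (\<lambda>X. (S X, X))"
      using A.in_lie_algebra[of X] graph_lie_algebra by simp
    then show "linear_part (graph_group S) X = S X" by auto
  qed
qed

end

lemma bij_betw_linear_part:
  fixes G :: "('v::real_normed_vector \<Rightarrow>\<^sub>L 'v) topology"
  assumes fd: "fin_dim TYPE('v)" and G: "lie_subgroup GL G"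
  shows "bij_betw linear_part (AST G) (C' (lie_algebra GL G))"
proof (rule bij_betw_byWitness[where f' = graph_group])
  show "\<forall>H\<in>AST G. graph_group (linear_part H) = H"
    using ast_group.eq_graph_group[OF ast_group.intro[OF fd]] by metis
  show "\<forall>S\<in>C' (lie_algebra GL G). linear_part (graph_group S) = S"
    using comm_alg_in.linear_part_graph_group[OF C'_comm_alg_in[OF fd G]] by blast
  show "linear_part ` AST G \<subseteq> C' (lie_algebra GL G)"
    using ast_group.linear_part_in_C'[OF ast_group.intro[OF fd]] by blast
  show "graph_group ` C' (lie_algebra GL G) \<subseteq> AST G"
    using comm_alg_in.graph_group_AST[OF C'_comm_alg_in[OF fd G]] by blast
qed

text \<open>The smooth inverse \<open>g\<close> of the orbit map recovers each tangent vector from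
  its translational part, which gives injectivity of the differential; images under \<open>g\<close>
  of the lines t X give surjectivity at the unit.\<close>

lemma ST_subset_AST:
  fixes G :: "('v::real_normed_vector \<Rightarrow>\<^sub>L 'v) topology"
  assumes fd: "fin_dim TYPE('v)" and H: "H \<in> ST G"
  shows "H \<in> AST G"
proof -
  have ab: "H \<in> abelian_groups_of_type G" and "diffeomorphism H euclidean orbit_map"
    using H by (auto simp: ST_def simply_transitive_def)
  then obtain g where sm: "smooth_map H euclidean orbit_map" and g: "smooth_map euclidean H g"
    "\<And>h. h \<in> topspace H \<Longrightarrow> g (snd h) = h" "\<And>y. snd (g y) = y"
    by (auto simp: diffeomorphism_def orbit_map_eq)
  have lie: "lie_subgroup Aff H" using ab by (simp add: abelian_groups_of_type_def affine_group_of_type_def)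
  have "\<exists>g'. (g has_derivative g') (at y)" for y
  proof -
    have "\<exists>U \<Omega> F. openin euclidean U \<and> y \<in> U \<and> open \<Omega> \<and> U \<subseteq> \<Omega> \<and> smooth_on \<Omega> F \<and> (\<forall>x\<in>U. g x = F x)"
      using bspec[OF conjunct2[OF g(1)[unfolded smooth_map_def]], of y] by simp
    then obtain U \<Omega> F where "openin euclidean U \<and> y \<in> U \<and> open \<Omega> \<and> U \<subseteq> \<Omega> \<and> smooth_on \<Omega> F \<and> (\<forall>x\<in>U. g x = F x)"
      by (elim exE) (rule that)
    then have F: "open U" "y \<in> U" "open \<Omega>" "U \<subseteq> \<Omega>" "smooth_on \<Omega> F" "\<forall>x\<in>U. g x = F x" by simp_all
    have "(F has_derivative frechet_derivative F (at y)) (at y)"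
      using smooth_on_has_derivative[OF F(5)] F by blast
    then have "(g has_derivative frechet_derivative F (at y)) (at y)"
      by (rule has_derivative_transform_within_open[OF _ F(1,2)]) (use F in auto)
    then show ?thesis by blast
  qed
  then obtain g' where g': "\<And>y. (g has_derivative g' y) (at y)" by metis
  have curve: "((\<lambda>t. g (s t)) has_vector_derivative g' (s 0) X) (at 0)"
    if "(s has_vector_derivative X) (at 0)" for s :: "real \<Rightarrow> 'v" and X
  proof -
    have "((\<lambda>t. g (s t)) has_derivative (\<lambda>t. g' (s 0) (t *\<^sub>R X))) (at 0)"
      using that unfolding has_vector_derivative_def by (rule has_derivative_compose[OF _ g'])
    then show ?thesis unfolding has_vector_derivative_def
      by (simp add: linear_cmul[OF has_derivative_linear[OF g']])
  qed
  have tan: "v = g' (snd p) (snd v)" if v: "v \<in> tangent_space H p" for p v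
  proof -
    obtain c \<epsilon> where c: "\<epsilon> > 0" "smooth_map (top_of_set {-\<epsilon><..<\<epsilon>}) H c" "c 0 = p" "(c has_vector_derivative v) (at 0)"
      using v by (auto simp: tangent_space_def curve_through_def)
    have "c t \<in> topspace H" if "t \<in> {-\<epsilon><..<\<epsilon>}" for t
      using c(2) that by (auto simp: smooth_map_def continuous_map_def Pi_iff)
    then have gc: "g (snd (c t)) = c t" if "t \<in> {-\<epsilon><..<\<epsilon>}" for t using that g(2) by blast
    have "((\<lambda>t. g (snd (c t))) has_vector_derivative g' (snd p) (snd v)) (at 0)"
      using curve[OF bounded_linear.has_vector_derivative[OF bounded_linear_snd c(4)]] c(3) by simp
    then have "(c has_vector_derivative g' (snd p) (snd v)) (at 0)"
      by (rule has_vector_derivative_transform_within_open[where S = "{-\<epsilon><..<\<epsilon>}"]) (use c(1) gc in auto)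
    then show ?thesis using c(4) vector_derivative_unique_at by blast
  qed
  have d: "differential H orbit_map p v = snd v" if "v \<in> tangent_space H p" for p v
    by (rule differential_bounded_linear[OF that bounded_linear_snd orbit_map_eq])
  have inj: "inj_on (differential H orbit_map p) (tangent_space H p)" for p
    by (rule inj_onI) (metis d tan)
  have one: "\<one>\<^bsub>Aff\<^esub> \<in> topspace H" using lie by (auto simp: lie_subgroup_def dest: subgroup.one_closed)
  have g0: "g 0 = \<one>\<^bsub>Aff\<^esub>" using g(2)[OF one] by simp
  have "X \<in> orbit_differential H ` lie_algebra Aff H" for X
  proof -
    have "smooth_map (top_of_set {-1<..<1::real}) euclidean (\<lambda>t. t *\<^sub>R X)"
      by (rule smooth_mapI_global[OF _ smooth_on_bounded_linear[OF bounded_linear_scaleR_left] open_UNIV])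
        (auto intro!: continuous_intros)
    moreover have dX: "((\<lambda>t. t *\<^sub>R X) has_vector_derivative X) (at 0)"
      by (auto intro!: derivative_eq_intros simp: has_vector_derivative_def)
    ultimately have "curve_through euclidean 0 X (\<lambda>t. t *\<^sub>R X)"
      unfolding curve_through_def by (auto intro!: exI[of _ 1])
    from curve_through_image[OF fd g(1) this, of "g' 0 X"] curve[OF dX]
    have v: "g' 0 X \<in> lie_algebra Aff H" by (auto simp: lie_algebra_def tangent_space_def g0)
    have "((\<lambda>t. snd (g (t *\<^sub>R X))) has_vector_derivative snd (g' 0 X)) (at 0)"
      using bounded_linear.has_vector_derivative[OF bounded_linear_snd curve[OF dX]] by simp
    then have "snd (g' 0 X) = X" using dX vector_derivative_unique_at by (simp add: g(3)) blast
    then have "orbit_differential H (g' 0 X) = X"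
      using d v unfolding orbit_differential_def lie_algebra_def by simp
    then show ?thesis using v by force
  qed
  then have "bij_betw (orbit_differential H) (lie_algebra Aff H) UNIV"
    using inj[of "\<one>\<^bsub>Aff\<^esub>"] by (auto simp: bij_betw_def orbit_differential_def lie_algebra_def)
  then show ?thesis using ab sm inj by (simp add: AST_def almost_simply_transitive_def immersion_def)
qed

text \<open>On a graph the orbit map is the projection to the vector space. It is onto only if every
  \<open>x\<close> lies in \<open>unit_set S\<close>, and then \<open>graph_point S\<close> is a
  smooth inverse.\<close>

lemma ST_iff:
  fixes G :: "('v::real_normed_vector \<Rightarrow>\<^sub>L 'v) topology"
  assumes fd: "fin_dim TYPE('v)"
  shows "H \<in> ST G \<longleftrightarrow> H \<in> AST G \<and> (\<forall>X. endo_trace (linear_part H X) = 0)"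
proof (cases "H \<in> AST G")
  case True
  interpret ast_group G H using fd True by unfold_locales
  have eq: "H = graph_group S" by (rule eq_graph_group)
  have "H \<in> ST G \<longleftrightarrow> simply_transitive H" using True by (auto simp: ST_def AST_def)
  also have "\<dots> \<longleftrightarrow> unit_set S = UNIV"
  proof
    assume "simply_transitive H"
    then obtain g where g: "smooth_map euclidean H g" "\<And>y. snd (g y) = y"
      by (auto simp: simply_transitive_def diffeomorphism_def orbit_map_eq)
    have "y \<in> unit_set S" for y
    proof -
      have "g y \<in> topspace H" using g(1) by (auto simp: smooth_map_def continuous_map_def)
      then have "snd (g y) \<in> snd ` graph_point S ` unit_comp S" unfolding topspace_eq by (rule imageI)
      then have "y \<in> unit_comp S" by (simp only: snd_image_graph_point g(2))
      then show ?thesis using unit_comp_subset by blast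
    qed
    then show "unit_set S = UNIV" by auto
  next
    assume "unit_set S = UNIV"
    then have U: "unit_comp S = UNIV" by (simp add: unit_comp_def connected_component_UNIV)
    have "smooth_map euclidean (graph_group S) (graph_point S)"
    proof (rule smooth_map_into_graph[OF subset_UNIV open_UNIV])
      show "smooth_on UNIV (graph_point S)" unfolding graph_point_def
        by (intro smooth_on_Pair open_UNIV smooth_on_add smooth_on_const smooth_on_ident smooth_on_bounded_linear blinfun.bounded_linear_right)
    qed (auto simp: U)
    then have g: "smooth_map euclidean H (graph_point S)" unfolding eq[symmetric] .
    have o: "smooth_map H euclidean orbit_map" using smooth_map_orbit_map_graph unfolding eq[symmetric] .
    show "simply_transitive H"
      unfolding simply_transitive_def diffeomorphism_def
      by (intro conjI exI[of _ "graph_point S"] ballI g o) (simp_all add: orbit_map_eq element_eq[symmetric])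
  qed
  also have "\<dots> \<longleftrightarrow> (\<forall>X. endo_trace (S X) = 0)"
    using unit_set_UNIV_imp_trace_0 trace_0_imp_unit_set_UNIV by blast
  finally show ?thesis using True by blast
qed (use ST_subset_AST[OF fd] in blast)

section \<open>The quadratic cone\<close>

lemma subspace_prolongation:
  assumes "subspace \<gg>" shows "subspace (prolongation \<gg>)"
  using assms unfolding prolongation_def
  by (auto simp: subspace_def blinfun.add_left blinfun.scaleR_left blinfun.zero_left)

text \<open>The coefficients of the commutators of the endomorphisms S_b for basis vectors b are
  finitely many quadratic forms in \<open>S\<close>. Their homogeneity makes the zero set a union of
  lines.\<close>

lemma C'_cone:
  fixes \<gg> :: "('v::real_normed_vector \<Rightarrow>\<^sub>L 'v) set"
  assumes fd: "fin_dim TYPE('v)" and \<gg>: "subspace \<gg>"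
  shows "\<exists>Z. quadratic_projective_variety (prolongation \<gg>) Z \<and> C' \<gg> = affine_cone Z"
proof -
  obtain B :: "'v set" where B: "finite B" "independent B" "span B = UNIV" using fin_dim_basis[OF fd] .
  \<comment> \<open>A bilinear polarisation of the coefficient at \<open>f\<close> of [S_b, S_b']
    applied to \<open>e\<close>; on the diagonal it is that coefficient.\<close>
  define \<beta> where "\<beta> i S T = (case i of (b, b', e, f) \<Rightarrow>
      representation B (S b (T b' e)
        - S b' (T b e)) f)"
    for i and S T :: "'v \<Rightarrow>\<^sub>L 'v \<Rightarrow>\<^sub>L 'v"
  define I where "I = B \<times> B \<times> B \<times> B"
  define Q where "Q = (\<lambda>i S. \<beta> i S S) ` I"
  note rl = linear_add[OF representation_linear[OF B(2,3)]] linear_cmul[OF representation_linear[OF B(2,3)]]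
    linear_diff[OF representation_linear[OF B(2,3)]]
  have bil: "bilinear (\<beta> i)" for i
    unfolding bilinear_def \<beta>_def
    by (auto split: prod.split intro!: linearI
      simp: blinfun.add_left blinfun.add_right blinfun.scaleR_left blinfun.scaleR_right rl algebra_simps)
  have C'_iff: "S \<in> C' \<gg> \<longleftrightarrow> S \<in> prolongation \<gg> \<and> (\<forall>q\<in>Q. q S = 0)" for S
  proof -
    have "(\<forall>X Y. bracket (S X) (S Y) = 0) \<longleftrightarrow> (\<forall>i\<in>I. \<beta> i S S = 0)"
    proof
      assume a: "\<forall>X Y. bracket (S X) (S Y) = 0"
      have "S X (S Y z)
        - S Y (S X z) = 0" for X Y z
        using arg_cong[OF a[rule_format, of X Y], of "\<lambda>f. blinfun_apply f z"] by (simp add: bracket_def blinfun.diff_left)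
      then show "\<forall>i\<in>I. \<beta> i S S = 0" by (auto simp: \<beta>_def linear_0[OF representation_linear[OF B(2,3)]])
    next
      assume a: "\<forall>i\<in>I. \<beta> i S S = 0"
      \<comment> \<open>Trilinear in its arguments, so vanishing on basis triples extends to all
        arguments, one at a time.\<close>
      define d where "d X Y z = S X (S Y z)
        - S Y (S X z)" for X Y z
      have 1: "d X Y z = 0" if "X \<in> B" "Y \<in> B" "z \<in> B" for X Y z
      proof -
        have "representation B (d X Y z) f = 0" if "f \<in> B" for f
          using a \<open>X \<in> B\<close> \<open>Y \<in> B\<close> \<open>z \<in> B\<close> that by (auto simp: I_def \<beta>_def d_def)
        then have "(\<Sum>f\<in>B. representation B (d X Y z) f *\<^sub>R f) = 0" by simp
        then show ?thesis using sum_representation_eq[OF B(2), of "d X Y z" B] B by auto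
      qed
      have lin: "linear (\<lambda>z. d X Y z)" "linear (\<lambda>Y. d X Y z)" "linear (\<lambda>X. d X Y z)" for X Y z
        unfolding d_def
        by (auto intro!: linearI simp: blinfun.add_left blinfun.add_right blinfun.scaleR_left blinfun.scaleR_right algebra_simps)
      have ext: "h z = 0" if "linear h" "\<And>b. b \<in> B \<Longrightarrow> h b = 0" for h :: "'v \<Rightarrow> 'v" and z
        by (rule linear_eq_0_on_span[OF that]) (use B in auto)
      have 2: "d X Y z = 0" if "X \<in> B" "Y \<in> B" for X Y z by (rule ext[OF lin(1)]) (rule 1[OF that])
      have 3: "d X Y z = 0" if "X \<in> B" for X Y z by (rule ext[OF lin(2)]) (rule 2[OF that])
      have 4: "d X Y z = 0" for X Y z by (rule ext[OF lin(3)]) (rule 3)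
      show "\<forall>X Y. bracket (S X) (S Y) = 0"
        using 4 by (auto intro!: blinfun_eqI simp: bracket_def blinfun.diff_left d_def)
    qed
    then show ?thesis by (auto simp: C'_def Q_def)
  qed
  define Z where "Z = {l \<in> projective_space (prolongation \<gg>). \<forall>q\<in>Q. \<forall>x\<in>l. q x = 0}"
  have "quadratic_projective_variety (prolongation \<gg>) Z"
    unfolding quadratic_projective_variety_def
  proof (intro conjI exI[of _ Q])
    show "subspace (prolongation \<gg>)" by (rule subspace_prolongation[OF \<gg>])
    show "finite Q" using B(1) by (simp add: Q_def I_def)
    show "\<forall>q\<in>Q. quadratic_form q"
    proof
      fix q assume "q \<in> Q"
      then obtain i where "q = (\<lambda>S. \<beta> i S S)" by (auto simp: Q_def)
      then show "quadratic_form q" unfolding quadratic_form_def using bil by (intro exI[of _ "\<beta> i"]) simp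
    qed
  qed (rule Z_def)
  moreover have "C' \<gg> = affine_cone Z"
  proof (intro equalityI subsetI)
    fix S assume S: "S \<in> C' \<gg>"
    show "S \<in> affine_cone Z"
    \<comment> \<open>The zero element spans no line and is the apex that \<open>affine_cone\<close>
      adds.\<close>
    proof (cases "S = 0")
      case False
      have "span {S} \<subseteq> prolongation \<gg>"
        by (rule span_minimal[OF _ subspace_prolongation[OF \<gg>]]) (use S in \<open>simp add: C'_def\<close>)
      moreover have "dim (span {S}) = 1"
        using dim_span_eq_card_independent[of "{S}"] False by simp
      moreover have "q x = 0" if q: "q \<in> Q" and x: "x \<in> span {S}" for q x
      proof -
        obtain c where c: "x = c *\<^sub>R S" using x by (auto simp: span_singleton)
        obtain i where i: "q = (\<lambda>S. \<beta> i S S)" using q by (auto simp: Q_def)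
        have "q S = 0" using S C'_iff q by blast
        then show ?thesis by (simp add: i c bilinear_lmul[OF bil] bilinear_rmul[OF bil])
      qed
      ultimately have "span {S} \<in> Z" by (auto simp: Z_def projective_space_def)
      then show ?thesis using span_base[of S "{S}"] by (auto simp: affine_cone_def)
    qed (simp add: affine_cone_def)
  next
    fix S assume "S \<in> affine_cone Z"
    moreover have "0 \<in> C' \<gg>"
      unfolding C'_iff using subspace_0[OF subspace_prolongation[OF \<gg>]] bilinear_lzero[OF bil] by (auto simp: Q_def)
    ultimately show "S \<in> C' \<gg>"
      unfolding C'_iff by (auto simp: affine_cone_def Z_def projective_space_def)
  qed
  ultimately show ?thesis by blast
qed

section \<open>The action by conjugation\<close>

lemma act_apply:
  fixes a :: "'v::real_normed_vector \<Rightarrow>\<^sub>L 'v"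
  shows "act a S X = a o\<^sub>L S ((inv\<^bsub>GL\<^esub> a) X) o\<^sub>L inv\<^bsub>GL\<^esub> a"
  unfolding act_def
  by (rule fun_cong[OF bounded_linear_Blinfun_apply])
    (intro bounded_linear_compose[OF bounded_bilinear.bounded_linear_left[OF bounded_bilinear_blinfun_compose]
      bounded_linear_compose[OF bounded_bilinear.bounded_linear_right[OF bounded_bilinear_blinfun_compose]]]
      bounded_linear_compose[OF blinfun.bounded_linear_right] blinfun.bounded_linear_right)

lemma linear_act: "linear (act a)"
  by (intro linearI blinfun_eqI)
    (simp_all add: act_apply blinfun.add_left blinfun.add_right blinfun.scaleR_left blinfun.scaleR_right)

lemma act_one:
  fixes S :: "'v::real_normed_vector \<Rightarrow>\<^sub>L 'v \<Rightarrow>\<^sub>L 'v"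
  shows "act id_blinfun S = S"
proof -
  have "inv\<^bsub>GL\<^esub> id_blinfun = (id_blinfun :: 'v \<Rightarrow>\<^sub>L 'v)" by (rule GL_inv_eqI) auto
  then show ?thesis by (intro blinfun_eqI) (simp add: act_apply)
qed

lemma act_mult:
  assumes "a \<in> carrier GL" "b \<in> carrier GL"
  shows "act (a o\<^sub>L b) S = act a (act b S)"
proof -
  have "inv\<^bsub>GL\<^esub> (a o\<^sub>L b) = inv\<^bsub>GL\<^esub> b o\<^sub>L inv\<^bsub>GL\<^esub> a"
    using group.inv_mult_group[OF group_GL assms] by simp
  then show ?thesis by (intro blinfun_eqI) (simp add: act_apply)
qed

lemma act_inverse:
  assumes "a \<in> carrier GL" shows "act (inv\<^bsub>GL\<^esub> a) (act a S) = S"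
  using act_mult[OF group.inv_closed[OF group_GL assms] assms, of S] by (simp add: GL_inv_compose[OF assms] act_one)

lemma act_prolongation:
  fixes G :: "('v::real_normed_vector \<Rightarrow>\<^sub>L 'v) topology"
  assumes fd: "fin_dim TYPE('v)" and G: "lie_subgroup GL G" and a: "a \<in> topspace G"
    and S: "S \<in> prolongation (lie_algebra GL G)"
  shows "act a S \<in> prolongation (lie_algebra GL G)"
  using S GL_Ad_lie_algebra[OF fd G a] by (auto simp: prolongation_def act_apply)

lemma act_C':
  fixes G :: "('v::real_normed_vector \<Rightarrow>\<^sub>L 'v) topology"
  assumes fd: "fin_dim TYPE('v)" and G: "lie_subgroup GL G" and a: "a \<in> topspace G"
    and S: "S \<in> C' (lie_algebra GL G)"
  shows "act a S \<in> C' (lie_algebra GL G)"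
proof -
  have aGL: "a \<in> carrier GL" by (rule lie_subgroup_carrier[OF G a])
  interpret comm_alg_in S G by (rule C'_comm_alg_in[OF fd G S])
  have "bracket (act a S X) (act a S Y) = 0" for X Y
    by (rule blinfun_eqI) (simp add: bracket_def act_apply blinfun.diff_left GL_inv_apply[OF aGL] comm)
  then show ?thesis using act_prolongation[OF fd G a] S by (simp add: C'_def)
qed

text \<open>Hence conjugation by \<open>a\<close> takes the graph point over \<open>x\<close> to the
  graph point of \<open>act a S\<close> over \<open>a x\<close>.\<close>

lemma act_L:
  assumes a: "a \<in> carrier GL"
  shows "id_blinfun + act a S (a x) = a o\<^sub>L (id_blinfun + S x) o\<^sub>L inv\<^bsub>GL\<^esub> a"
  by (rule blinfun_eqI) (simp add: act_apply GL_inv_apply[OF a] blinfun.add_left blinfun.add_right)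

lemma act_unit_comp_subset:
  assumes a: "a \<in> carrier GL"
  shows "blinfun_apply a ` unit_comp S \<subseteq> unit_comp (act a S)"
proof (rule unit_comp_maximal[OF unit_comp_0])
  show "0 \<in> blinfun_apply a ` unit_comp S" using unit_comp_0 by (force intro: image_eqI[of _ _ 0])
  show "connected (blinfun_apply a ` unit_comp S)"
    by (intro connected_continuous_image connected_unit_comp continuous_intros)
  show "blinfun_apply a ` unit_comp S \<subseteq> unit_set (act a S)"
  proof clarify
    fix x assume "x \<in> unit_comp S"
    then have "id_blinfun + S x \<in> carrier GL" by (rule unit_compD)
    then have "(a \<otimes>\<^bsub>GL\<^esub> (id_blinfun + S x)) \<otimes>\<^bsub>GL\<^esub> inv\<^bsub>GL\<^esub> a \<in> carrier GL"
      using a by (intro monoid.m_closed[OF group.is_monoid[OF group_GL]] group.inv_closed[OF group_GL])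
    then show "a x \<in> unit_set (act a S)" by (simp add: unit_set_def act_L[OF a])
  qed
qed

text \<open>The reverse inclusion is \<open>act_unit_comp_subset\<close> for the inverse of
  \<open>a\<close> and \<open>act a S\<close>.\<close>

lemma act_unit_comp:
  assumes a: "a \<in> carrier GL"
  shows "unit_comp (act a S) = blinfun_apply a ` unit_comp S"
proof
  show "unit_comp (act a S) \<subseteq> blinfun_apply a ` unit_comp S"
  proof
    fix y assume "y \<in> unit_comp (act a S)"
    then have "(inv\<^bsub>GL\<^esub> a) y \<in> unit_comp S"
      using act_unit_comp_subset[OF group.inv_closed[OF group_GL a], of "act a S"] act_inverse[OF a] by auto
    then show "y \<in> blinfun_apply a ` unit_comp S" using GL_inv_apply(2)[OF a] by (metis imageI)
  qed
qed (rule act_unit_comp_subset[OF a])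

lemma openin_push_topology:
  assumes "inj_on f (topspace M)"
  shows "openin (push_topology f M) X \<longleftrightarrow> (\<exists>U. openin M U \<and> X = f ` U)"
proof -
  have "inv_into (topspace M) f -` U \<inter> f ` topspace M = f ` U" if "openin M U" for U
    using openin_subset[OF that] assms by (auto simp: subset_iff)
  then show ?thesis unfolding push_topology_def openin_pullback_topology by metis
qed

text \<open>On projections, conjugation is the linear homeomorphism \<open>a\<close>, so the pushed
  topology and the graph topology have the same open sets.\<close>

lemma conj_group_graph_group:
  fixes S :: "'v::real_normed_vector \<Rightarrow>\<^sub>L 'v \<Rightarrow>\<^sub>L 'v"
  assumes fd: "fin_dim TYPE('v)" and a: "a \<in> carrier GL"
  shows "conj_group a (graph_group S) = graph_group (act a S)"
proof -
  define \<phi> where "\<phi> h = (a, 0) \<otimes>\<^bsub>Aff\<^esub> h \<otimes>\<^bsub>Aff\<^esub> inv\<^bsub>Aff\<^esub> (a, 0)" for h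
  have \<phi>: "\<phi> (graph_point S x) = graph_point (act a S) (a x)" for x
    by (simp add: \<phi>_def graph_point_def Aff_inv[OF a] act_L[OF a])
  have snd\<phi>: "snd (\<phi> h) = a (snd h)" for h
    by (cases h) (simp add: \<phi>_def Aff_inv[OF a])
  have inj: "inj_on \<phi> (topspace (graph_group S))"
  proof (rule inj_onI)
    fix h h' assume h: "h \<in> topspace (graph_group S)" "h' \<in> topspace (graph_group S)" "\<phi> h = \<phi> h'"
    then have "a (snd h) = a (snd h')" by (metis snd\<phi>)
    then have "snd h = snd h'" by (metis GL_inv_apply(1)[OF a])
    then show "h = h'" using h by auto
  qed
  have img: "\<phi> ` graph_point S ` unit_comp S = graph_point (act a S) ` unit_comp (act a S)"
    by (simp add: act_unit_comp[OF a] image_image \<phi>)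
  have pre: "blinfun_apply a ` A = blinfun_apply (inv\<^bsub>GL\<^esub> a) -` A" for A
    by (auto simp: GL_inv_apply[OF a] image_iff) (metis GL_inv_apply(2)[OF a])
  have inja: "inj (blinfun_apply a)" by (metis injI GL_inv_apply(1)[OF a])
  have open_image: "open (blinfun_apply a ` A)" if "open A" for A
    unfolding pre by (rule open_vimage[OF that]) (intro continuous_intros)
  have open_vim: "open (blinfun_apply a -` A)" if "open A" for A
    by (rule open_vimage[OF that]) (intro continuous_intros)
  have "openin (push_topology \<phi> (graph_group S)) X \<longleftrightarrow> openin (graph_group (act a S)) X" for X
    unfolding openin_push_topology[OF inj] openin_graph_group[OF fd]
  proof (intro iffI; elim exE conjE)
    fix U assume U: "U \<subseteq> graph_point S ` unit_comp S" "open (snd ` U)" "X = \<phi> ` U"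
    have "X \<subseteq> graph_point (act a S) ` unit_comp (act a S)"
      unfolding U(3) img[symmetric] by (rule image_mono[OF U(1)])
    moreover have "snd ` X = blinfun_apply a ` snd ` U" by (simp add: U(3) image_image snd\<phi>)
    ultimately show "X \<subseteq> graph_point (act a S) ` unit_comp (act a S) \<and> open (snd ` X)"
      using open_image[OF U(2)] by simp
  next
    assume X: "X \<subseteq> graph_point (act a S) ` unit_comp (act a S)" "open (snd ` X)"
    define U where "U = {h \<in> graph_point S ` unit_comp S. \<phi> h \<in> X}"
    have XU: "X = \<phi> ` U" using X(1) unfolding U_def img[symmetric] by blast
    then have "snd ` X = blinfun_apply a ` snd ` U" by (simp add: image_image snd\<phi>)
    then have "blinfun_apply a -` (snd ` X) = snd ` U"
      using inj_vimage_image_eq[OF inja] by simp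
    then have "open (snd ` U)" using open_vim[OF X(2)] by simp
    moreover have "U \<subseteq> graph_point S ` unit_comp S" by (simp add: U_def)
    ultimately show "\<exists>U. (U \<subseteq> graph_point S ` unit_comp S \<and> open (snd ` U)) \<and> X = \<phi> ` U"
      using XU by (intro exI[of _ U] conjI)
  qed
  then have "push_topology \<phi> (graph_group S) = graph_group (act a S)"
    by (intro topology_eq[THEN iffD2] allI)
  then show ?thesis by (simp only: conj_group_def \<phi>_def[abs_def])
qed

theorem theorem6:
  fixes G :: "('v::real_normed_vector \<Rightarrow>\<^sub>L 'v) topology"
    and \<gg> :: "('v \<Rightarrow>\<^sub>L 'v) set"
    and B :: "'v set"
  assumes "finite_dimensional_vector_space (scaleR :: real \<Rightarrow> 'v \<Rightarrow> 'v) B"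
    and "lie_subgroup GL G"
    and "\<gg> = lie_algebra GL G"
  shows "bij_betw linear_part (AST G) (C' \<gg>) \<and>
    ST G \<subseteq> AST G \<and>
    bij_betw linear_part (ST G) (C0 \<gg>) \<and>
    (\<exists>Z. quadratic_projective_variety (prolongation \<gg>) Z \<and>
         linear_part ` AST G = affine_cone Z) \<and>
    (\<exists>\<Lambda> :: (('v \<Rightarrow>\<^sub>L 'v \<Rightarrow>\<^sub>L 'v) \<Rightarrow> real) set.
         finite \<Lambda> \<and> (\<forall>l\<in>\<Lambda>. linear l) \<and>
         ST G = {H \<in> AST G. \<forall>l\<in>\<Lambda>. l (linear_part H) = 0}) \<and>
    (\<forall>a\<in>topspace G.
         linear (act a) \<and> act a ` prolongation \<gg> \<subseteq> prolongation \<gg> \<and>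
         (\<forall>H\<in>AST G. conj_group a H \<in> AST G \<and>
                      linear_part (conj_group a H) = act a (linear_part H))) \<and>
    (\<forall>S\<in>prolongation \<gg>. act \<one>\<^bsub>GL\<^esub> S = S) \<and>
    (\<forall>a\<in>topspace G. \<forall>b\<in>topspace G. \<forall>S\<in>prolongation \<gg>. act (a \<otimes>\<^bsub>GL\<^esub> b) S = act a (act b S))"
proof -
  note G = assms(2) and \<gg> = assms(3)
  have fd: "fin_dim TYPE('v)" by (rule fin_dim_of_locale[OF assms(1)])
  have sub: "subspace \<gg>" unfolding \<gg> by (rule lie_algebra_subspace[OF fin_dim_blinfun[OF fd fd] G])
  have bij: "bij_betw linear_part (AST G) (C' \<gg>)" unfolding \<gg> by (rule bij_betw_linear_part[OF fd G])
  have ST: "ST G = {H \<in> AST G. \<forall>X. endo_trace (linear_part H X) = 0}"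
    using ST_iff[OF fd] by blast
  have "linear_part ` ST G = C0 \<gg>"
    unfolding ST C0_def bij_betw_imp_surj_on[OF bij, symmetric] by auto
  then have bij0: "bij_betw linear_part (ST G) (C0 \<gg>)"
    using bij unfolding bij_betw_def by (metis (no_types, lifting) ST inj_on_subset mem_Collect_eq subsetI)
  have cone: "\<exists>Z. quadratic_projective_variety (prolongation \<gg>) Z \<and> linear_part ` AST G = affine_cone Z"
    using C'_cone[OF fd sub] bij_betw_imp_surj_on[OF bij] by simp
  have lin: "\<exists>\<Lambda> :: (('v \<Rightarrow>\<^sub>L 'v \<Rightarrow>\<^sub>L 'v) \<Rightarrow> real) set.
         finite \<Lambda> \<and> (\<forall>l\<in>\<Lambda>. linear l) \<and> ST G = {H \<in> AST G. \<forall>l\<in>\<Lambda>. l (linear_part H) = 0}"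
  proof -
    \<comment> \<open>The trace of \<open>S X\<close> is linear in \<open>X\<close>, so the
      equations for a finite spanning set suffice.\<close>
    obtain A :: "'v set" where A: "finite A" "span A = UNIV" using fd by (auto simp: fin_dim_def)
    define l where "l b S = endo_trace (S b)" for b and S :: "'v \<Rightarrow>\<^sub>L 'v \<Rightarrow>\<^sub>L 'v"
    note tl = linear_add[OF linear_endo_trace[OF fd]] linear_cmul[OF linear_endo_trace[OF fd]]
    have "linear (l b)" for b
      by (rule linearI) (simp_all add: l_def blinfun.add_left blinfun.scaleR_left tl)
    moreover have "(\<forall>X. endo_trace (S X) = 0) \<longleftrightarrow> (\<forall>k\<in>l ` A. k S = 0)" for S :: "'v \<Rightarrow>\<^sub>L 'v \<Rightarrow>\<^sub>L 'v"
    proof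
      assume a: "\<forall>k\<in>l ` A. k S = 0"
      have "linear (\<lambda>X. endo_trace (S X))"
        by (rule linearI) (simp_all add: blinfun.add_right blinfun.scaleR_right tl)
      from linear_eq_0_on_span[OF this, of A] show "\<forall>X. endo_trace (S X) = 0"
        using a A(2) by (auto simp: l_def)
    qed (auto simp: l_def)
    ultimately show ?thesis using A(1) unfolding ST by (intro exI[of _ "l ` A"]) auto
  qed
  \<comment> \<open>Since \<open>H\<close> is the graph of its linear part, its conjugate is the
    graph of the transformed one, and both the membership and the linear part of a graph are already
    known.\<close>
  have conj: "conj_group a H \<in> AST G \<and> linear_part (conj_group a H) = act a (linear_part H)"
    if a: "a \<in> topspace G" and H: "H \<in> AST G" for a H
  proof -
    have aGL: "a \<in> carrier GL" by (rule lie_subgroup_carrier[OF G a])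
    interpret ast_group G H using fd H by unfold_locales
    interpret A: comm_alg_in "act a S" G
      by (rule C'_comm_alg_in[OF fd G act_C'[OF fd G a linear_part_in_C']])
    have "conj_group a H = graph_group (act a S)"
      using conj_group_graph_group[OF fd aGL] eq_graph_group by metis
    then show ?thesis using A.graph_group_AST A.linear_part_graph_group by simp
  qed
  have mult: "act (a o\<^sub>L b) S = act a (act b S)" if "a \<in> topspace G" "b \<in> topspace G" for a b S
    using act_mult lie_subgroup_carrier[OF G] that by blast
  show ?thesis
    using bij ST bij0 cone lin conj mult linear_act act_prolongation[OF fd G] unfolding \<gg>
    by (auto simp: act_one)
qed

end
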